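(* Let $P$ be a pseudo-polygon and let $(p_i,p_j)$ be any invisible pair in $P$. Then there is exactly one designated blocker $p_k$ for $(p_i,p_j)$. Moreover, $p_k$ is a candidate blocker for the invisible pair $(p_i,p_j)$ in the visibility graph of $P$.
   Context: **Pseudo-polygons.** An arrangement of pseudo-lines is a collection of simple curves in $\mathbb{R}^2$, each of which separates the plane, such that each pair of them intersects at exactly one point, where they cross. Let $P=\{p_0,\dots,p_{n-1}\}$ ($n\ge 3$) be a set of points in $\mathbb{R}^2$ and $\mathcal{L}$ an arrangement of $\binom n2$ pseudo-lines such that every pair of points $p_i,p_j$ lies on exactly one pseudo-line of $\mathcal{L}$, denoted $L_{i,j}$, and every pseudo-line in $\mathcal{L}$ contains exactly two points of $P$; $(P,\mathcal{L})$ is a pseudo configuration of points in general position. The subsegment of $L_{i,j}$ connecting $p_i$ and $p_j$ is the segment $p_ip_j$; removing it leaves two rays, one starting at $p_i$ and moving away from $p_j$, the other starting at $p_j$ and moving away from $p_i$. Indices are modulo $n$. Let $e_i$ be the segment $p_ip_{i+1}$. The segments $e_0,\dots,e_{n-1}$ form a pseudo-polygon (with boundary edges $e_i$) if $e_i\cap e_{i+1}=\{p_{i+1}\}$ for all $i$ and non-consecutive $e_i,e_j$ are disjoint. Vertices are indexed in counterclockwise order along the boundary. The pseudo-polygon separates the plane into an inside and an outside; two vertices $p_i,p_j$ see each other if the segment $p_ip_j$ does not go outside the pseudo-polygon. The visibility graph of the pseudo-polygon has the vertices $p_0,\dots,p_{n-1}$, with an edge $\{p_i,p_j\}$ iff $p_i$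 and $p_j$ see each other. **Combinatorial notions.** $\partial(p_i,p_j)$ denotes the vertices and boundary edges encountered when walking counterclockwise along the boundary from $p_i$ to $p_j$ (inclusive). Two vertices that see each other form a visible pair $\{p_i,p_j\}$ (unordered). If distinct $p_i,p_j$ do not see each other, both ordered pairs $(p_i,p_j)$ and $(p_j,p_i)$ are called invisible pairs. **Designated blocker.** Let $(p_i,p_j)$ be an invisible pair. A vertex $p_k\in\partial(p_i,p_j)$ is a designated blocker for $(p_i,p_j)$ if $p_i$ sees $p_k$ and the ray of $L_{i,k}$ starting at $p_k$ and moving away from $p_i$ first exits the pseudo-polygon through a boundary edge in $\partial(p_j,p_i)$. Similarly, $p_k\in\partial(p_j,p_i)$ is a designated blocker for $(p_i,p_j)$ if $p_i$ sees $p_k$ and the ray of $L_{i,k}$ starting at $p_k$ and moving away from $p_i$ first exits the pseudo-polygon through a boundary edge in $\partial(p_i,p_j)$. (Here $k\neq i,j$.) **Candidate blocker.** Let $(p_i,p_j)$ be an invisible pair. Let $p_k$ be the first vertex, walking clockwise from $p_j$ towards $p_i$, such that $\{p_i,p_k\}$ is a visible pair; $p_k$ is a candidate blocker for $(p_i,p_j)$ if there is no visible pair $\{p_s,p_t\}$ with $p_s\in\partial(p_i,p_{k-1})$ and $p_t\in\partial(p_{k+1},p_j)$. Similarly, let $p_{k'}$ be the first vertex, walking counterclockwise from $p_j$ towards $p_i$, such that $\{p_i,p_{k'}\}$ is a visible pair; $p_{k'}$ is a candidate blocker for $(p_i,p_j)$ if there is no visible pair $\{p_s,p_t\}$ with $p_s\in\partial(p_j,p_{k'-1})$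 and $p_t\in\partial(p_{k'+1},p_i)$. There are no other candidate blockers. *)

theory Defs
  imports "HOL-Complex_Analysis.Complex_Analysis"
begin

text \<open>The plane is the type \<^typ>\<open>complex\<close>, so that the library's winding number is available
  for orientation.\<close>

definition pseudo_line :: "complex set \<Rightarrow> bool" where
  "pseudo_line L \<longleftrightarrow> L homeomorphic (UNIV :: real set) \<and> closed L \<and> \<not> connected (- L)"

text \<open>\<open>M\<close> crosses \<open>L\<close> at \<open>x\<close> if arbitrarily close to \<open>x\<close> it has points on different sides of \<open>L\<close>.
  This is used only for curves whose sole common point is \<open>x\<close>.\<close>

definition crosses_at :: "complex set \<Rightarrow> complex set \<Rightarrow> complex \<Rightarrow> bool" where
  "crosses_at L M x \<longleftrightarrow> x \<in> L \<inter> M \<and>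
     (\<forall>\<epsilon>>0. \<exists>a \<in> (M - L) \<inter> ball x \<epsilon>. \<exists>b \<in> (M - L) \<inter> ball x \<epsilon>. \<not> connected_component (- L) a b)"

definition pseudo_line_arrangement :: "complex set set \<Rightarrow> bool" where
  "pseudo_line_arrangement \<L> \<longleftrightarrow>
     (\<forall>L\<in>\<L>. pseudo_line L) \<and>
     (\<forall>L\<in>\<L>. \<forall>M\<in>\<L>. L \<noteq> M \<longrightarrow> (\<exists>x. L \<inter> M = {x} \<and> crosses_at L M x))"

definition pseudo_configuration :: "nat \<Rightarrow> (nat \<Rightarrow> complex) \<Rightarrow> complex set set \<Rightarrow> bool" where
  "pseudo_configuration n p \<L> \<longleftrightarrow>
     n \<ge> 3 \<and> inj_on p {..<n} \<and>
     pseudo_line_arrangement \<L> \<and> card \<L> = n choose 2 \<and>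
     (\<forall>i<n. \<forall>j<n. i \<noteq> j \<longrightarrow> (\<exists>!L. L \<in> \<L> \<and> p i \<in> L \<and> p j \<in> L)) \<and>
     (\<forall>L\<in>\<L>. card (L \<inter> p ` {..<n}) = 2)"

definition pline :: "(nat \<Rightarrow> complex) \<Rightarrow> complex set set \<Rightarrow> nat \<Rightarrow> nat \<Rightarrow> complex set" where
  "pline p \<L> i j = (THE L. L \<in> \<L> \<and> p i \<in> L \<and> p j \<in> L)"

text \<open>The part of the curve \<open>L\<close> between two of its points, endpoints included. All
  homeomorphisms between the real line and \<open>L\<close> are monotone reparametrisations of each other, so
  each of them yields the same set.\<close>

definition subsegment :: "complex set \<Rightarrow> complex \<Rightarrow> complex \<Rightarrow> complex set" where
  "subsegment L x y =
     {z \<in> L. \<exists>f g. homeomorphism (UNIV :: real set) L f g \<and> g z \<in> closed_segment (g x) (g y)}"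

text \<open>The ray of \<open>L\<close> starting at \<open>y\<close> and moving away from \<open>x\<close>, without the point \<open>y\<close> itself.\<close>

definition ray_away :: "complex set \<Rightarrow> complex \<Rightarrow> complex \<Rightarrow> complex set" where
  "ray_away L x y = {z \<in> L. z \<noteq> y \<and> y \<in> subsegment L x z}"

definition seg :: "(nat \<Rightarrow> complex) \<Rightarrow> complex set set \<Rightarrow> nat \<Rightarrow> nat \<Rightarrow> complex set" where
  "seg p \<L> i j = subsegment (pline p \<L> i j) (p i) (p j)"

definition cyc_succ :: "nat \<Rightarrow> nat \<Rightarrow> nat" where
  "cyc_succ n i = (i + 1) mod n"

definition cyc_pred :: "nat \<Rightarrow> nat \<Rightarrow> nat" where
  "cyc_pred n i = (i + n - 1) mod n"

definition edge :: "nat \<Rightarrow> (nat \<Rightarrow> complex) \<Rightarrow> complex set set \<Rightarrow> nat \<Rightarrow> complex set" where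
  "edge n p \<L> i = seg p \<L> i (cyc_succ n i)"

definition boundary :: "nat \<Rightarrow> (nat \<Rightarrow> complex) \<Rightarrow> complex set set \<Rightarrow> complex set" where
  "boundary n p \<L> = (\<Union>i<n. edge n p \<L> i)"

text \<open>The vertices are met in the order \<open>0, \<dots>, n - 1\<close> when the boundary is traversed with
  the inside on the left.\<close>

definition ccw_indexed :: "nat \<Rightarrow> (nat \<Rightarrow> complex) \<Rightarrow> complex set set \<Rightarrow> bool" where
  "ccw_indexed n p \<L> \<longleftrightarrow>
     (\<exists>(\<gamma> :: real \<Rightarrow> complex) (t :: nat \<Rightarrow> real).
        simple_path \<gamma> \<and> pathfinish \<gamma> = pathstart \<gamma> \<and>
        path_image \<gamma> = boundary n p \<L> \<and>
        strict_mono_on {..n} t \<and> t 0 = 0 \<and> t n = 1 \<and>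
        (\<forall>i<n. \<gamma> (t i) = p i \<and> \<gamma> ` {t i..t (i + 1)} = edge n p \<L> i) \<and>
        (\<forall>z \<in> inside (boundary n p \<L>). winding_number \<gamma> z = 1))"

definition pseudo_polygon :: "nat \<Rightarrow> (nat \<Rightarrow> complex) \<Rightarrow> complex set set \<Rightarrow> bool" where
  "pseudo_polygon n p \<L> \<longleftrightarrow>
     pseudo_configuration n p \<L> \<and>
     (\<forall>i<n. edge n p \<L> i \<inter> edge n p \<L> (cyc_succ n i) = {p (cyc_succ n i)}) \<and>
     (\<forall>i<n. \<forall>j<n. i \<noteq> j \<and> j \<noteq> cyc_succ n i \<and> i \<noteq> cyc_succ n j \<longrightarrow>
        edge n p \<L> i \<inter> edge n p \<L> j = {}) \<and>
     ccw_indexed n p \<L>"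

definition sees :: "nat \<Rightarrow> (nat \<Rightarrow> complex) \<Rightarrow> complex set set \<Rightarrow> nat \<Rightarrow> nat \<Rightarrow> bool" where
  "sees n p \<L> i j \<longleftrightarrow>
     i < n \<and> j < n \<and> i \<noteq> j \<and> seg p \<L> i j \<inter> outside (boundary n p \<L>) = {}"

text \<open>The edge set of the visibility graph; the vertex \<open>p i\<close> is represented by its index \<open>i < n\<close>.\<close>

definition visibility_graph :: "nat \<Rightarrow> (nat \<Rightarrow> complex) \<Rightarrow> complex set set \<Rightarrow> nat set set" where
  "visibility_graph n p \<L> = {{i, j} | i j. sees n p \<L> i j}"

definition invisible_pair ::
    "nat \<Rightarrow> (nat \<Rightarrow> complex) \<Rightarrow> complex set set \<Rightarrow> nat \<Rightarrow> nat \<Rightarrow> bool" where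
  "invisible_pair n p \<L> i j \<longleftrightarrow> i < n \<and> j < n \<and> i \<noteq> j \<and> \<not> sees n p \<L> i j"

text \<open>Indices of the vertices and of the boundary edges met when walking counterclockwise from
  vertex \<open>i\<close> to vertex \<open>j\<close>; the walk takes \<open>(j + n - i) mod n\<close> steps, so it is trivial for \<open>i = j\<close>.\<close>

definition walk_vertices :: "nat \<Rightarrow> nat \<Rightarrow> nat \<Rightarrow> nat set" where
  "walk_vertices n i j = (\<lambda>d. (i + d) mod n) ` {..(j + n - i) mod n}"

definition walk_edges :: "nat \<Rightarrow> nat \<Rightarrow> nat \<Rightarrow> nat set" where
  "walk_edges n i j = (\<lambda>d. (i + d) mod n) ` {..<(j + n - i) mod n}"

text \<open>The ray starting at \<open>p k\<close> and moving away from \<open>p i\<close> first exits through edge \<open>m\<close>: it has a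
  point \<open>x\<close> on edge \<open>m\<close> such that the ray does not go outside before \<open>x\<close> but does so
  immediately after \<open>x\<close>. In particular this never holds for a ray that leaves the polygon at \<open>p k\<close>
  itself.\<close>

definition first_exits_through ::
    "nat \<Rightarrow> (nat \<Rightarrow> complex) \<Rightarrow> complex set set \<Rightarrow> nat \<Rightarrow> nat \<Rightarrow> nat \<Rightarrow> bool" where
  "first_exits_through n p \<L> i k m \<longleftrightarrow>
     (let L = pline p \<L> i k; R = ray_away L (p i) (p k); Out = outside (boundary n p \<L>) in
        \<exists>x \<in> R \<inter> edge n p \<L> m.
          subsegment L (p k) x \<inter> Out = {} \<and>
          (\<forall>y\<in>R. subsegment L (p k) y \<inter> Out = {} \<longrightarrow> y \<in> subsegment L (p k) x))"

definition designated_blocker ::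
    "nat \<Rightarrow> (nat \<Rightarrow> complex) \<Rightarrow> complex set set \<Rightarrow> nat \<Rightarrow> nat \<Rightarrow> nat \<Rightarrow> bool" where
  "designated_blocker n p \<L> i j k \<longleftrightarrow>
     k \<noteq> i \<and> k \<noteq> j \<and> sees n p \<L> i k \<and>
     (k \<in> walk_vertices n i j \<and> (\<exists>m \<in> walk_edges n j i. first_exits_through n p \<L> i k m) \<or>
      k \<in> walk_vertices n j i \<and> (\<exists>m \<in> walk_edges n i j. first_exits_through n p \<L> i k m))"

text \<open>Purely combinatorial: depends only on the edge set \<open>E\<close> of a graph on the cyclically ordered
  vertices \<open>0, \<dots>, n - 1\<close>. The two disjuncts are the clockwise and the counterclockwise walk from \<open>j\<close>
  towards \<open>i\<close>.\<close>

definition candidate_blocker :: "nat \<Rightarrow> nat set set \<Rightarrow> nat \<Rightarrow> nat \<Rightarrow> nat \<Rightarrow> bool" where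
  "candidate_blocker n E i j k \<longleftrightarrow>
     k \<in> walk_vertices n i j \<and> {i, k} \<in> E \<and>
     (\<forall>l \<in> walk_vertices n k j. l \<noteq> k \<longrightarrow> {i, l} \<notin> E) \<and>
     \<not> (\<exists>s \<in> walk_vertices n i (cyc_pred n k). \<exists>t \<in> walk_vertices n (cyc_succ n k) j. {s, t} \<in> E)
   \<or> k \<in> walk_vertices n j i \<and> {i, k} \<in> E \<and>
     (\<forall>l \<in> walk_vertices n j k. l \<noteq> k \<longrightarrow> {i, l} \<notin> E) \<and>
     \<not> (\<exists>s \<in> walk_vertices n j (cyc_pred n k). \<exists>t \<in> walk_vertices n (cyc_succ n k) i. {s, t} \<in> E)"

end

theory Submission
  imports Defs
begin

text \<open>
  Rotate the indices so that the viewpoint is \<open>p 0\<close>. A pseudo-line that meets a boundary edge of another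
  pseudo-line in its relative interior reaches the outside there, so segments and rays inside the polygon
  are crosscuts of a Jordan curve, and two crosscuts with interlaced ends meet.

  Let \<open>k\<close> be a designated blocker, with \<open>x\<close> the exit point of its ray. A visible segment between the two
  sides of \<open>k\<close> would have to cross both the segment from \<open>p 0\<close> to \<open>p k\<close> and the ray from \<open>p k\<close> to \<open>x\<close>,
  that is, the same pseudo-line twice. This shows that \<open>k\<close> is a candidate blocker, and it leaves no room
  for a second designated blocker on the same side of \<open>j\<close>; on opposite sides the two rays would cross.

  Existence is a discrete version of rotating a ray about \<open>p 0\<close>. If there is no designated blocker, then each
  ray from \<open>p 0\<close> to a vertex stops on the side of \<open>j\<close> on which its visible vertex lies. Take the last stop
  before \<open>p j\<close> and the first stop after it. The two full rays through these stops divide the plane; the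
  boundary edges that leave the two stops towards \<open>p j\<close> start in the same side \<open>U\<close>. They cannot both cross
  the other ray, as they would meet inside \<open>U\<close>. So one of them ends in \<open>U\<close> at a vertex, and the ray from \<open>p 0\<close>
  to this vertex has a stop strictly between the two chosen ones.
\<close>

text \<open>Pseudo-lines are arbitrary topological curves: there are no angles at \<open>p 0\<close>
  and no local picture of two curves near a common point. So "starting on the same side" becomes a
  statement about components. The two rays up to their stops and the chain of boundary between the
  stops form a Jordan curve \<open>D\<close> with inside \<open>R\<close>; the two full rays form
  \<open>K\<close>. A ray that has left the polygon may come back into \<open>R\<close>, so
  \<open>R\<close> need not lie on one side of \<open>K\<close>. But along a connected part of
  \<open>D\<close> near which \<open>K\<close> does not enter \<open>R\<close>, the adjacent points
  of \<open>R\<close> all belong to one component of \<open>R - K\<close>. This local connectivity,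
  a consequence of Janiszewski's theorem, carries the side \<open>U\<close> from \<open>p 0\<close>
  to the stops and along the chain as far as the chain avoids \<open>K\<close>. A vertex in
  \<open>U\<close> yields a new stop for the following reason: its ray stays in \<open>U\<close> up
  to the vertex and therefore starts in \<open>R\<close>; it can leave \<open>R\<close> only through
  the chain, and does so before it has been outside the polygon.\<close>

section \<open>Local connectivity at a Jordan curve\<close>

text \<open>Janiszewski's theorem, applied to the whole curve and to the union of its arc
  \<open>C1\<close> away from \<open>b\<close> with the part of \<open>K\<close> away from
  \<open>b\<close>. These two sets intersect in the arc \<open>C1\<close>, which is connected, so
  points that are joined in \<open>V\<close> and joined in a small ball around \<open>b\<close> are
  joined off both sets. \<open>K\<close> may touch the curve near \<open>b\<close> as long as it
  stays out of \<open>V\<close>.\<close>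

lemma boundary_local_connectivity:
  fixes c :: "real \<Rightarrow> complex"
  assumes c: "simple_path c" "pathfinish c = pathstart c"
    and V: "V \<in> components (- path_image c)"
    and K: "closed K" and b: "b \<in> path_image c"
    and \<epsilon>: "\<epsilon> > 0" "ball b \<epsilon> \<inter> K \<inter> V = {}"
  obtains \<delta> where "\<delta> > 0"
    "\<And>x y. x \<in> ball b \<delta> \<inter> V \<Longrightarrow> y \<in> ball b \<delta> \<inter> V \<Longrightarrow> connected_component (V - K) x y"
proof -
  obtain a where a: "a \<in> {0..1}" "c a = b"
    using b by (auto simp: path_image_def)
  \<comment> \<open>The loop is restarted at \<open>b\<close>, so that the arc away from
    \<open>b\<close> is the image of one interval.\<close>
  define q where "q = shiftpath a c"
  have q: "simple_path q" "pathfinish q = pathstart q" "path_image q = path_image c" "q 0 = b"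
    using simple_path_shiftpath[OF c(1) c(2), of a] path_image_shiftpath[of a c] a c
      closed_shiftpath[of c a]
    by (auto simp: q_def shiftpath_def)
  have "continuous_on {0..1} q"
    using q(1) by (simp add: simple_path_def path_def)
  moreover have "q 1 = b"
    using q by (simp add: pathfinish_def pathstart_def)
  ultimately obtain d0 d1 where d0: "d0 > 0" "\<And>x. x \<in> {0..1} \<Longrightarrow> dist x 0 < d0 \<Longrightarrow> dist (q x) b < \<epsilon>"
    and d1: "d1 > 0" "\<And>x. x \<in> {0..1} \<Longrightarrow> dist x 1 < d1 \<Longrightarrow> dist (q x) b < \<epsilon>"
    unfolding continuous_on_iff using \<epsilon>(1) \<open>q 0 = b\<close>
    by (metis atLeastAtMost_iff order_refl zero_le_one)
  define d where "d = min (1/2) (min d0 d1) / 2"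
  have d: "0 < d" "d \<le> 1/4" "d < d0" "d < d1"
    using d0(1) d1(1) by (auto simp: d_def min_def)
  define C1 where "C1 = q ` {d..1 - d}"
  have contq: "continuous_on {d..1-d} q"
    using \<open>continuous_on {0..1} q\<close> by (rule continuous_on_subset) (use d in auto)
  have C1: "compact C1" "connected C1"
    unfolding C1_def using contq by (auto intro!: compact_continuous_image connected_continuous_image)
  have C1sub: "C1 \<subseteq> path_image c"
  proof -
    have "q ` {d..1-d} \<subseteq> path_image q"
      unfolding path_image_def using d by (intro image_mono) auto
    then show ?thesis using q(3) by (simp add: C1_def)
  qed
  have bC1: "b \<notin> C1"
  proof
    assume "b \<in> C1"
    then obtain x where "x \<in> {d..1-d}" "q x = q 0"
      using q(4) by (auto simp: C1_def)
    then show False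
      using q(1) d unfolding simple_path_def loop_free_def by force
  qed
  have near: "path_image c - ball b \<epsilon> \<subseteq> C1"
  proof
    fix z assume z: "z \<in> path_image c - ball b \<epsilon>"
    then have "z \<in> path_image q" by (simp add: q(3))
    then obtain x where x: "x \<in> {0..1}" "z = q x"
      unfolding path_image_def by auto
    have "\<not> dist x 0 < d0" "\<not> dist x 1 < d1"
      using z x d0(2)[OF x(1)] d1(2)[OF x(1)] by (auto simp: dist_commute)
    then show "z \<in> C1"
      unfolding C1_def x(2) using x(1) d by (intro imageI) (auto simp: dist_real_def)
  qed
  define K1 where "K1 = K - ball b \<epsilon>"
  have "closed K1"
    unfolding K1_def using K by (simp add: closed_Diff)
  obtain \<delta>' where \<delta>': "\<delta>' > 0" "ball b \<delta>' \<inter> C1 = {}"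
    using open_contains_ball[of "- C1"] compact_imp_closed[OF C1(1)] bC1 by force
  define \<delta> where "\<delta> = min \<delta>' \<epsilon>"
  have \<delta>: "\<delta> > 0" "ball b \<delta> \<inter> (K1 \<union> C1) = {}"
    using \<delta>' \<epsilon>(1) by (auto simp: \<delta>_def K1_def)
  show thesis
  proof (rule that[OF \<delta>(1)])
    fix x y assume x: "x \<in> ball b \<delta> \<inter> V" and y: "y \<in> ball b \<delta> \<inter> V"
    have V': "connected V" "V \<subseteq> - path_image c"
      using in_components_connected[OF V] in_components_subset[OF V] by blast+
    have "connected_component (- (path_image c \<union> (K1 \<union> C1))) x y"
    proof (rule Janiszewski)
      show "compact (path_image c)"
        using c by (simp add: compact_simple_path_image)
      show "closed (K1 \<union> C1)"
        using \<open>closed K1\<close> C1 compact_imp_closed by blast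
      have "path_image c \<inter> (K1 \<union> C1) = C1"
        using near C1sub by (auto simp: K1_def)
      then show "connected (path_image c \<inter> (K1 \<union> C1))"
        using C1 by simp
      show "connected_component (- path_image c) x y"
        using x y V' unfolding connected_component_def by blast
      show "connected_component (- (K1 \<union> C1)) x y"
        unfolding connected_component_def using x y \<delta>(2)
        by (intro exI[of _ "ball b \<delta>"]) auto
    qed
    then obtain T where T: "connected T" "T \<subseteq> - (path_image c \<union> (K1 \<union> C1))" "x \<in> T" "y \<in> T"
      unfolding connected_component_def by blast
    have "T \<subseteq> V"
      using V T x by (intro components_maximal[OF V]) auto
    moreover have "V \<inter> K \<subseteq> K1"
      using \<epsilon>(2) by (auto simp: K1_def)
    ultimately have "T \<subseteq> V - K"
      using T(2) by auto
    then show "connected_component (V - K) x y"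
      using T unfolding connected_component_def by blast
  qed
qed

text \<open>That all points of \<open>V\<close> near \<open>b\<close> are joined in
  \<open>V - K\<close> to all those near \<open>b'\<close> is an equivalence relation on
  \<open>A\<close>. By local connectivity its classes are open in \<open>A\<close>, and a connected
  \<open>A\<close> has only one.\<close>

lemma boundary_common_component:
  fixes c :: "real \<Rightarrow> complex"
  assumes c: "simple_path c" "pathfinish c = pathstart c"
    and V: "V \<in> components (- path_image c)" and fr: "path_image c \<subseteq> closure V"
    and K: "closed K" and A: "connected A" "A \<subseteq> path_image c" "A \<noteq> {}"
    and free: "\<And>b. b \<in> A \<Longrightarrow> \<exists>\<epsilon>>0. ball b \<epsilon> \<inter> K \<inter> V = {}"
  obtains Z where "Z \<in> components (V - K)" "\<And>b. b \<in> A \<Longrightarrow> \<exists>\<delta>>0. ball b \<delta> \<inter> V \<subseteq> Z"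
proof -
  define R where "R = (\<lambda>b b'. \<exists>\<delta>>0. \<forall>x \<in> ball b \<delta> \<inter> V. \<forall>y \<in> ball b' \<delta> \<inter> V. connected_component (V - K) x y)"
  have lc: "\<exists>\<delta>>0. \<forall>x\<in>ball b \<delta> \<inter> V. \<forall>y \<in> ball b \<delta> \<inter> V. connected_component (V - K) x y" if b: "b \<in> A" for b
  proof -
    obtain \<epsilon> where e: "\<epsilon> > 0" "ball b \<epsilon> \<inter> K \<inter> V = {}"
      using free[OF b] by blast
    have "b \<in> path_image c" using A(2) b by blast
    then show ?thesis
    proof (rule boundary_local_connectivity[OF c V K _ e])
      fix \<delta> :: real assume "\<delta> > 0"
        "\<And>x y. x \<in> ball b \<delta> \<inter> V \<Longrightarrow> y \<in> ball b \<delta> \<inter> V \<Longrightarrow> connected_component (V - K) x y"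
      then show ?thesis by (intro exI[of _ \<delta>]) simp
    qed
  qed
  have ne: "ball b \<delta> \<inter> V \<noteq> {}" if b: "b \<in> A" "\<delta> > 0" for b \<delta>
  proof -
    have "b \<in> closure V" using b fr A(2) by blast
    then obtain z where "z \<in> V" "dist z b < \<delta>" using b(2) by (auto simp: closure_approachable)
    then show ?thesis by (auto simp: dist_commute)
  qed
  have rel: "R a b" if "a \<in> A" "b \<in> A" for a b
  proof (rule connected_equivalence_relation[OF A(1) that])
    fix x y assume "R x y" then show "R y x"
      unfolding R_def using connected_component_sym by metis
  next
    fix x y z assume R: "R x y" "R y z" and "x \<in> A" "y \<in> A" "z \<in> A"
    obtain d where d: "d > 0" "\<forall>u \<in> ball x d \<inter> V. \<forall>v \<in> ball y d \<inter> V. connected_component (V - K) u v"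
      using R unfolding R_def by blast
    obtain e where e: "e > 0" "\<forall>u \<in> ball y e \<inter> V. \<forall>v \<in> ball z e \<inter> V. connected_component (V - K) u v"
      using R unfolding R_def by blast
    have de: "min d e > 0" using d(1) e(1) by simp
    obtain w where w: "w \<in> ball y (min d e) \<inter> V"
      using ne[OF \<open>y \<in> A\<close> de] by blast
    show "R x z"
      unfolding R_def
    proof (intro exI[of _ "min d e"] conjI ballI)
      show "min d e > 0" using d e by simp
      fix u v assume "u \<in> ball x (min d e) \<inter> V" "v \<in> ball z (min d e) \<inter> V"
      then have "connected_component (V - K) u w" "connected_component (V - K) w v"
        using w d e by auto
      then show "connected_component (V - K) u v"
        by (rule connected_component_trans)
    qed
  next
    fix x assume x: "x \<in> A"
    obtain d where d: "d > 0" "\<forall>u \<in> ball x d \<inter> V. \<forall>v \<in> ball x d \<inter> V. connected_component (V - K) u v"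
      using lc[OF x] by blast
    show "\<exists>T. openin (top_of_set A) T \<and> x \<in> T \<and> (\<forall>y\<in>T. R x y)"
    proof (intro exI[of _ "A \<inter> ball x (d/2)"] conjI ballI)
      show "openin (top_of_set A) (A \<inter> ball x (d/2))"
        by (simp add: openin_open_Int)
      show "x \<in> A \<inter> ball x (d/2)" using x d by simp
      fix y assume y: "y \<in> A \<inter> ball x (d/2)"
      have "ball y (d/2) \<subseteq> ball x d"
      proof
        fix z assume "z \<in> ball y (d/2)"
        then show "z \<in> ball x d" using y dist_triangle[of x z y] by simp
      qed
      moreover have "ball x (d/2) \<subseteq> ball x d"
        using d by auto
      ultimately show "R x y"
        unfolding R_def using d by (intro exI[of _ "d/2"]) (simp add: subset_iff)
    qed
  qed
  obtain a where a: "a \<in> A" using A by blast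
  obtain d where d: "d > 0" "\<forall>u \<in> ball a d \<inter> V. \<forall>v \<in> ball a d \<inter> V. connected_component (V - K) u v"
    using lc[OF a] by blast
  obtain w where w: "w \<in> ball a d \<inter> V"
    using ne[OF a d(1)] by blast
  have "connected_component (V - K) w w" using d w by blast
  then have wVK: "w \<in> V - K" using connected_component_in by blast
  show thesis
  proof
    show "connected_component_set (V - K) w \<in> components (V - K)"
      using wVK by (rule componentsI)
    fix b assume b: "b \<in> A"
    obtain e where e: "e > 0" "\<forall>u \<in> ball a e \<inter> V. \<forall>v \<in> ball b e \<inter> V. connected_component (V - K) u v"
      using rel[OF a b] unfolding R_def by blast
    have de: "min d e > 0" using d(1) e(1) by simp
    obtain w' where w': "w' \<in> ball a (min d e) \<inter> V"
      using ne[OF a de] by blast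
    have "ball b e \<inter> V \<subseteq> connected_component_set (V - K) w"
    proof
      fix v assume "v \<in> ball b e \<inter> V"
      then have "connected_component (V - K) w' v"
        using e w' by auto
      moreover have "connected_component (V - K) w w'"
        using d w w' by auto
      ultimately show "v \<in> connected_component_set (V - K) w"
        using connected_component_trans by blast
    qed
    then show "\<exists>\<delta>>0. ball b \<delta> \<inter> V \<subseteq> connected_component_set (V - K) w"
      using e by blast
  qed
qed

text \<open>The chord \<open>d\<close> and the two arcs of \<open>c\<close> between its ends form a
  theta curve, so \<open>d\<close> splits the inside into \<open>I1\<close> and \<open>I2\<close>. A
  connected set off \<open>d\<close> lies in one of them, and the closure of each meets the curve
  only in its own arc, which excludes \<open>c v\<close> or \<open>c u\<close>. The condition on
  \<open>v\<close> speaks of points because the parameters 0 and 1 give the same one.\<close>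

lemma crossing_chords:
  fixes c d :: "real \<Rightarrow> complex"
  assumes c: "simple_path c" "pathfinish c = pathstart c"
    and xy: "0 \<le> x" "x < y" "y \<le> 1" "y - x < 1"
    and d: "arc d" "pathstart d = c x" "pathfinish d = c y"
      "path_image d - {c x, c y} \<subseteq> inside (path_image c)"
    and S: "connected S" "S \<subseteq> inside (path_image c)" "c u \<in> closure S" "c v \<in> closure S"
    and uv: "x < u" "u < y" "v \<in> {0..1}" "c v \<notin> c ` {x..y}"
  shows "S \<inter> path_image d \<noteq> {}"
proof
  assume dis: "S \<inter> path_image d = {}"
  note Jc = Jordan_inside_outside[OF c]
  have inj: "s = s' \<or> (s = 0 \<and> s' = 1) \<or> (s = 1 \<and> s' = 0)" if "s \<in> {0..1}" "s' \<in> {0..1}" "c s = c s'" for s s'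
    using c(1) that unfolding simple_path_def loop_free_def by blast
  \<comment> \<open>Restarting the loop at \<open>x\<close> turns the other arc, which passes
    through parameter 1, into a single subpath.\<close>
  define q where "q = shiftpath x c"
  have q: "simple_path q" "path_image q = path_image c"
    using simple_path_shiftpath[OF c(1) c(2), of x] path_image_shiftpath[of x c] xy c by (auto simp: q_def)
  have c01: "c 1 = c 0" using c by (simp add: pathfinish_def pathstart_def)
  have q1: "q 1 = c x" using c01 xy by (auto simp: q_def shiftpath_def)
  have qy: "q (y - x) = c y" using xy by (auto simp: q_def shiftpath_def)
  define c1 where "c1 = subpath x y c"
  define c2 where "c2 = subpath 1 (y - x) q"
  have a1: "arc c1"
    unfolding c1_def using c xy by (intro arc_simple_path_subpath_interior) auto
  have a2: "arc c2"
    unfolding c2_def using q xy by (intro arc_simple_path_subpath_interior) auto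
  have im1: "path_image c1 = c ` {x..y}"
    unfolding c1_def using xy by (simp add: path_image_subpath)
  have im2: "path_image c2 = c ` ({y..1} \<union> {0..x})"
  proof -
    have "path_image c2 = q ` {y - x..1}"
      unfolding c2_def using xy by (simp add: path_image_subpath_gen closed_segment_eq_real_ivl)
    also have "{y-x..1} = {y-x..1-x} \<union> {1-x..1}"
      using xy by auto
    also have "q ` \<dots> = q ` {y-x..1-x} \<union> q ` {1-x..1}" by (rule image_Un)
    also have "q ` {y-x..1-x} = c ` {y..1}"
    proof -
      have "q ` {y-x..1-x} = (\<lambda>s. c (x + s)) ` {y-x..1-x}"
        by (intro image_cong) (auto simp: q_def shiftpath_def)
      also have "\<dots> = c ` ((+) x ` {y-x..1-x})" by (simp only: image_image)
      also have "(+) x ` {y-x..1-x} = {y..1}" by simp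
      finally show ?thesis .
    qed
    also have "q ` {1-x..1} = c ` {0..x}"
    proof -
      have "q ` {1-x..1} = (\<lambda>s. c ((x - 1) + s)) ` {1-x..1}"
        using c01 by (intro image_cong) (auto simp: q_def shiftpath_def algebra_simps)
      also have "\<dots> = c ` ((+) (x-1) ` {1-x..1})" by (simp only: image_image)
      also have "(+) (x-1) ` {1-x..1} = {0..x}" by simp
      finally show ?thesis .
    qed
    finally show ?thesis by (simp add: image_Un)
  qed
  have ends: "pathstart c1 = c x" "pathfinish c1 = c y" "pathstart c2 = c x" "pathfinish c2 = c y"
    by (auto simp: c1_def c2_def q1 qy)
  have cxy: "c x \<noteq> c y" using inj[of x y] xy by auto
  have i12: "path_image c1 \<inter> path_image c2 = {c x, c y}"
  proof
    show "path_image c1 \<inter> path_image c2 \<subseteq> {c x, c y}"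
    proof
      fix z assume "z \<in> path_image c1 \<inter> path_image c2"
      then obtain s s' where s: "s \<in> {x..y}" "s' \<in> {y..1} \<union> {0..x}" "z = c s" "z = c s'"
        unfolding im1 im2 by (metis IntE imageE)
      then have "s = s' \<or> (s = 0 \<and> s' = 1) \<or> (s = 1 \<and> s' = 0)"
        using xy by (intro inj) auto
      then show "z \<in> {c x, c y}"
        using s xy by auto
    qed
    show "{c x, c y} \<subseteq> path_image c1 \<inter> path_image c2"
      using xy by (auto simp: im1 im2)
  qed
  have u12: "path_image c1 \<union> path_image c2 = path_image c"
  proof -
    have "{x..y} \<union> ({y..1} \<union> {0..x}) = {0..1}" using xy by auto
    then show ?thesis unfolding im1 im2 image_Un[symmetric] by (simp add: path_image_def)
  qed
  have dB: "path_image d \<inter> path_image c = {c x, c y}"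
  proof -
    have "c x \<in> path_image d" "c y \<in> path_image d"
      using d pathstart_in_path_image pathfinish_in_path_image by metis+
    moreover have "c x \<in> path_image c" "c y \<in> path_image c"
      using xy by (auto simp: path_image_def)
    moreover have "inside (path_image c) \<inter> path_image c = {}"
      by (simp add: inside_no_overlap)
    ultimately show ?thesis using d(4) by blast
  qed
  have ne: "path_image d \<inter> inside (path_image c1 \<union> path_image c2) \<noteq> {}"
  proof
    assume "path_image d \<inter> inside (path_image c1 \<union> path_image c2) = {}"
    then have "path_image d \<subseteq> {c x, c y}" using d(4) u12 by auto
    then have "finite (path_image d)" using finite_subset by blast
    then show False
      using arc_image_uncountable[OF d(1)] countable_finite by blast
  qed
  obtain split: "inside(path_image c1 \<union> path_image d) \<inter> inside(path_image c2 \<union> path_image d) = {}"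
    "inside(path_image c1 \<union> path_image d) \<union> inside(path_image c2 \<union> path_image d) \<union>
           (path_image d - {c x,c y}) = inside(path_image c1 \<union> path_image c2)"
  proof (rule split_inside_simple_closed_curve[of c1 "c x" "c y" c2 d])
    show "path_image c1 \<inter> path_image d = {c x, c y}" "path_image c2 \<inter> path_image d = {c x, c y}"
      using dB u12 i12 by blast+
  qed (use a1 a2 d ends cxy i12 ne arc_imp_simple_path in auto)
  define I1 where "I1 = inside (path_image c1 \<union> path_image d)"
  define I2 where "I2 = inside (path_image c2 \<union> path_image d)"
  have cl1: "closed (path_image c1 \<union> path_image d)" and cl2: "closed (path_image c2 \<union> path_image d)"
    using a1 a2 d(1) by (auto intro!: closed_Un simp: closed_arc_image)
  have op: "open I1" "open I2"
    unfolding I1_def I2_def using cl1 cl2 by (auto simp: open_inside)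
  have "S \<subseteq> I1 \<union> I2"
    using S(2) split(2) dis unfolding I1_def I2_def u12 by blast
  moreover have "I1 \<inter> I2 = {}" using split(1) by (simp add: I1_def I2_def)
  ultimately have "S \<subseteq> I1 \<or> S \<subseteq> I2"
    using connectedD[OF S(1) op] by blast
  moreover have sub1: "closure I1 \<subseteq> path_image c1 \<union> path_image d \<union> I1"
    unfolding I1_def by (metis closure_inside_subset cl1)
  moreover have sub2: "closure I2 \<subseteq> path_image c2 \<union> path_image d \<union> I2"
    unfolding I2_def by (metis closure_inside_subset cl2)
  moreover have I12: "I1 \<union> I2 \<subseteq> inside (path_image c)"
    using split(2) u12 by (auto simp: I1_def I2_def)
  moreover have inP: "inside (path_image c) \<inter> path_image c = {}"
    by (simp add: inside_no_overlap)
  have u01: "u \<in> {0..1}" using uv xy by auto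
  have cuP: "c u \<in> path_image c" "c v \<in> path_image c"
    using u01 uv by (auto simp: path_image_def)
  have "c u \<in> path_image c1" unfolding im1 using uv by auto
  moreover have cu: "c u \<noteq> c x" "c u \<noteq> c y"
    using inj[OF u01, of x] inj[OF u01, of y] uv xy by auto
  ultimately have cu2: "c u \<notin> path_image c2 \<union> path_image d"
    using i12 dB cuP by blast
  have cv: "c v \<noteq> c x" "c v \<noteq> c y"
    using uv(4) xy by auto
  have cv2: "c v \<notin> path_image c1 \<union> path_image d"
    using uv(4) dB cuP cv by (auto simp: im1)
  from \<open>S \<subseteq> I1 \<or> S \<subseteq> I2\<close> show False
  proof
    assume "S \<subseteq> I1"
    then have "c v \<in> closure I1" using S closure_mono by blast
    then show False using sub1 cv2 I12 inP cuP by blast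
  next
    assume "S \<subseteq> I2"
    then have "c u \<in> closure I2" using S closure_mono by blast
    then show False using sub2 cu2 I12 inP cuP by blast
  qed
qed

section \<open>Proper lines in the plane\<close>

lemma closure_image_mono_on:
  fixes f :: "'a::metric_space \<Rightarrow> 'b::metric_space"
  assumes "continuous_on T f" "S \<subseteq> T" "z \<in> closure S" "z \<in> T"
  shows "f z \<in> closure (f ` S)"
  unfolding closure_approachable
proof (intro allI impI)
  fix e :: real assume "0 < e"
  then obtain d where d: "d > 0" "\<And>x. x \<in> T \<Longrightarrow> dist x z < d \<Longrightarrow> dist (f x) (f z) < e"
    using assms(1,4) unfolding continuous_on_iff by meson
  obtain x where "x \<in> S" "dist x z < d"
    using assms(3) d(1) unfolding closure_approachable by meson
  then show "\<exists>y\<in>f ` S. dist y (f z) < e"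
    using d(2) assms(2) by (intro bexI[of _ "f x"]) auto
qed

text \<open>Two connected sets in \<open>U\<close> whose ends are interlaced along the line \<open>H\<close> meet.\<close>

definition crossing_side :: "(real \<Rightarrow> complex) \<Rightarrow> complex set \<Rightarrow> bool" where
  "crossing_side H U \<longleftrightarrow> (\<forall>x1 x2 y1 y2 d S. x1 < x2 \<longrightarrow> x2 < y1 \<longrightarrow> y1 < y2 \<longrightarrow> arc d \<longrightarrow>
     pathstart d = H x1 \<longrightarrow> pathfinish d = H y1 \<longrightarrow> path_image d - {H x1, H y1} \<subseteq> U \<longrightarrow>
     connected S \<longrightarrow> S \<subseteq> U \<longrightarrow> H x2 \<in> closure S \<longrightarrow> H y2 \<in> closure S \<longrightarrow> S \<inter> path_image d \<noteq> {})"

text \<open>Inversion at \<open>c\<close> turns a proper line into a Jordan curve through \<open>0\<close>, and the side of the line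
  that does not contain \<open>c\<close> into its inside.\<close>

lemma proper_line_side:
  fixes H :: "real \<Rightarrow> complex"
  assumes cont: "continuous_on UNIV H" and inj: "inj H"
    and top: "filterlim H at_infinity at_top" and bot: "filterlim H at_infinity at_bot"
    and c: "c \<notin> range H"
  obtains U V where "open U" "connected U" "open V" "connected V" "U \<inter> V = {}" "U \<union> V = - range H"
    "range H \<subseteq> closure U" "range H \<subseteq> closure V" "c \<in> V" "crossing_side H U"
proof -
  \<comment> \<open>\<open>\<psi>\<close> maps the open unit interval onto the reals, with inverse
    \<open>\<theta>\<close>. \<open>G\<close> is the inverted line over this interval, closed up by
    the value 0, the image of infinity; properness of \<open>H\<close> makes it continuous at both
    ends.\<close>
  define \<phi> where "\<phi> = (\<lambda>z. inverse (z - c))"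
  define \<psi> where "\<psi> = (\<lambda>x::real. tan (pi * (x - 1/2)))"
  define \<theta> where "\<theta> = (\<lambda>s::real. arctan s / pi + 1/2)"
  define G where "G = (\<lambda>x. if 0 < x \<and> x < 1 then \<phi> (H (\<psi> x)) else 0)"
  have \<theta>: "0 < \<theta> s" "\<theta> s < 1" "\<psi> (\<theta> s) = s" for s
  proof -
    have "arctan s < (1/2) * pi" "(-1/2) * pi < arctan s"
      using arctan_ubound[of s] arctan_lbound[of s] by simp_all
    then have "arctan s / pi < 1/2" "-1/2 < arctan s / pi"
      by (simp_all only: pos_divide_less_eq[OF pi_gt_zero] pos_less_divide_eq[OF pi_gt_zero])
    then show "0 < \<theta> s" "\<theta> s < 1" unfolding \<theta>_def by linarith+
    have "pi * (\<theta> s - 1/2) = arctan s"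
      unfolding \<theta>_def add_diff_cancel_right' using pi_neq_zero by (rule nonzero_mult_div_cancel_left[of pi, unfolded times_divide_eq_right[symmetric]])
    then show "\<psi> (\<theta> s) = s" by (simp only: \<psi>_def tan_arctan)
  qed
  have rng: "- (pi/2) < pi * (x - 1/2)" "pi * (x - 1/2) < pi/2" if "0 < x" "x < 1" for x :: real
  proof -
    have "0 < pi * x" "pi * x < pi * 1"
      using that by (simp_all add: mult_less_cancel_left_pos)
    then show "- (pi/2) < pi * (x - 1/2)" "pi * (x - 1/2) < pi/2" by (simp_all add: algebra_simps)
  qed
  have \<theta>\<psi>: "\<theta> (\<psi> x) = x" if "0 < x" "x < 1" for x
    unfolding \<theta>_def \<psi>_def using arctan_tan[OF rng[OF that]] by simp
  have \<theta>_mono: "\<theta> s < \<theta> s'" if "s < s'" for s s'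
    using that by (simp add: \<theta>_def arctan_less_iff divide_strict_right_mono)
  have G\<theta>: "G (\<theta> s) = \<phi> (H s)" for s
    using \<theta>[of s] by (simp add: G_def)
  have Hc: "H s \<noteq> c" for s using c by auto
  have \<phi>0: "\<phi> z = 0 \<longleftrightarrow> z = c" for z by (simp add: \<phi>_def)
  have \<phi>inj: "\<phi> z = \<phi> w \<longleftrightarrow> z = w" for z w by (simp add: \<phi>_def)
  have c\<phi>: "continuous_on (- {c}) \<phi>"
    unfolding \<phi>_def by (intro continuous_intros) auto
  have G01: "G 0 = 0" "G 1 = 0" by (auto simp: G_def)
  have cont\<psi>: "continuous_on {0<..<1} \<psi>"
    unfolding \<psi>_def
  proof (intro continuous_intros ballI)
    fix x :: real assume "x \<in> {0<..<1}"
    then show "cos (pi * (x - 1/2)) \<noteq> 0"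
      using rng[of x] cos_gt_zero_pi[of "pi * (x - 1/2)"] by auto
  qed
  have contG': "continuous_on {0<..<1} G"
  proof -
    have "continuous_on {0<..<1} (\<lambda>x. H (\<psi> x))"
      by (rule continuous_on_compose2[OF cont cont\<psi>]) simp
    then have "continuous_on {0<..<1} (\<lambda>x. \<phi> (H (\<psi> x)))"
      by (rule continuous_on_compose2[OF c\<phi>]) (use Hc in auto)
    then show ?thesis by (rule continuous_on_eq) (auto simp: G_def)
  qed
  have \<phi>inf: "(\<phi> \<longlongrightarrow> 0) at_infinity"
  proof -
    have "filterlim (\<lambda>z. (- c) + z) at_infinity at_infinity"
      by (rule tendsto_add_filterlim_at_infinity[OF tendsto_const filterlim_ident])
    then have "((\<lambda>z. inverse ((- c) + z)) \<longlongrightarrow> 0) at_infinity"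
      by (rule filterlim_compose[OF tendsto_inverse_0])
    then show ?thesis by (simp add: \<phi>_def)
  qed
  have contG: "continuous_on {0..1} G"
    unfolding continuous_on_def
  proof
    fix x :: real assume x: "x \<in> {0..1}"
    consider "x \<in> {0<..<1}" | "x = 0" | "x = 1" using x by fastforce
    then show "(G \<longlongrightarrow> G x) (at x within {0..1})"
    proof cases
      case 1
      then have "isCont G x"
        using contG' by (simp add: continuous_on_eq_continuous_at)
      then show ?thesis
        unfolding isCont_def by (rule tendsto_within_subset) simp
    next
      case 2
      have "filterlim \<psi> at_bot (at_right 0)"
        unfolding \<psi>_def
      proof (rule filterlim_compose[OF filterlim_tan_at_right])
        have "((\<lambda>x::real. pi * (x - 1/2)) \<longlongrightarrow> pi * (0 - 1/2)) (at_right 0)"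
          by (intro tendsto_intros)
        moreover have "\<forall>\<^sub>F x in at_right 0. pi * (x - 1/2) \<in> {- (pi/2)<..} \<and> pi * (x - 1/2) \<noteq> - (pi/2)"
          unfolding eventually_at_right_field
        proof (intro exI[of _ 1] conjI allI impI)
          fix x :: real assume "0 < x" "x < 1"
          then have "- (pi/2) < pi * (x - 1/2)" by (rule rng(1))
          then show "pi * (x - 1/2) \<in> {- (pi/2)<..}" "pi * (x - 1/2) \<noteq> - (pi/2)"
            by (simp only: greaterThan_iff, rule less_imp_neq[symmetric])
        qed simp
        ultimately show "filterlim (\<lambda>x. pi * (x - 1/2)) (at_right (- (pi/2))) (at_right 0)"
          by (simp add: filterlim_at)
      qed
      then have "((\<lambda>x. \<phi> (H (\<psi> x))) \<longlongrightarrow> 0) (at_right 0)"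
        by (intro filterlim_compose[OF \<phi>inf] filterlim_compose[OF bot])
      moreover have "\<forall>\<^sub>F x in at_right 0. \<phi> (H (\<psi> x)) = G x"
        unfolding eventually_at_right_field by (intro exI[of _ 1]) (simp add: G_def)
      ultimately have "(G \<longlongrightarrow> 0) (at_right 0)"
        by (rule Lim_transform_eventually)
      moreover have "at (0::real) within {0..1} = at_right 0"
        by (rule at_within_Icc_at_right) simp
      ultimately show ?thesis
        by (simp only: 2 G01)
    next
      case 3
      have "filterlim \<psi> at_top (at_left 1)"
        unfolding \<psi>_def
      proof (rule filterlim_compose[OF filterlim_tan_at_left])
        have "((\<lambda>x::real. pi * (x - 1/2)) \<longlongrightarrow> pi * (1 - 1/2)) (at_left 1)"
          by (intro tendsto_intros)
        moreover have "\<forall>\<^sub>F x in at_left 1. pi * (x - 1/2) \<in> {..<pi/2} \<and> pi * (x - 1/2) \<noteq> pi/2"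
          unfolding eventually_at_left_field
        proof (intro exI[of _ 0] conjI allI impI)
          fix x :: real assume "0 < x" "x < 1"
          then have "pi * (x - 1/2) < pi/2" by (rule rng(2))
          then show "pi * (x - 1/2) \<in> {..<pi/2}" "pi * (x - 1/2) \<noteq> pi/2"
            by (simp only: lessThan_iff, rule less_imp_neq)
        qed simp
        ultimately show "filterlim (\<lambda>x. pi * (x - 1/2)) (at_left (pi/2)) (at_left 1)"
          by (simp add: filterlim_at)
      qed
      then have "((\<lambda>x. \<phi> (H (\<psi> x))) \<longlongrightarrow> 0) (at_left 1)"
        by (intro filterlim_compose[OF \<phi>inf] filterlim_compose[OF top])
      moreover have "\<forall>\<^sub>F x in at_left 1. \<phi> (H (\<psi> x)) = G x"
        unfolding eventually_at_left_field by (intro exI[of _ 0]) (simp add: G_def)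
      ultimately have "(G \<longlongrightarrow> 0) (at_left 1)"
        by (rule Lim_transform_eventually)
      moreover have "at (1::real) within {0..1} = at_left 1"
        by (rule at_within_Icc_at_left) simp
      ultimately show ?thesis
        by (simp only: 3 G01)
    qed
  qed
  have Gnz: "G x \<noteq> 0" if "0 < x" "x < 1" for x
    using that Hc by (simp add: G_def \<phi>0)
  have Ginj: "x = y" if "0 < x" "x < 1" "0 < y" "y < 1" "G x = G y" for x y
  proof -
    have "\<psi> x = \<psi> y" using that inj by (simp add: G_def \<phi>inj inj_eq)
    then show ?thesis using \<theta>\<psi> that by metis
  qed
  have G: "simple_path G" "pathfinish G = pathstart G"
  proof -
    have "x = y \<or> x = 0 \<and> y = 1 \<or> x = 1 \<and> y = 0" if "x \<in> {0..1}" "y \<in> {0..1}" "G x = G y" for x y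
    proof -
      have "x = 0 \<or> x = 1 \<or> (0 < x \<and> x < 1)" "y = 0 \<or> y = 1 \<or> (0 < y \<and> y < 1)"
        using that(1,2) by auto
      then show ?thesis
        using that(3) Ginj[of x y] Gnz[of x] Gnz[of y] G01 by metis
    qed
    then show "simple_path G"
      using contG by (simp add: simple_path_def path_def loop_free_def)
    show "pathfinish G = pathstart G" by (simp add: pathfinish_def pathstart_def G01)
  qed
  have imG: "path_image G = insert 0 (\<phi> ` range H)"
  proof
    show "path_image G \<subseteq> insert 0 (\<phi> ` range H)"
      by (auto simp: path_image_def G_def)
    show "insert 0 (\<phi> ` range H) \<subseteq> path_image G"
    proof
      fix w assume "w \<in> insert 0 (\<phi> ` range H)"
      then consider "w = G 0" | s where "w = G (\<theta> s)" using G01 G\<theta> by auto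
      then show "w \<in> path_image G"
        using \<theta> by cases (auto simp: path_image_def intro!: imageI less_imp_le)
    qed
  qed
  note J = Jordan_inside_outside[OF G]
  define I where "I = inside (path_image G)"
  define Out where "Out = outside (path_image G)"
  have IO: "open I" "connected I" "open Out" "connected Out" "I \<inter> Out = {}" "I \<union> Out = - path_image G"
    "closure I = I \<union> path_image G" "closure Out = Out \<union> path_image G" "bounded I"
    using J by (auto simp: I_def Out_def closure_Un_frontier)
  have n0: "0 \<notin> I" "0 \<notin> Out" using IO imG by blast+
  \<comment> \<open>Since \<open>inverse 0 = 0\<close>, the maps \<open>\<phi>\<close> and
    \<open>\<xi>\<close> are mutually inverse on the whole plane, but they pair \<open>c\<close>
    with 0, whereas geometrically \<open>c\<close> corresponds to infinity. So \<open>c\<close> is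
    added to \<open>V\<close> by hand.\<close>
  define \<xi> where "\<xi> = (\<lambda>w. c + inverse w)"
  have c\<xi>: "continuous_on (- {0}) \<xi>"
    unfolding \<xi>_def by (intro continuous_intros) auto
  have \<xi>\<phi>: "\<xi> (\<phi> z) = z" "\<phi> (\<xi> z) = z" for z by (auto simp: \<xi>_def \<phi>_def)
  define U where "U = \<xi> ` I"
  define V where "V = insert c (\<xi> ` Out)"
  have Uiff: "z \<in> U \<longleftrightarrow> \<phi> z \<in> I" for z
    unfolding U_def using \<xi>\<phi> by (metis imageE imageI)
  have \<xi>Out: "z \<in> \<xi> ` Out \<longleftrightarrow> \<phi> z \<in> Out" for z
    using \<xi>\<phi> by (metis imageE imageI)
  have Viff: "z \<in> V \<longleftrightarrow> z = c \<or> \<phi> z \<in> Out" for z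
    unfolding V_def using \<xi>Out by simp
  have Rc: "z \<in> range H \<longleftrightarrow> \<phi> z \<in> path_image G \<and> z \<noteq> c" for z
    unfolding imG using \<phi>inj \<phi>0 Hc by (metis image_iff insert_iff)
  have dis: "U \<inter> V = {}"
  proof -
    have False if "z \<in> U" "z \<in> V" for z
      using that IO(5) n0 \<phi>0[of z] unfolding Uiff Viff by auto
    then show ?thesis by blast
  qed
  have un: "U \<union> V = - range H"
  proof -
    have "z \<in> U \<union> V \<longleftrightarrow> z \<notin> range H" for z
    proof -
      have "z \<in> U \<union> V \<longleftrightarrow> z = c \<or> \<phi> z \<in> I \<union> Out" unfolding Uiff Viff Un_iff by blast
      also have "\<dots> \<longleftrightarrow> z = c \<or> \<phi> z \<notin> path_image G" by (simp only: IO(6) Compl_iff)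
      also have "\<dots> \<longleftrightarrow> z \<notin> range H" unfolding Rc by blast
      finally show ?thesis .
    qed
    then show ?thesis by blast
  qed
  have opU: "open U"
  proof -
    have "\<phi> c = 0" by (simp add: \<phi>_def)
    then have "z \<in> U \<longleftrightarrow> z \<in> (- {c}) \<inter> \<phi> -` I" for z
      using n0(1) by (cases "z = c") (simp_all add: Uiff)
    then have "U = (- {c}) \<inter> \<phi> -` I" by (rule set_eqI)
    moreover have "open ((- {c}) \<inter> \<phi> -` I)"
      by (rule continuous_open_preimage[OF c\<phi> open_Compl[OF closed_singleton] IO(1)])
    ultimately show ?thesis by simp
  qed
  have opOut: "open (\<xi> ` Out)"
  proof -
    have "\<phi> c = 0" by (simp add: \<phi>_def)
    then have "z \<in> \<xi> ` Out \<longleftrightarrow> z \<in> (- {c}) \<inter> \<phi> -` Out" for z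
      using n0(2) by (cases "z = c") (simp_all add: \<xi>Out)
    then have "\<xi> ` Out = (- {c}) \<inter> \<phi> -` Out" by (rule set_eqI)
    moreover have "open ((- {c}) \<inter> \<phi> -` Out)"
      by (rule continuous_open_preimage[OF c\<phi> open_Compl[OF closed_singleton] IO(3)])
    ultimately show ?thesis by simp
  qed
  \<comment> \<open>Openness of \<open>V\<close> at \<open>c\<close>: the curve and its inside fit
    into a ball of radius \<open>B\<close>, so points at distance less than \<open>1/B\<close> from
    \<open>c\<close> are inverted into the outside.\<close>
  have "bounded (path_image G)"
    using G(1) by (simp add: bounded_simple_path_image)
  then have "bounded (path_image G \<union> I)"
    using IO(9) by simp
  then obtain B where B: "B > 0" "path_image G \<union> I \<subseteq> ball 0 B"
    using bounded_subset_ballD by blast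
  have nearc: "ball c (1/B) \<subseteq> V"
  proof
    fix z assume z: "z \<in> ball c (1/B)"
    show "z \<in> V"
    proof (cases "z = c")
      case False
      have "norm (z - c) < 1/B" using z by (simp add: dist_norm norm_minus_commute)
      then have "norm (\<phi> z) > B"
        unfolding \<phi>_def norm_inverse using False B(1) by (simp add: field_simps)
      then have "\<phi> z \<notin> ball 0 B" by simp
      then have "\<phi> z \<notin> path_image G \<union> I" using B(2) by blast
      then have "\<phi> z \<in> Out" using IO(6) by blast
      then show ?thesis by (simp add: Viff)
    qed (simp add: V_def)
  qed
  have opV: "open V"
  proof -
    have "V = ball c (1/B) \<union> \<xi> ` Out" using nearc B(1) by (auto simp: V_def)
    then show ?thesis using opOut by auto
  qed
  have conU: "connected U"
    unfolding U_def using n0 by (intro connected_continuous_image continuous_on_subset[OF c\<xi>] IO) auto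
  have conO: "connected (\<xi> ` Out)"
    using n0 by (intro connected_continuous_image continuous_on_subset[OF c\<xi>] IO) auto
  have conV: "connected V"
  proof -
    have "ball c (1/B) \<inter> \<xi> ` Out \<noteq> {}"
    proof -
      define r where "r = 1 / (2 * B)"
      have r: "0 < r" "r < 1 / B" using B(1) by (simp_all add: r_def field_simps)
      then have z: "c + of_real r \<in> ball c (1/B)" by (simp add: dist_norm)
      moreover have "c + of_real r \<noteq> c" using r by simp
      ultimately have "c + of_real r \<in> \<xi> ` Out" using nearc by (auto simp: V_def)
      then show ?thesis using z by blast
    qed
    then have "connected (ball c (1/B) \<union> \<xi> ` Out)" using conO by (intro connected_Un) auto
    moreover have "V = ball c (1/B) \<union> \<xi> ` Out" using nearc B(1) by (auto simp: V_def)
    ultimately show ?thesis by simp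
  qed
  have clos: "H s \<in> closure (\<xi> ` X)" if "path_image G \<subseteq> closure X" "0 \<notin> X" for s X
  proof -
    have "\<xi> (\<phi> (H s)) \<in> closure (\<xi> ` X)"
      using that Hc Rc[of "H s"] \<phi>0
      by (intro closure_image_mono_on[OF c\<xi>]) auto
    then show ?thesis by (simp add: \<xi>\<phi>)
  qed
  have clU: "range H \<subseteq> closure U"
    using clos[of I] IO(7) n0 by (auto simp: U_def)
  have clV: "range H \<subseteq> closure V"
    using clos[of Out] IO(8) n0 closure_mono[of "\<xi> ` Out" V] by (auto simp: V_def)
  have "crossing_side H U"
    unfolding crossing_side_def
  proof (intro allI impI)
    fix x1 x2 y1 y2 d S
    assume o: "x1 < x2" "x2 < y1" "y1 < y2" and d: "arc d" "pathstart d = H x1" "pathfinish d = H y1"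
      "path_image d - {H x1, H y1} \<subseteq> U" and S: "connected S" "S \<subseteq> U" "H x2 \<in> closure S" "H y2 \<in> closure S"
    have cU: "c \<notin> U" using dis by (auto simp: V_def)
    then have cd: "c \<notin> path_image d" using d(4) Hc by auto
    have "\<phi> ` S \<inter> path_image (\<phi> \<circ> d) \<noteq> {}"
    proof (rule crossing_chords[OF G, where x = "\<theta> x1" and y = "\<theta> y1" and u = "\<theta> x2" and v = "\<theta> y2"])
      show "arc (\<phi> \<circ> d)"
      proof -
        have "continuous_on {0..1} d" "inj_on d {0..1}" using d(1) by (simp_all add: arc_def path_def)
        moreover have "continuous_on {0..1} (\<lambda>x. \<phi> (d x))"
          by (rule continuous_on_compose2[OF c\<phi> calculation(1)]) (use cd in \<open>auto simp: path_image_def\<close>)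
        ultimately show ?thesis
          unfolding arc_def path_def o_def inj_on_def \<phi>inj by blast
      qed
      show "path_image (\<phi> \<circ> d) - {G (\<theta> x1), G (\<theta> y1)} \<subseteq> inside (path_image G)"
        unfolding path_image_compose G\<theta> I_def[symmetric]
      proof
        fix w assume w: "w \<in> \<phi> ` path_image d - {\<phi> (H x1), \<phi> (H y1)}"
        then obtain z where z: "z \<in> path_image d" "w = \<phi> z" by blast
        then have "z \<in> U" using w d(4) by blast
        then show "w \<in> I" using Uiff z(2) by simp
      qed
      show "connected (\<phi> ` S)"
        using S cU by (intro connected_continuous_image continuous_on_subset[OF c\<phi>]) auto
      show "\<phi> ` S \<subseteq> inside (path_image G)"
        using S(2) Uiff by (auto simp: I_def[symmetric])
      show "G (\<theta> x2) \<in> closure (\<phi> ` S)" "G (\<theta> y2) \<in> closure (\<phi> ` S)"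
        unfolding G\<theta> using S cU Hc
        by (auto intro!: closure_image_mono_on[OF c\<phi>])
      show "G (\<theta> y2) \<notin> G ` {\<theta> x1..\<theta> y1}"
      proof
        assume "G (\<theta> y2) \<in> G ` {\<theta> x1..\<theta> y1}"
        then obtain x where "x \<in> {\<theta> x1..\<theta> y1}" "G (\<theta> y2) = G x" by auto
        moreover have "0 < x" "x < 1"
          using calculation(1) \<theta>[of x1] \<theta>[of y1] by auto
        ultimately have "\<theta> y2 = x" using Ginj \<theta> by metis
        then show False using \<open>x \<in> {\<theta> x1..\<theta> y1}\<close> \<theta>_mono[OF o(3)] by auto
      qed
      show "0 \<le> \<theta> x1" "\<theta> y1 \<le> 1" "\<theta> y1 - \<theta> x1 < 1" "\<theta> y2 \<in> {0..1}"
        using \<theta>(1)[of x1] \<theta>(2)[of y1] \<theta>(1)[of y2] \<theta>(2)[of y2] by simp_all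
      show "\<theta> x1 < \<theta> y1" "\<theta> x1 < \<theta> x2" "\<theta> x2 < \<theta> y1"
        using \<theta>_mono o less_trans by blast+
      show "pathstart (\<phi> \<circ> d) = G (\<theta> x1)" "pathfinish (\<phi> \<circ> d) = G (\<theta> y1)"
        unfolding G\<theta> pathstart_compose pathfinish_compose d by (rule refl)+
    qed
    then show "S \<inter> path_image d \<noteq> {}"
      using \<phi>inj by (auto simp: path_image_compose)
  qed
  then show thesis
    using that[OF opU conU opV conV dis un clU clV] by (simp add: V_def)
qed

section \<open>Pseudo-lines and the boundary loop\<close>

lemma subsegment_commute: "subsegment L x y = subsegment L y x"
  by (simp add: subsegment_def closed_segment_commute)

lemma pseudo_line_param:
  assumes L: "pseudo_line L" and x: "x \<in> L" and y: "y \<in> L" "x \<noteq> y"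
  obtains h g where "homeomorphism UNIV L h g" "h 0 = x" "h (1::real) = y"
proof -
  obtain f g where fg: "homeomorphism (UNIV::real set) L f g"
    using L unfolding pseudo_line_def by (metis homeomorphic_def homeomorphic_sym)
  have fgz: "f (g z) = z" if "z \<in> L" for z using fg that by (simp add: homeomorphism_def)
  have gfz: "g (f z) = z" for z using fg by (simp add: homeomorphism_def)
  define d where "d = g y - g x"
  have d: "d \<noteq> 0" using fgz[OF x] fgz[OF y(1)] y(2) by (auto simp: d_def)
  define h where "h = (\<lambda>s. f (g x + s * d))"
  define k where "k = (\<lambda>z. (g z - g x) / d)"
  have "homeomorphism UNIV L h k"
  proof (rule homeomorphismI)
    show "continuous_on UNIV h"
      unfolding h_def
      by (rule continuous_on_compose2[of UNIV f]) (use fg in \<open>auto simp: homeomorphism_def intro!: continuous_intros\<close>)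
    show "continuous_on L k"
      unfolding k_def using fg d by (intro continuous_intros) (auto simp: homeomorphism_def)
    show "h ` UNIV \<subseteq> L" using fg by (auto simp: h_def homeomorphism_def)
    show "h (k z) = z" if "z \<in> L" for z using that d by (simp add: h_def k_def fgz)
    show "k (h z) = z" for z using d by (simp add: h_def k_def gfz)
  qed auto
  moreover have "h 0 = x" "h 1 = y" using fgz x y by (simp_all add: h_def d_def)
  ultimately show thesis by (rule that)
qed

text \<open>For another parametrisation \<open>f\<close> the change of parameter from
  \<open>f\<close> to \<open>h\<close> is continuous and injective on the reals, hence maps closed
  segments onto closed segments. So every homeomorphism gives the same subsegment.\<close>

lemma subsegment_param:
  assumes hg: "homeomorphism (UNIV::real set) L h g"
  shows "subsegment L (h s) (h u) = h ` closed_segment s u"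
proof
  have gh: "g (h r) = r" for r using hg by (simp add: homeomorphism_def)
  have hg': "h (g z) = z" if "z \<in> L" for z using hg that by (simp add: homeomorphism_def)
  have hL: "h r \<in> L" for r using hg by (auto simp: homeomorphism_def)
  show "h ` closed_segment s u \<subseteq> subsegment L (h s) (h u)"
  proof
    fix z assume "z \<in> h ` closed_segment s u"
    then obtain r where r: "z = h r" "r \<in> closed_segment s u" by blast
    then have "g z \<in> closed_segment (g (h s)) (g (h u))" by (simp add: gh)
    then show "z \<in> subsegment L (h s) (h u)"
      unfolding subsegment_def using hL[of r] hg r(1) by blast
  qed
  show "subsegment L (h s) (h u) \<subseteq> h ` closed_segment s u"
  proof
    fix z assume "z \<in> subsegment L (h s) (h u)"
    then obtain f k where z: "z \<in> L" and fk: "homeomorphism (UNIV::real set) L f k"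
      and kz: "k z \<in> closed_segment (k (h s)) (k (h u))"
      unfolding subsegment_def by blast
    define q where "q = (\<lambda>r. g (f r))"
    have fk': "f (k w) = w" if "w \<in> L" for w using fk that by (simp add: homeomorphism_def)
    have "continuous_on UNIV q"
      unfolding q_def
      by (rule continuous_on_compose2[of L g]) (use fk hg in \<open>auto simp: homeomorphism_def\<close>)
    moreover have "inj q"
    proof (rule injI)
      fix r r' assume "q r = q r'"
      then have "h (g (f r)) = h (g (f r'))" by (simp add: q_def)
      moreover have "f r \<in> L" "f r' \<in> L" using fk by (auto simp: homeomorphism_def)
      ultimately have "f r = f r'" using hg' by simp
      then have "k (f r) = k (f r')" by simp
      then show "r = r'" using fk by (simp add: homeomorphism_def)
    qed
    ultimately have "q ` closed_segment (k (h s)) (k (h u)) = closed_segment (q (k (h s))) (q (k (h u)))"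
      by (intro continuous_injective_image_segment_1) (auto intro: continuous_on_subset inj_on_subset)
    moreover have "q (k w) = g w" if "w \<in> L" for w using fk' that by (simp add: q_def)
    ultimately have "g z \<in> closed_segment s u"
      using kz z hL gh by (metis imageI)
    then show "z \<in> h ` closed_segment s u" using hg'[OF z] by (metis imageI)
  qed
qed

text \<open>The part of a closed \<open>L\<close> in a ball is compact, so the continuous inverse
  \<open>g\<close> is bounded on it.\<close>

lemma closed_line_proper:
  assumes hg: "homeomorphism (UNIV::real set) L h g" and L: "closed (L :: complex set)"
  shows "filterlim h at_infinity at_top" "filterlim h at_infinity at_bot"
proof -
  have bd: "\<exists>B. \<forall>s. norm (h s) \<le> R \<longrightarrow> \<bar>s\<bar> \<le> B" for R
  proof -
    have "compact (L \<inter> cball 0 R)" using L by (simp add: closed_Int_compact)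
    moreover have "continuous_on (L \<inter> cball 0 R) g"
      using hg by (auto simp: homeomorphism_def intro: continuous_on_subset)
    ultimately have "compact (g ` (L \<inter> cball 0 R))" by (rule compact_continuous_image[rotated])
    then obtain B where B: "\<And>x. x \<in> g ` (L \<inter> cball 0 R) \<Longrightarrow> norm x \<le> B"
      using compact_imp_bounded bounded_iff by metis
    show ?thesis
    proof (intro exI[of _ B] allI impI)
      fix s assume "norm (h s) \<le> R"
      then have "h s \<in> L \<inter> cball 0 R" using hg by (auto simp: homeomorphism_def)
      moreover have "g (h s) = s" using hg by (simp add: homeomorphism_def)
      ultimately show "\<bar>s\<bar> \<le> B" using B by (metis imageI real_norm_def)
    qed
  qed
  show "filterlim h at_infinity at_top"
    unfolding filterlim_at_infinity[OF order_refl]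
  proof (intro allI impI)
    fix R :: real assume "R > 0"
    obtain B where B: "\<forall>s. norm (h s) \<le> R \<longrightarrow> \<bar>s\<bar> \<le> B" using bd by blast
    have "R \<le> norm (h s)" if "s > B" for s
    proof (rule ccontr)
      assume "\<not> R \<le> norm (h s)"
      then have "\<bar>s\<bar> \<le> B" using B by simp
      then show False using that by simp
    qed
    then show "\<forall>\<^sub>F s in at_top. R \<le> norm (h s)"
      by (rule eventually_mono[OF eventually_gt_at_top])
  qed
  show "filterlim h at_infinity at_bot"
    unfolding filterlim_at_infinity[OF order_refl]
  proof (intro allI impI)
    fix R :: real assume "R > 0"
    obtain B where B: "\<forall>s. norm (h s) \<le> R \<longrightarrow> \<bar>s\<bar> \<le> B" using bd by blast
    have "R \<le> norm (h s)" if "s < - B" for s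
    proof (rule ccontr)
      assume "\<not> R \<le> norm (h s)"
      then have "\<bar>s\<bar> \<le> B" using B by simp
      then show False using that by simp
    qed
    then show "\<forall>\<^sub>F s in at_bot. R \<le> norm (h s)"
      by (rule eventually_mono[OF eventually_gt_at_bot])
  qed
qed

text \<open>The data are stable under rotation and under reversal of the indices, the loop carrying
  no orientation. So the viewpoint can be moved to vertex 0, and statements about one side of
  \<open>J\<close> can be transferred to the other.\<close>

locale polygon_loop =
  fixes n :: nat and p :: "nat \<Rightarrow> complex" and \<L> :: "complex set set"
    and \<gamma> :: "real \<Rightarrow> complex" and t :: "nat \<Rightarrow> real"
  assumes n3: "3 \<le> n" and inj_p: "inj_on p {..<n}"
    and arr: "pseudo_line_arrangement \<L>"
    and uniq: "\<And>i j. i < n \<Longrightarrow> j < n \<Longrightarrow> i \<noteq> j \<Longrightarrow> \<exists>!l. l \<in> \<L> \<and> p i \<in> l \<and> p j \<in> l"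
    and two: "\<And>l. l \<in> \<L> \<Longrightarrow> card (l \<inter> p ` {..<n}) = 2"
    and loop: "simple_path \<gamma>" "pathfinish \<gamma> = pathstart \<gamma>" "path_image \<gamma> = boundary n p \<L>"
    and t: "strict_mono_on {..n} t" "t 0 = 0" "t n = 1"
    and \<gamma>t: "\<And>i. i < n \<Longrightarrow> \<gamma> (t i) = p i"
    and \<gamma>edge: "\<And>i. i < n \<Longrightarrow> \<gamma> ` {t i..t (Suc i)} = edge n p \<L> i"
begin

abbreviation "line \<equiv> pline p \<L>"
abbreviation "Bd \<equiv> boundary n p \<L>"
abbreviation "In \<equiv> inside (boundary n p \<L>)"
abbreviation "Out \<equiv> outside (boundary n p \<L>)"

lemma line: assumes "i < n" "j < n" "i \<noteq> j"
  shows "line i j \<in> \<L>" "p i \<in> line i j" "p j \<in> line i j"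
  using theI'[OF uniq[OF assms]] unfolding pline_def by auto

lemma line_eqI:
  assumes "i < n" "j < n" "i \<noteq> j" "l \<in> \<L>" "p i \<in> l" "p j \<in> l" shows "line i j = l"
  using line[OF assms(1-3)] uniq[OF assms(1-3)] assms(4-6) by blast

lemma line_commute: assumes "i < n" "j < n" "i \<noteq> j" shows "line i j = line j i"
  using assms line[of j i] by (intro line_eqI) auto

lemma p_inj: "i < n \<Longrightarrow> j < n \<Longrightarrow> p i = p j \<longleftrightarrow> i = j"
  using inj_p by (auto simp: inj_on_def)

lemma line_vertex:
  assumes "i < n" "j < n" "i \<noteq> j" "k < n" "p k \<in> line i j" shows "k = i \<or> k = j"
proof (rule ccontr)
  assume k: "\<not> (k = i \<or> k = j)"
  have "{p i, p j, p k} \<subseteq> line i j \<inter> p ` {..<n}"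
    using assms line[OF assms(1-3)] by auto
  moreover have "card {p i, p j, p k} = 3"
    using assms k p_inj by (auto simp: card_insert_if)
  moreover have "finite (line i j \<inter> p ` {..<n})" by simp
  ultimately have "3 \<le> card (line i j \<inter> p ` {..<n})" using card_mono by metis
  then show False using two[OF line(1)[OF assms(1-3)]] by simp
qed

lemma lines_meet:
  assumes "l \<in> \<L>" "l' \<in> \<L>" "l \<noteq> l'" "z \<in> l" "z \<in> l'" "w \<in> l" "w \<in> l'" shows "z = w"
proof -
  obtain x where "l \<inter> l' = {x}" using arr assms(1-3) unfolding pseudo_line_arrangement_def by blast
  then show ?thesis using assms(4-7) by (metis IntI singletonD)
qed

lemma lines_cross:
  assumes "l \<in> \<L>" "l' \<in> \<L>" "l \<noteq> l'" "z \<in> l" "z \<in> l'" shows "crosses_at l l' z"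
proof -
  obtain x where "l \<inter> l' = {x}" "crosses_at l l' x"
    using arr assms(1-3) unfolding pseudo_line_arrangement_def by blast
  then show ?thesis using assms(4-5) by (metis IntI singletonD)
qed

lemma line_neq:
  assumes "i < n" "j < n" "i \<noteq> j" "k < n" "l < n" "k \<noteq> l" "k \<noteq> i" "k \<noteq> j" shows "line i j \<noteq> line k l"
  using line_vertex[OF assms(1-3,4)] line[OF assms(4-6)] assms(7,8) by auto

lemma lines_meet_vertex:
  assumes "i < n" "j < n" "i \<noteq> j" "k < n" "i \<noteq> k" "j \<noteq> k" "z \<in> line i j" "z \<in> line i k" shows "z = p i"
proof -
  have "line k i \<noteq> line i j" using line_neq[of i j k i] assms by auto
  then have "line i k \<noteq> line i j" using line_commute[of i k] assms by auto
  then show ?thesis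
    using lines_meet[of "line i j" "line i k" z "p i"] line[of i j] line[of i k] assms by auto
qed

text \<open>Normalised so that order along the line becomes order of reals: the segment has the
  parameters from 0 to 1 and the ray beyond \<open>p j\<close> those above 1. \<open>h i j\<close>
  and \<open>h j i\<close> are independent choices, related only through their images.\<close>

definition h :: "nat \<Rightarrow> nat \<Rightarrow> real \<Rightarrow> complex" where
  "h i j = (SOME h. (\<exists>g. homeomorphism UNIV (line i j) h g) \<and> h 0 = p i \<and> h 1 = p j)"

lemma h: assumes "i < n" "j < n" "i \<noteq> j"
  shows h_homeo: "\<exists>g. homeomorphism UNIV (line i j) (h i j) g" and h0: "h i j 0 = p i" and h1: "h i j 1 = p j"
proof -
  have "pseudo_line (line i j)" using arr line(1)[OF assms] by (simp add: pseudo_line_arrangement_def)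
  moreover have "p i \<noteq> p j" using p_inj assms by simp
  ultimately obtain h' g where "homeomorphism UNIV (line i j) h' g" "h' 0 = p i" "h' (1::real) = p j"
    using pseudo_line_param[OF _ line(2,3)[OF assms]] by blast
  then have "\<exists>h::real \<Rightarrow> complex. (\<exists>g. homeomorphism UNIV (line i j) h g) \<and> h 0 = p i \<and> h 1 = p j"
    by blast
  from someI_ex[OF this, folded h_def]
  show "\<exists>g. homeomorphism UNIV (line i j) (h i j) g" "h i j 0 = p i" "h i j 1 = p j" by auto
qed

lemma h_line: assumes "i < n" "j < n" "i \<noteq> j" shows "range (h i j) = line i j" "h i j s \<in> line i j"
  using h_homeo[OF assms] by (auto simp: homeomorphism_def)

lemma h_cont: assumes "i < n" "j < n" "i \<noteq> j" shows "continuous_on S (h i j)"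
  using h_homeo[OF assms] by (auto simp: homeomorphism_def intro: continuous_on_subset)

lemma h_inj: assumes "i < n" "j < n" "i \<noteq> j" shows "h i j s = h i j s' \<longleftrightarrow> s = s'"
  using h_homeo[OF assms] unfolding homeomorphism_def by (metis UNIV_I)

lemma h_subsegment: assumes "i < n" "j < n" "i \<noteq> j"
  shows "subsegment (line i j) (h i j s) (h i j u) = h i j ` closed_segment s u"
  using h_homeo[OF assms] subsegment_param by blast

lemma h_seg: assumes "i < n" "j < n" "i \<noteq> j" shows "seg p \<L> i j = h i j ` {0..1}"
  using h_subsegment[OF assms, of 0 1] h0[OF assms] h1[OF assms]
  by (simp add: seg_def closed_segment_eq_real_ivl)

lemma line_closed: assumes "i < n" "j < n" "i \<noteq> j" shows "closed (line i j)"
  using arr line(1)[OF assms] by (simp add: pseudo_line_arrangement_def pseudo_line_def)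

lemma h_proper: assumes "i < n" "j < n" "i \<noteq> j"
  shows "filterlim (h i j) at_infinity at_top" "filterlim (h i j) at_infinity at_bot"
  using h_homeo[OF assms] closed_line_proper line_closed[OF assms] by blast+

text \<open>Continuity of the inverse homeomorphism: a line does not come back close to one of its
  points at a distant parameter.\<close>

lemma h_near: assumes "i < n" "j < n" "i \<noteq> j" "0 < \<delta>"
  obtains \<epsilon> where "0 < \<epsilon>" "\<And>s. h i j s \<in> ball (h i j r) \<epsilon> \<Longrightarrow> \<bar>s - r\<bar> < \<delta>"
proof -
  obtain g where g: "homeomorphism UNIV (line i j) (h i j) g" using h_homeo[OF assms(1-3)] by blast
  have gh: "g (h i j s) = s" for s using g by (simp add: homeomorphism_def)
  have "continuous_on (line i j) g" using g by (simp add: homeomorphism_def)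
  then obtain \<epsilon> where e: "\<epsilon> > 0"
    "\<And>z. z \<in> line i j \<Longrightarrow> dist z (h i j r) < \<epsilon> \<Longrightarrow> dist (g z) (g (h i j r)) < \<delta>"
    using assms(4) h_line(2)[OF assms(1-3), of r] unfolding continuous_on_iff by meson
  show thesis
  proof (rule that[OF e(1)])
    fix s assume "h i j s \<in> ball (h i j r) \<epsilon>"
    then show "\<bar>s - r\<bar> < \<delta>"
      using e(2)[OF h_line(2)[OF assms(1-3), of s]] by (simp add: gh dist_commute dist_real_def)
  qed
qed

lemma h_near': assumes "i < n" "j < n" "i \<noteq> j" "0 < \<epsilon>"
  obtains \<delta> where "0 < \<delta>" "\<And>s. \<bar>s - r\<bar> < \<delta> \<Longrightarrow> h i j s \<in> ball (h i j r) \<epsilon>"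
proof -
  have "continuous_on UNIV (h i j)" using h_cont[OF assms(1-3)] .
  then obtain \<delta> where "\<delta> > 0" "\<And>s. dist s r < \<delta> \<Longrightarrow> dist (h i j s) (h i j r) < \<epsilon>"
    using assms(4) unfolding continuous_on_iff by (meson UNIV_I)
  then show thesis using that[of \<delta>] by (simp add: dist_commute dist_real_def)
qed

section \<open>Inside, outside, and the loop parameters of vertices and edges\<close>

lemmas J = Jordan_inside_outside[OF loop(1,2), unfolded loop(3)]

lemma InOut: "open In" "connected In" "open Out" "connected Out" "In \<inter> Out = {}" "In \<union> Out = - Bd"
    "closure In = In \<union> Bd" "closure Out = Out \<union> Bd" "bounded In" "In \<noteq> {}" "Out \<noteq> {}" "\<not> bounded Out"
  using J by (auto simp: closure_Un_frontier)

lemma compact_Bd: "compact Bd"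
  using compact_simple_path_image[OF loop(1)] loop(3) by simp

lemma In_Out_components: "In \<in> components (- Bd)" "Out \<in> components (- Bd)"
  using InOut by (simp_all add: inside_in_components outside_in_components)

lemma t_mono: "i < j \<Longrightarrow> j \<le> n \<Longrightarrow> t i < t j"
  using t(1) by (auto simp: strict_mono_on_def)

lemma t_mono_le: "i \<le> j \<Longrightarrow> j \<le> n \<Longrightarrow> t i \<le> t j"
  using t_mono[of i j] by (cases "i = j") auto

lemma t01: "i \<le> n \<Longrightarrow> 0 \<le> t i" "i \<le> n \<Longrightarrow> t i \<le> 1"
  using t_mono_le[of 0 i] t_mono_le[of i n] t by auto

lemma t01': "0 < i \<Longrightarrow> i < n \<Longrightarrow> 0 < t i \<and> t i < 1"
  using t_mono[of 0 i] t_mono[of i n] t by auto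

lemma t_less_iff: "i \<le> n \<Longrightarrow> j \<le> n \<Longrightarrow> t i < t j \<longleftrightarrow> i < j"
  using t_mono[of i j] t_mono_le[of j i] by force

lemma \<gamma>_inj: "x \<in> {0..1} \<Longrightarrow> y \<in> {0..1} \<Longrightarrow> \<gamma> x = \<gamma> y \<Longrightarrow> x = y \<or> x = 0 \<and> y = 1 \<or> x = 1 \<and> y = 0"
  using loop(1) by (auto simp: simple_path_def loop_free_def)

lemma \<gamma>_cont: "S \<subseteq> {0..1} \<Longrightarrow> continuous_on S \<gamma>"
  using loop(1) by (auto simp: simple_path_def path_def intro: continuous_on_subset)

lemma \<gamma>01: "\<gamma> 0 = p 0" "\<gamma> 1 = p 0"
  using \<gamma>t[of 0] n3 t loop(2) by (auto simp: pathfinish_def pathstart_def)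

lemma \<gamma>_Bd: "x \<in> {0..1} \<Longrightarrow> \<gamma> x \<in> Bd"
  using loop(3) by (auto simp: path_image_def)

lemma p_Bd: "i < n \<Longrightarrow> p i \<in> Bd"
  using \<gamma>t[of i] \<gamma>_Bd[of "t i"] t01[of i] by auto

lemma \<gamma>_vertex: assumes "0 < x" "x < 1" "k < n" "\<gamma> x = p k" shows "x = t k"
proof -
  have "\<gamma> x = \<gamma> (t k)" using assms \<gamma>t by simp
  then show ?thesis using \<gamma>_inj[of x "t k"] assms t01[of k] by auto
qed

lemma Bd_param: assumes "z \<in> Bd" obtains x where "0 \<le> x" "x < 1" "\<gamma> x = z"
proof -
  have "z \<in> \<gamma> ` {0..1}" using assms loop(3) by (simp add: path_image_def)
  then obtain x where x: "x \<in> {0..1}" "\<gamma> x = z" by blast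
  show thesis
  proof (cases "x = 1")
    case True then show thesis using that[of 0] x \<gamma>01 by auto
  qed (use that[of x] x in auto)
qed

lemma index: assumes "0 \<le> x" "x < 1" obtains m where "m < n" "t m \<le> x" "x < t (Suc m)"
proof -
  define m where "m = (GREATEST k. k \<le> n \<and> t k \<le> x)"
  have m: "m \<le> n \<and> t m \<le> x"
    unfolding m_def by (rule GreatestI_nat[of "\<lambda>k. k \<le> n \<and> t k \<le> x" 0 n]) (use assms t in auto)
  have "m \<noteq> n" using m assms t by auto
  then have "m < n" using m by simp
  moreover have "\<not> t (Suc m) \<le> x"
  proof
    assume "t (Suc m) \<le> x"
    then have "Suc m \<le> m" using \<open>m < n\<close> unfolding m_def by (intro Greatest_le_nat[of _ _ n]) auto
    then show False by simp
  qed
  ultimately show thesis using that m by force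
qed

lemma cyc_succ: "m < n \<Longrightarrow> cyc_succ n m < n" "m < n \<Longrightarrow> cyc_succ n m \<noteq> m"
  using n3 by (auto simp: cyc_succ_def mod_Suc)

lemma cyc_succ_Suc: "m < n \<Longrightarrow> cyc_succ n m = (if Suc m = n then 0 else Suc m)"
  by (simp add: cyc_succ_def)

lemma edge_h: "m < n \<Longrightarrow> edge n p \<L> m = h m (cyc_succ n m) ` {0..1}"
  unfolding edge_def using h_seg cyc_succ by metis

lemma edge_line: "m < n \<Longrightarrow> edge n p \<L> m \<subseteq> line m (cyc_succ n m)"
  using edge_h h_line(2) cyc_succ by fastforce

lemma edge_Bd: "m < n \<Longrightarrow> edge n p \<L> m \<subseteq> Bd"
  by (auto simp: boundary_def)

text \<open>Near a relative interior point of an edge the boundary and the line of the edge coincide, so by local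
  connectivity a curve that changes sides of the line also changes sides of the boundary.\<close>

lemma line_edge_outside:
  assumes ij: "i < n" "j < n" "i \<noteq> j" and m: "m < n" and x: "t m < x" "x < t (Suc m)"
    and on: "\<gamma> x \<in> line i j" and ne: "line i j \<noteq> line m (cyc_succ n m)" and e: "0 < \<epsilon>"
  obtains a where "a \<in> line i j" "a \<in> ball (\<gamma> x) \<epsilon>" "a \<in> Out"
proof -
  define m' where "m' = cyc_succ n m"
  have m': "m' < n" "m \<noteq> m'" using cyc_succ[OF m] by (auto simp: m'_def)
  note mm = m m'
  have x01: "x \<in> {0..1}" "0 < x" "x < 1" using x t01[of m] t01[of "Suc m"] m by auto
  have "\<gamma> x \<in> edge n p \<L> m" using \<gamma>edge[OF m] x by auto
  then obtain r where r: "r \<in> {0..1}" "\<gamma> x = h m m' r" using edge_h[OF m] by (auto simp: m'_def)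
  have "\<gamma> x \<noteq> p k" if "k < n" for k
  proof
    assume "\<gamma> x = p k"
    then have "x = t k" using \<gamma>_vertex x01 that by simp
    then have "t m < t k" "t k < t (Suc m)" using x by auto
    then show False using t_less_iff[of m k] t_less_iff[of k "Suc m"] that m by simp
  qed
  then have "r \<noteq> 0" "r \<noteq> 1" using r h0[OF mm] h1[OF mm] m m' by metis+
  then have r01: "0 < r" "r < 1" using r by auto
  define K where "K = line m m'"
  \<comment> \<open>The bound \<open>min r (1 - r)\<close> keeps \<open>K\<close> near
    \<open>\<gamma> x\<close> on the edge itself, hence on the boundary and out of both
    sides.\<close>
  obtain \<epsilon>0 where e0: "0 < \<epsilon>0" "\<And>s. h m m' s \<in> ball (h m m' r) \<epsilon>0 \<Longrightarrow> \<bar>s - r\<bar> < min r (1 - r)"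
    using h_near[OF mm, of "min r (1 - r)" r] r01 by auto
  have KB: "ball (\<gamma> x) \<epsilon>0 \<inter> K \<subseteq> Bd"
  proof
    fix z assume z: "z \<in> ball (\<gamma> x) \<epsilon>0 \<inter> K"
    then obtain s where s: "z = h m m' s" using h_line(1)[OF mm] by (auto simp: K_def)
    then have "\<bar>s - r\<bar> < min r (1 - r)" using e0(2) z r by auto
    then have "s \<in> {0..1}" by auto
    then show "z \<in> Bd" using s edge_h[OF m] edge_Bd[OF m] by (auto simp: m'_def)
  qed
  \<comment> \<open>The rest of the boundary. It keeps a distance from \<open>\<gamma> x\<close>, so
    near \<open>\<gamma> x\<close> the boundary lies on \<open>K\<close>, and the points
    \<open>a\<close>, \<open>b\<close> off \<open>K\<close> below are off the boundary.\<close>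
  define C where "C = \<gamma> ` ({0..t m} \<union> {t (Suc m)..1})"
  have "compact C"
    unfolding C_def using t01[of m] t01[of "Suc m"] m by (intro compact_continuous_image \<gamma>_cont) auto
  moreover have "\<gamma> x \<notin> C"
  proof
    assume "\<gamma> x \<in> C"
    then obtain y where "y \<in> {0..t m} \<union> {t (Suc m)..1}" "\<gamma> x = \<gamma> y"
      unfolding C_def by (rule imageE)
    then show False using \<gamma>_inj[of x y] x x01 t01[of m] t01[of "Suc m"] m by auto
  qed
  ultimately obtain \<epsilon>1 where e1: "\<epsilon>1 > 0" "ball (\<gamma> x) \<epsilon>1 \<inter> C = {}"
    using open_contains_ball[of "- C"] compact_imp_closed by (metis ComplI disjoint_eq_subset_Compl open_Compl)
  have BC: "Bd \<subseteq> C \<union> K"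
  proof
    fix z assume "z \<in> Bd"
    then obtain y where y: "0 \<le> y" "y < 1" "\<gamma> y = z" by (rule Bd_param)
    show "z \<in> C \<union> K"
    proof (cases "t m \<le> y \<and> y \<le> t (Suc m)")
      case True
      then have "z \<in> edge n p \<L> m" using \<gamma>edge[OF m] y by auto
      then show ?thesis using edge_line[OF m] by (auto simp: K_def m'_def)
    qed (use y in \<open>auto simp: C_def\<close>)
  qed
  have clK: "closed K" using line_closed[OF mm] by (simp add: K_def)
  have lc: "\<exists>\<delta>>0. \<forall>a\<in>ball (\<gamma> x) \<delta> \<inter> V. \<forall>b \<in> ball (\<gamma> x) \<delta> \<inter> V. connected_component (V - K) a b"
    if V: "V \<in> components (- Bd)" for V
  proof -
    have V': "V \<in> components (- path_image \<gamma>)" "\<gamma> x \<in> path_image \<gamma>"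
      using V loop(3) \<gamma>_Bd[OF x01(1)] by auto
    have "ball (\<gamma> x) \<epsilon>0 \<inter> K \<inter> V = {}"
      using KB in_components_subset[OF V] by blast
    show ?thesis
    proof (rule boundary_local_connectivity[OF loop(1,2) V'(1) clK V'(2) e0(1)])
      show "ball (\<gamma> x) \<epsilon>0 \<inter> K \<inter> V = {}" by fact
      fix \<delta> :: real assume "\<delta> > 0"
        "\<And>a b. a \<in> ball (\<gamma> x) \<delta> \<inter> V \<Longrightarrow> b \<in> ball (\<gamma> x) \<delta> \<inter> V \<Longrightarrow> connected_component (V - K) a b"
      then show ?thesis by (intro exI[of _ \<delta>]) simp
    qed
  qed
  obtain \<delta>1 where d1: "\<delta>1 > 0"
    "\<forall>a\<in>ball (\<gamma> x) \<delta>1 \<inter> In. \<forall>b \<in> ball (\<gamma> x) \<delta>1 \<inter> In. connected_component (In - K) a b"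
    using lc[OF In_Out_components(1)] by blast
  define \<epsilon>' where "\<epsilon>' = min \<epsilon> (min \<epsilon>1 \<delta>1)"
  have e': "\<epsilon>' > 0" "\<epsilon>' \<le> \<epsilon>" "\<epsilon>' \<le> \<epsilon>1" "\<epsilon>' \<le> \<delta>1" using e e1 d1 by (auto simp: \<epsilon>'_def)
  have "\<gamma> x \<in> K" using r h_line(2)[OF mm] by (simp add: K_def)
  then have "crosses_at K (line i j) (\<gamma> x)"
    using lines_cross[of K "line i j" "\<gamma> x"] line(1)[OF mm] line(1)[OF ij] ne on by (auto simp: K_def m'_def)
  then obtain a b where ab: "a \<in> (line i j - K) \<inter> ball (\<gamma> x) \<epsilon>'" "b \<in> (line i j - K) \<inter> ball (\<gamma> x) \<epsilon>'"
    "\<not> connected_component (- K) a b"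
    unfolding crosses_at_def using e'(1) by blast
  have "ball (\<gamma> x) \<epsilon>' \<subseteq> ball (\<gamma> x) \<epsilon>1" using e'(3) by (rule subset_ball)
  then have "a \<notin> Bd" "b \<notin> Bd" using ab(1,2) BC e1(2) by blast+
  moreover have "\<not> (a \<in> In \<and> b \<in> In)"
  proof
    assume "a \<in> In \<and> b \<in> In"
    then have "connected_component (In - K) a b" using d1(2) ab(1,2) e'(4) by auto
    then have "connected_component (- K) a b" by (rule connected_component_of_subset) auto
    then show False using ab(3) by blast
  qed
  ultimately have "a \<in> Out \<or> b \<in> Out" using InOut(6) by blast
  then show thesis using that[of a] that[of b] ab(1,2) e'(2) by auto
qed

end

section \<open>Rays\<close>

context polygon_loop
begin

text \<open>The last parameter up to which the ray from \<open>p i\<close> through \<open>p k\<close> has not been outside; it is \<open>0\<close> if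
  the ray leaves the polygon at \<open>p i\<close>, and at least \<open>1\<close> iff \<open>p i\<close> sees \<open>p k\<close>.\<close>

definition extent :: "nat \<Rightarrow> nat \<Rightarrow> real" where
  "extent i k = Sup {r. 0 \<le> r \<and> h i k ` {0..r} \<inter> Out = {}}"

definition adjacent :: "nat \<Rightarrow> nat \<Rightarrow> bool" where
  "adjacent i k \<longleftrightarrow> k = cyc_succ n i \<or> i = cyc_succ n k"

lemma seg_commute: "i < n \<Longrightarrow> j < n \<Longrightarrow> i \<noteq> j \<Longrightarrow> seg p \<L> i j = seg p \<L> j i"
  unfolding seg_def using line_commute subsegment_commute by metis

lemma sees_commute: "sees n p \<L> i j \<longleftrightarrow> sees n p \<L> j i"
  unfolding sees_def using seg_commute by metis

lemma adjacent_sees: assumes "i < n" "k < n" "adjacent i k" shows "sees n p \<L> i k"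
proof -
  have *: "sees n p \<L> m (cyc_succ n m)" if m: "m < n" for m
  proof -
    have "seg p \<L> m (cyc_succ n m) \<subseteq> Bd" using edge_Bd[OF m] by (simp add: edge_def)
    then have "seg p \<L> m (cyc_succ n m) \<inter> Out = {}" using outside_no_overlap[of Bd] by blast
    then show ?thesis using cyc_succ[OF m] m by (simp add: sees_def)
  qed
  show ?thesis using assms *[of i] *[of k] sees_commute unfolding adjacent_def by metis
qed

context
  fixes i k :: nat assumes ik: "i < n" "k < n" "i \<noteq> k"
begin

lemma eventually_Out: "\<exists>r0\<ge>0. \<forall>r\<ge>r0. h i k r \<in> Out"
proof -
  obtain R where R: "In \<union> Bd \<subseteq> ball 0 R" "R > 0"
    using bounded_subset_ballD[of "In \<union> Bd" 0] InOut(9) compact_imp_bounded[OF compact_Bd] by auto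
  have "\<forall>\<^sub>F r in at_top. R \<le> norm (h i k r)"
    using h_proper(1)[OF ik] R(2) unfolding filterlim_at_infinity[OF order_refl] by blast
  then obtain r0 where "\<forall>r\<ge>r0. R \<le> norm (h i k r)" unfolding eventually_at_top_linorder by blast
  moreover have "z \<in> Out" if "R \<le> norm z" for z
  proof -
    have "z \<notin> ball 0 R" using that by simp
    then have "z \<notin> In \<union> Bd" using R(1) by blast
    then show ?thesis using InOut(6) by blast
  qed
  ultimately show ?thesis by (intro exI[of _ "max 0 r0"]) auto
qed

text \<open>The supremum is attained because \<open>Out\<close> is open: an outside point at the
  parameter \<open>extent i k\<close> would be preceded by further outside points, while
  \<open>p i\<close> itself is on the boundary.\<close>

lemma extent: "0 \<le> extent i k" "h i k ` {0..extent i k} \<inter> Out = {}" "\<And>r. 0 \<le> r \<Longrightarrow> h i k ` {0..r} \<inter> Out = {} \<Longrightarrow> r \<le> extent i k"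
proof -
  define S where "S = {r. 0 \<le> r \<and> h i k ` {0..r} \<inter> Out = {}}"
  have e: "extent i k = Sup S" by (simp add: extent_def S_def)
  obtain r0 where r0: "r0 \<ge> 0" "\<forall>r\<ge>r0. h i k r \<in> Out" using eventually_Out by blast
  have bdd: "bdd_above S"
  proof (rule bdd_aboveI)
    fix r assume r: "r \<in> S"
    show "r \<le> r0"
    proof (rule ccontr)
      assume "\<not> r \<le> r0"
      then have "h i k r \<in> Out" "r \<in> {0..r}" using r0 by auto
      moreover have "h i k ` {0..r} \<inter> Out = {}" using r by (simp add: S_def)
      ultimately show False by blast
    qed
  qed
  have B0: "h i k 0 \<in> Bd" using h0[OF ik] p_Bd[OF ik(1)] by simp
  have BO: "z \<notin> Out" if "z \<in> Bd" for z using that InOut(6) by blast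
  have S0: "0 \<in> S" using B0 BO by (simp add: S_def)
  show le: "r \<le> extent i k" if "0 \<le> r" "h i k ` {0..r} \<inter> Out = {}" for r
    unfolding e using that bdd by (intro cSup_upper) (auto simp: S_def)
  show ge: "0 \<le> extent i k" unfolding e using S0 bdd by (rule cSup_upper)
  have less: "h i k r \<notin> Out" if r: "0 \<le> r" "r < extent i k" for r
  proof -
    have "r < Sup S" "S \<noteq> {}" using r(2) S0 e by auto
    then obtain r' where r': "r' \<in> S" "r < r'" by (rule less_cSupE)
    then have "h i k r \<in> h i k ` {0..r'}" using r(1) by simp
    moreover have "h i k ` {0..r'} \<inter> Out = {}" using r'(1) by (simp add: S_def)
    ultimately show ?thesis by blast
  qed
  have "h i k (extent i k) \<notin> Out"
  proof
    assume O: "h i k (extent i k) \<in> Out"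
    then obtain \<epsilon> where \<epsilon>: "\<epsilon> > 0" "ball (h i k (extent i k)) \<epsilon> \<subseteq> Out" using InOut(3) open_contains_ball by blast
    obtain \<delta> where \<delta>: "\<delta> > 0" "\<And>s. \<bar>s - extent i k\<bar> < \<delta> \<Longrightarrow> h i k s \<in> ball (h i k (extent i k)) \<epsilon>"
      using h_near'[OF ik \<epsilon>(1), of "extent i k"] by blast
    have pos: "0 < extent i k" using O B0 BO ge by (cases "extent i k = 0") auto
    define s where "s = max 0 (extent i k - \<delta>/2)"
    have "0 \<le> s" "s < extent i k" "\<bar>s - extent i k\<bar> < \<delta>" using \<delta>(1) pos by (auto simp: s_def)
    then show False using \<delta>(2)[of s] \<epsilon>(2) less[of s] by blast
  qed
  then show "h i k ` {0..extent i k} \<inter> Out = {}"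
    using less by (force simp: le_less)
qed

lemma extent_not_Out: "0 \<le> r \<Longrightarrow> r \<le> extent i k \<Longrightarrow> h i k r \<notin> Out"
  using extent(2) by (metis IntI atLeastAtMost_iff empty_iff imageI)

lemma beyond_ext: assumes "extent i k < r" obtains s where "extent i k < s" "s \<le> r" "h i k s \<in> Out"
proof -
  have "h i k ` {0..r} \<inter> Out \<noteq> {}" using extent(3)[of r] extent(1) assms by force
  then obtain s where "0 \<le> s" "s \<le> r" "h i k s \<in> Out" by auto
  moreover then have "extent i k < s" using extent_not_Out[of s] by force
  ultimately show thesis using that by blast
qed

text \<open>The ray is outside at parameters arbitrarily soon after \<open>extent i k\<close>, which
  is impossible at a point of the open set \<open>In\<close>.\<close>

lemma extent_Bd: "h i k (extent i k) \<in> Bd"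
proof (rule ccontr)
  assume "h i k (extent i k) \<notin> Bd"
  then have "h i k (extent i k) \<in> In" using extent_not_Out[OF extent(1) order_refl] InOut(6) by blast
  then obtain \<epsilon> where \<epsilon>: "\<epsilon> > 0" "ball (h i k (extent i k)) \<epsilon> \<subseteq> In" using InOut(1) open_contains_ball by blast
  obtain \<delta> where \<delta>: "\<delta> > 0" "\<And>s. \<bar>s - extent i k\<bar> < \<delta> \<Longrightarrow> h i k s \<in> ball (h i k (extent i k)) \<epsilon>"
    using h_near'[OF ik \<epsilon>(1), of "extent i k"] by blast
  have "extent i k < extent i k + \<delta>/2" using \<delta>(1) by simp
  then obtain s where s: "extent i k < s" "s \<le> extent i k + \<delta>/2" "h i k s \<in> Out" by (rule beyond_ext)
  then have "\<bar>s - extent i k\<bar> < \<delta>" using \<delta>(1) by simp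
  then have "h i k s \<in> In" using \<delta>(2) \<epsilon>(2) by blast
  then show False using s(3) InOut(5) by blast
qed

lemma sees_iff_extent: "sees n p \<L> i k \<longleftrightarrow> 1 \<le> extent i k"
proof
  assume "sees n p \<L> i k"
  then have "h i k ` {0..1} \<inter> Out = {}" using h_seg[OF ik] by (simp add: sees_def)
  then show "1 \<le> extent i k" using extent(3)[of 1] by simp
next
  assume "1 \<le> extent i k"
  then have "h i k ` {0..1} \<inter> Out = {}" using extent_not_Out by auto
  then show "sees n p \<L> i k" using h_seg[OF ik] ik by (simp add: sees_def)
qed

lemma vertex_on_line: assumes "v < n" "h i k r = p v" shows "(r = 0 \<and> v = i) \<or> (r = 1 \<and> v = k)"
proof -
  have "v = i \<or> v = k" using line_vertex[OF ik assms(1)] h_line(2)[OF ik, of r] assms(2) by simp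
  then show ?thesis using assms(2) h0[OF ik] h1[OF ik] h_inj[OF ik] by metis
qed

text \<open>General position: the line of an edge contains no vertices but the two ends of the
  edge.\<close>

lemma same_edge_line:
  assumes m: "m < n" and eq: "line i k = line m (cyc_succ n m)"
  shows "adjacent i k" "edge n p \<L> m = h i k ` {0..1}"
proof -
  note m' = m cyc_succ(1)[OF m] cyc_succ(2)[OF m, symmetric]
  have "(i = m \<or> i = cyc_succ n m) \<and> (k = m \<or> k = cyc_succ n m)"
    using line_vertex[OF m'] line(2,3)[OF ik] eq ik by metis
  then have c: "(i = m \<and> k = cyc_succ n m) \<or> (k = m \<and> i = cyc_succ n m)" using ik(3) by blast
  then show "adjacent i k" by (auto simp: adjacent_def)
  show "edge n p \<L> m = h i k ` {0..1}"
    unfolding edge_def using c h_seg[OF ik] seg_commute[OF ik] by metis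
qed

text \<open>Suppose the point is on an edge. If the edge belongs to another line,
  \<open>line_edge_outside\<close> gives an outside point so close by that its parameter is still
  between 0 and \<open>extent i k\<close>. If it belongs to the same line, then \<open>p i\<close>
  and \<open>p k\<close> are its ends and \<open>r < 1\<close>.\<close>

lemma segment_In:
  assumes r: "0 < r" "r < extent i k" "r \<noteq> 1" and na: "\<not> (adjacent i k \<and> r < 1)"
  shows "h i k r \<in> In"
proof (rule ccontr)
  assume "h i k r \<notin> In"
  moreover have "h i k r \<notin> Out" using extent_not_Out[of r] r by simp
  ultimately have "h i k r \<in> Bd" using InOut(6) by blast
  then obtain x where x: "0 \<le> x" "x < 1" "\<gamma> x = h i k r" by (rule Bd_param)
  obtain m where m: "m < n" "t m \<le> x" "x < t (Suc m)" using index[OF x(1,2)] by blast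
  have nv: "h i k r \<noteq> p v" if "v < n" for v using vertex_on_line[OF that] r by auto
  have "x \<noteq> t m" using nv[OF m(1)] \<gamma>t[OF m(1)] x(3) by auto
  then have xm: "t m < x" using m by simp
  show False
  proof (cases "line i k = line m (cyc_succ n m)")
    case True
    have "h i k r \<in> edge n p \<L> m" using \<gamma>edge[OF m(1)] m x(3) by (metis atLeastAtMost_iff imageI less_imp_le)
    then obtain s where "s \<in> {0..1}" "h i k r = h i k s" using same_edge_line(2)[OF m(1) True] by auto
    then have "r \<le> 1" using h_inj[OF ik] by auto
    then show False using same_edge_line(1)[OF m(1) True] na r(3) by simp
  next
    case False
    define \<delta> where "\<delta> = min r (extent i k - r)"
    have "\<delta> > 0" using r by (simp add: \<delta>_def)
    then obtain \<epsilon> where \<epsilon>: "\<epsilon> > 0" "\<And>s. h i k s \<in> ball (h i k r) \<epsilon> \<Longrightarrow> \<bar>s - r\<bar> < \<delta>"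
      using h_near[OF ik] by metis
    have "\<gamma> x \<in> line i k" using x(3) h_line(2)[OF ik] by simp
    then obtain a where a: "a \<in> line i k" "a \<in> ball (\<gamma> x) \<epsilon>" "a \<in> Out"
      using line_edge_outside[OF ik m(1) xm m(3) _ False \<epsilon>(1)] by blast
    obtain s where s: "a = h i k s" using a(1) h_line(1)[OF ik] by blast
    then have "\<bar>s - r\<bar> < \<delta>" using \<epsilon>(2) a(2) x(3) by simp
    then have "0 \<le> s" "s \<le> extent i k" by (auto simp: \<delta>_def)
    then show False using extent_not_Out a(3) s by blast
  qed
qed

text \<open>In the parameter of \<open>h i k\<close>, a subsegment from \<open>p k\<close> along the
  ray avoids \<open>Out\<close> exactly if it ends no later than \<open>extent i k\<close>, because
  the segment up to \<open>p k\<close> is visible. The condition \<open>1 < extent i k\<close> says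
  that the ray does not leave the polygon at \<open>p k\<close>.\<close>

lemma first_exits_iff:
  assumes "sees n p \<L> i k"
  shows "first_exits_through n p \<L> i k m \<longleftrightarrow> 1 < extent i k \<and> h i k (extent i k) \<in> edge n p \<L> m"
proof -
  have e1: "1 \<le> extent i k" using assms sees_iff_extent by simp
  have ray: "ray_away (line i k) (p i) (p k) = h i k ` {1<..}"
  proof -
    have "h i k u \<in> ray_away (line i k) (p i) (p k) \<longleftrightarrow> 1 < u" for u
    proof -
      have "subsegment (line i k) (p i) (h i k u) = h i k ` closed_segment 0 u"
        using h_subsegment[OF ik, of 0 u] h0[OF ik] by simp
      then have "p k \<in> subsegment (line i k) (p i) (h i k u) \<longleftrightarrow> 1 \<in> closed_segment 0 u"
        using h1[OF ik] h_inj[OF ik] by (metis image_iff)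
      moreover have "h i k u \<noteq> p k \<longleftrightarrow> u \<noteq> 1" using h1[OF ik] h_inj[OF ik] by metis
      ultimately show ?thesis
        using h_line(2)[OF ik, of u] by (auto simp: ray_away_def closed_segment_eq_real_ivl)
    qed
    moreover have "ray_away (line i k) (p i) (p k) \<subseteq> range (h i k)"
      using h_line(1)[OF ik] by (auto simp: ray_away_def)
    ultimately show ?thesis by auto
  qed
  have sub: "subsegment (line i k) (p k) (h i k u) = h i k ` {1..u}" if "1 < u" for u
    using h_subsegment[OF ik, of 1 u] h1[OF ik] that by (simp add: closed_segment_eq_real_ivl)
  have O: "h i k ` {1..u} \<inter> Out = {} \<longleftrightarrow> u \<le> extent i k" if "1 < u" for u
  proof
    assume a: "h i k ` {1..u} \<inter> Out = {}"
    have "h i k ` {0..u} \<inter> Out = {}"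
    proof -
      have "h i k s \<notin> Out" if s: "s \<in> {0..u}" for s
      proof (cases "s \<le> 1")
        case True then show ?thesis using extent_not_Out[of s] e1 s by simp
      next
        case False
        then have "s \<in> {1..u}" using s by simp
        then show ?thesis using a by blast
      qed
      then show ?thesis by blast
    qed
    then show "u \<le> extent i k" using extent(3)[of u] that by simp
  next
    assume "u \<le> extent i k" then show "h i k ` {1..u} \<inter> Out = {}" using extent_not_Out by fastforce
  qed
  have *: "first_exits_through n p \<L> i k m \<longleftrightarrow>
     (\<exists>u>1. h i k u \<in> edge n p \<L> m \<and> u \<le> extent i k \<and> (\<forall>v>1. v \<le> extent i k \<longrightarrow> v \<le> u))"
  proof -
    have "first_exits_through n p \<L> i k m \<longleftrightarrow>
     (\<exists>u>1. h i k u \<in> edge n p \<L> m \<and> subsegment (line i k) (p k) (h i k u) \<inter> Out = {} \<and>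
       (\<forall>v>1. subsegment (line i k) (p k) (h i k v) \<inter> Out = {} \<longrightarrow> h i k v \<in> subsegment (line i k) (p k) (h i k u)))"
      unfolding first_exits_through_def Let_def ray by auto
    also have "\<dots> \<longleftrightarrow> (\<exists>u>1. h i k u \<in> edge n p \<L> m \<and> u \<le> extent i k \<and> (\<forall>v>1. v \<le> extent i k \<longrightarrow> v \<le> u))"
    proof -
      have in_im: "h i k v \<in> h i k ` {1..u} \<longleftrightarrow> 1 \<le> v \<and> v \<le> u" for u v
        using h_inj[OF ik] by auto
      have key: "(h i k u \<in> edge n p \<L> m \<and> subsegment (line i k) (p k) (h i k u) \<inter> Out = {} \<and>
          (\<forall>v>1. subsegment (line i k) (p k) (h i k v) \<inter> Out = {} \<longrightarrow> h i k v \<in> subsegment (line i k) (p k) (h i k u))) \<longleftrightarrow>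
        (h i k u \<in> edge n p \<L> m \<and> u \<le> extent i k \<and> (\<forall>v>1. v \<le> extent i k \<longrightarrow> v \<le> u))" if "1 < u" for u
        using that by (auto simp: sub O in_im)
      show ?thesis by (rule ex_cong1, rule conj_cong[OF refl], rule key)
    qed
    finally show ?thesis .
  qed
  show ?thesis
  proof
    assume "first_exits_through n p \<L> i k m"
    then obtain u where u: "1 < u" "h i k u \<in> edge n p \<L> m" "u \<le> extent i k" "\<forall>v>1. v \<le> extent i k \<longrightarrow> v \<le> u"
      unfolding * by blast
    then have "1 < extent i k" by simp
    then have "u = extent i k" using u(3,4) by (simp add: order_antisym)
    then show "1 < extent i k \<and> h i k (extent i k) \<in> edge n p \<L> m" using u by simp
  next
    assume "1 < extent i k \<and> h i k (extent i k) \<in> edge n p \<L> m"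
    then show "first_exits_through n p \<L> i k m" unfolding * by blast
  qed
qed

end

end

section \<open>Crossing chords\<close>

context polygon_loop
begin

lemma h_arc:
  assumes "i < n" "j < n" "i \<noteq> j" "a \<noteq> b"
  shows "arc (h i j \<circ> linepath a b)" "pathstart (h i j \<circ> linepath a b) = h i j a"
    "pathfinish (h i j \<circ> linepath a b) = h i j b" "path_image (h i j \<circ> linepath a b) = h i j ` closed_segment a b"
proof -
  have "inj_on (h i j) (closed_segment a b)" using h_inj[OF assms(1-3)] by (simp add: inj_on_def)
  moreover have "arc (linepath a b)" using assms(4) by (rule arc_linepath)
  moreover have "continuous_on {0..1} (h i j \<circ> linepath a b)"
    by (intro continuous_on_compose h_cont[OF assms(1-3)] continuous_on_linepath)
  ultimately show "arc (h i j \<circ> linepath a b)"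
    unfolding arc_def path_def by (simp add: comp_inj_on linepath_image_01)
qed (simp_all add: pathstart_compose pathfinish_compose path_image_compose)

lemma h_open_segment:
  assumes "i < n" "j < n" "i \<noteq> j" "a < b"
  shows "connected (h i j ` {a<..<b})" "h i j a \<in> closure (h i j ` {a<..<b})" "h i j b \<in> closure (h i j ` {a<..<b})"
proof -
  show "connected (h i j ` {a<..<b})"
    using h_cont[OF assms(1-3)] by (intro connected_continuous_image) auto
  have "closure {a<..<b} = {a..b}" using assms(4) by simp
  then show "h i j a \<in> closure (h i j ` {a<..<b})" "h i j b \<in> closure (h i j ` {a<..<b})"
    using assms(4) by (auto intro!: closure_image_mono_on[OF h_cont[OF assms(1-3), of UNIV]])
qed

text \<open>\<open>crossing_chords\<close> with the first segment, ends included, as the arc and the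
  second, ends removed, as the connected set. Hence the bounds on \<open>s\<close> are closed and
  those on \<open>s'\<close> open; the open ones exclude that the second segment is met only at an
  end.\<close>

lemma chords_cross:
  assumes xy: "0 \<le> x" "x < y" "y < 1"
    and ij: "i < n" "j < n" "i \<noteq> j" "a < b" "h i j ` {a<..<b} \<subseteq> In"
    and ends: "(h i j a = \<gamma> x \<and> h i j b = \<gamma> y) \<or> (h i j a = \<gamma> y \<and> h i j b = \<gamma> x)"
    and ij': "i' < n" "j' < n" "i' \<noteq> j'" "a' < b'" "h i' j' ` {a'<..<b'} \<subseteq> In"
    and ends': "(h i' j' a' = \<gamma> u \<and> h i' j' b' = \<gamma> v) \<or> (h i' j' a' = \<gamma> v \<and> h i' j' b' = \<gamma> u)"
    and uv: "x < u" "u < y" "0 \<le> v" "v < 1" "v \<notin> {x..y}"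
  obtains s s' where "a \<le> s" "s \<le> b" "a' < s'" "s' < b'" "h i j s = h i' j' s'"
proof -
  have seg: "h i j ` {a..b} - {\<gamma> x, \<gamma> y} \<subseteq> In"
  proof
    fix z assume z: "z \<in> h i j ` {a..b} - {\<gamma> x, \<gamma> y}"
    then obtain s where s: "s \<in> {a..b}" "z = h i j s" by blast
    then have "s \<noteq> a" "s \<noteq> b" using z ends by auto
    then have "s \<in> {a<..<b}" using s by auto
    then show "z \<in> In" using s ij(5) by blast
  qed
  obtain d where d: "arc d" "pathstart d = \<gamma> x" "pathfinish d = \<gamma> y" "path_image d = h i j ` {a..b}"
  proof (cases "h i j a = \<gamma> x \<and> h i j b = \<gamma> y")
    case True
    then show thesis
      using that[of "h i j \<circ> linepath a b"] h_arc[OF ij(1-3), of a b] ij(4) by (auto simp: closed_segment_eq_real_ivl)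
  next
    case False
    then show thesis
      using that[of "h i j \<circ> linepath b a"] h_arc[OF ij(1-3), of b a] ij(4) ends by (auto simp: closed_segment_eq_real_ivl)
  qed
  have nv: "\<gamma> v \<notin> \<gamma> ` {x..y}"
  proof
    assume "\<gamma> v \<in> \<gamma> ` {x..y}"
    then obtain w where w: "w \<in> {x..y}" "\<gamma> v = \<gamma> w" by blast
    then show False using \<gamma>_inj[of v w] uv xy by auto
  qed
  have "h i' j' ` {a'<..<b'} \<inter> path_image d \<noteq> {}"
  proof (rule crossing_chords[of \<gamma> x y d _ u v])
    show "\<gamma> u \<in> closure (h i' j' ` {a'<..<b'})" "\<gamma> v \<in> closure (h i' j' ` {a'<..<b'})"
      using h_open_segment(2,3)[OF ij'(1-4)] ends' by metis+
    show "connected (h i' j' ` {a'<..<b'})" by (rule h_open_segment(1)[OF ij'(1-4)])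
    show "h i' j' ` {a'<..<b'} \<subseteq> inside (path_image \<gamma>)" using ij'(5) loop(3) by simp
    show "path_image d - {\<gamma> x, \<gamma> y} \<subseteq> inside (path_image \<gamma>)" using seg d(4) loop(3) by simp
    show "x < y" "x < u" "u < y" "0 \<le> x" "y \<le> 1" "y - x < 1" "v \<in> {0..1}" using xy uv by auto
  qed (fact nv d loop)+
  then obtain s s' where "s' \<in> {a'<..<b'}" "s \<in> {a..b}" "h i j s = h i' j' s'"
    unfolding d(4) by (auto simp: set_eq_iff)
  then show thesis using that[of s s'] by auto
qed

lemma \<gamma>_edge:
  assumes "0 < \<tau>" "\<tau> < 1" "\<And>v. v \<le> n \<Longrightarrow> \<tau> \<noteq> t v" "m < n"
  shows "\<gamma> \<tau> \<in> edge n p \<L> m \<longleftrightarrow> t m < \<tau> \<and> \<tau> < t (Suc m)"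
proof
  assume "\<gamma> \<tau> \<in> edge n p \<L> m"
  then have "\<gamma> \<tau> \<in> \<gamma> ` {t m..t (Suc m)}" using \<gamma>edge[OF assms(4)] by simp
  then obtain w where w: "w \<in> {t m..t (Suc m)}" "\<gamma> \<tau> = \<gamma> w" by (rule imageE)
  then have "\<tau> = w" using \<gamma>_inj[of \<tau> w] assms(1,2,4) t01[of m] t01[of "Suc m"] by auto
  then show "t m < \<tau> \<and> \<tau> < t (Suc m)" using w assms(3)[of m] assms(3)[of "Suc m"] assms(4) by auto
next
  assume "t m < \<tau> \<and> \<tau> < t (Suc m)"
  then have "\<tau> \<in> {t m..t (Suc m)}" by simp
  then show "\<gamma> \<tau> \<in> edge n p \<L> m" using \<gamma>edge[OF assms(4)] by blast
qed

text \<open>Away from the vertices the loop parameter determines the edge, so the edges before and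
  after \<open>J\<close> become the two sides of \<open>t J\<close>.\<close>

lemma \<gamma>_edge_index:
  assumes "0 < \<tau>" "\<tau> < 1" "\<And>v. v \<le> n \<Longrightarrow> \<tau> \<noteq> t v" "J < n"
  shows "(\<exists>m\<in>{J..<n}. \<gamma> \<tau> \<in> edge n p \<L> m) \<longleftrightarrow> t J < \<tau>" "(\<exists>m<J. \<gamma> \<tau> \<in> edge n p \<L> m) \<longleftrightarrow> \<tau> < t J"
proof -
  obtain m where m: "m < n" "t m \<le> \<tau>" "\<tau> < t (Suc m)" using index[of \<tau>] assms(1,2) by auto
  have in_m: "\<gamma> \<tau> \<in> edge n p \<L> m" using m \<gamma>edge[OF m(1)] by (metis atLeastAtMost_iff imageI less_imp_le)
  show "(\<exists>m\<in>{J..<n}. \<gamma> \<tau> \<in> edge n p \<L> m) \<longleftrightarrow> t J < \<tau>"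
  proof
    assume "\<exists>m\<in>{J..<n}. \<gamma> \<tau> \<in> edge n p \<L> m"
    then obtain k where k: "k \<in> {J..<n}" "\<gamma> \<tau> \<in> edge n p \<L> k" by blast
    then have "t k < \<tau>" using \<gamma>_edge[OF assms(1-3), of k] by simp
    then show "t J < \<tau>" using t_mono_le[of J k] k by simp
  next
    assume "t J < \<tau>"
    then have "t J < t (Suc m)" using m by simp
    then have "J \<le> m" using t_less_iff[of J "Suc m"] m assms(4) by simp
    then show "\<exists>m\<in>{J..<n}. \<gamma> \<tau> \<in> edge n p \<L> m" using in_m m by auto
  qed
  show "(\<exists>m<J. \<gamma> \<tau> \<in> edge n p \<L> m) \<longleftrightarrow> \<tau> < t J"
  proof
    assume "\<exists>m<J. \<gamma> \<tau> \<in> edge n p \<L> m"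
    then obtain k where k: "k < J" "\<gamma> \<tau> \<in> edge n p \<L> k" by blast
    then have "\<tau> < t (Suc k)" using \<gamma>_edge[OF assms(1-3), of k] assms(4) by simp
    then show "\<tau> < t J" using t_mono_le[of "Suc k" J] k assms(4) by simp
  next
    assume "\<tau> < t J"
    then have "t m < t J" using m by simp
    then have "m < J" using t_less_iff[of m J] m assms(4) by simp
    then show "\<exists>m<J. \<gamma> \<tau> \<in> edge n p \<L> m" using in_m m by auto
  qed
qed

text \<open>By general position only the parameters 0 and 1 of the ray give vertices.\<close>

lemma exit_param:
  assumes k: "0 < k" "k < n" and r: "r \<noteq> 0" "r \<noteq> 1" "h 0 k r \<in> Bd"
  obtains \<tau> where "0 < \<tau>" "\<tau> < 1" "\<gamma> \<tau> = h 0 k r" "\<And>v. v \<le> n \<Longrightarrow> \<tau> \<noteq> t v"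
proof -
  have ik: "0 < n" "k < n" "0 \<noteq> k" using k by auto
  obtain \<tau> where \<tau>: "0 \<le> \<tau>" "\<tau> < 1" "\<gamma> \<tau> = h 0 k r" using r(3) by (rule Bd_param)
  have nv: "h 0 k r \<noteq> p v" if "v < n" for v using vertex_on_line[OF ik that] r by auto
  have ne: "\<tau> \<noteq> t v" if "v \<le> n" for v
  proof
    assume a: "\<tau> = t v"
    then have "v < n" using that \<tau>(2) t(3) by (cases "v = n") auto
    then show False using nv[of v] \<gamma>t[of v] \<tau>(3) a by simp
  qed
  moreover have "0 < \<tau>" using ne[of 0] t(2) \<tau>(1) by simp
  ultimately show thesis using that \<tau> by blast
qed

lemma adjacent_0: "0 < k \<Longrightarrow> k < n \<Longrightarrow> adjacent 0 k \<longleftrightarrow> k = 1 \<or> k = n - 1"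
  using n3 by (auto simp: adjacent_def cyc_succ_Suc)

lemma beyond_In: assumes "0 < k" "k < n" shows "h 0 k ` {1<..<extent 0 k} \<subseteq> In"
proof
  fix z assume "z \<in> h 0 k ` {1<..<extent 0 k}"
  then obtain r where "1 < r" "r < extent 0 k" "z = h 0 k r" by auto
  then show "z \<in> In" using segment_In[of 0 k r] assms by auto
qed

lemma sees_In: assumes "i < n" "k < n" "i \<noteq> k" "sees n p \<L> i k" "\<not> adjacent i k" shows "h i k ` {0<..<1} \<subseteq> In"
proof
  fix z assume "z \<in> h i k ` {0<..<1}"
  then obtain r where "0 < r" "r < 1" "z = h i k r" by auto
  then show "z \<in> In" using segment_In[OF assms(1-3), of r] sees_iff_extent[OF assms(1-3)] assms by auto
qed

lemma exit_separates:
  assumes k: "0 < k" "k < J" "J < n" and inv: "\<not> sees n p \<L> 0 J" and sk: "sees n p \<L> 0 k" "1 < extent 0 k"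
    and \<tau>: "h 0 k (extent 0 k) = \<gamma> \<tau>" "t J < \<tau>" "\<tau> < 1"
    and s: "s < k" and u: "k < u" "u \<le> J"
  shows "\<not> sees n p \<L> s u"
proof
  assume su: "sees n p \<L> s u"
  have k': "0 < n" "k < n" "0 \<noteq> k" using k by auto
  have su': "s < n" "u < n" "s \<noteq> u" using s u k by auto
  \<comment> \<open>As \<open>k\<close> lies strictly between \<open>s\<close> and \<open>u\<close>,
    adjacency would mean \<open>s = 0\<close> and \<open>u = n - 1 = J\<close>, against the
    invisibility of \<open>J\<close>.\<close>
  have na: "\<not> adjacent s u"
  proof
    assume "adjacent s u"
    then have "s = 0 \<and> u = n - 1" using s u su' by (auto simp: adjacent_def cyc_succ_Suc split: if_splits)
    then have "J = u" using u k by simp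
    then show False using inv su \<open>s = 0 \<and> u = n - 1\<close> by simp
  qed
  note S = sees_In[OF su' su na]
  have ts: "0 \<le> t s" "t s < t k" "t k < t u" "t u \<le> t J" "t J < 1"
    using t01[of s] t_mono[of s k] t_mono[of k u] t_mono_le[of u J] t01'[of J] s u k su' by auto
  have ends: "h s u 0 = \<gamma> (t s)" "h s u 1 = \<gamma> (t u)" "h 0 k 0 = \<gamma> 0" "h 0 k 1 = \<gamma> (t k)"
    using h0[OF su'] h1[OF su'] h0[OF k'] h1[OF k'] \<gamma>t su' k' \<gamma>01 by auto
  obtain r r' where r: "1 \<le> r" "r \<le> extent 0 k" "0 < r'" "r' < 1" "h 0 k r = h s u r'"
  proof (rule chords_cross[of "t k" \<tau> 0 k 1 "extent 0 k" s u 0 1 "t u" "t s"])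
    show "h 0 k ` {1<..<extent 0 k} \<subseteq> In" using beyond_In k by simp
  qed (use k' su' S ends \<tau> ts sk(2) that in auto)
  have on: "h 0 k r \<in> line 0 k" "h 0 k r \<in> line s u"
    using h_line(2)[OF k', of r] h_line(2)[OF su', of r'] r(5) by simp_all
  \<comment> \<open>For \<open>s = 0\<close> both lines pass through \<open>p 0\<close>, so the
    crossing with the ray is already one too many. Otherwise the segment also crosses the one from
    \<open>p 0\<close> to \<open>p k\<close>, at a parameter \<open>q \<le> 1 \<le> r\<close>. Both
    crossings coincide, so \<open>q = r = 1\<close>, and \<open>p k\<close> would be a third vertex
    on \<open>line s u\<close>.\<close>
  show False
  proof (cases "s = 0")
    case True
    then have "h 0 k r = p 0" using lines_meet_vertex[of 0 k u "h 0 k r"] on k' su' u by auto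
    then have "h 0 k r = h 0 k 0" using h0[OF k'] by simp
    then show False using h_inj[OF k'] r(1) by simp
  next
    case False
    then have "t 0 < t s" using t_mono[of 0 s] su' by simp
    have na': "\<not> adjacent 0 k" using adjacent_0[of k] k s False by auto
    note S' = sees_In[OF k' sk(1) na']
    obtain q q' where q: "0 \<le> q" "q \<le> 1" "0 < q'" "q' < 1" "h 0 k q = h s u q'"
      by (rule chords_cross[of 0 "t k" 0 k 0 1 s u 0 1 "t s" "t u"])
        (use k' su' S S' ends \<tau> ts \<open>t 0 < t s\<close> t(2) in auto)
    have on': "h 0 k q \<in> line 0 k" "h 0 k q \<in> line s u"
      using h_line(2)[OF k', of q] h_line(2)[OF su', of q'] q(5) by simp_all
    have "line 0 k \<noteq> line s u" using line_neq[OF k' su'] s False by auto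
    then have "h 0 k q = h 0 k r" using lines_meet[of "line 0 k" "line s u"] line(1)[OF k'] line(1)[OF su'] on on' by blast
    then have "q = r" using h_inj[OF k'] by simp
    then have "r = 1" using q r by simp
    then have "p k \<in> line s u" using on(2) h1[OF k'] by simp
    then show False using line_vertex[OF su' k'(2)] s u by auto
  qed
qed

text \<open>Distinct lines through \<open>p 0\<close> meet nowhere else. So neither ray, beyond its
  vertex, can cross the segment from \<open>p 0\<close> to the other vertex, which forces
  \<open>\<tau> < t k'\<close> and \<open>t k < \<tau>'\<close>. Together with
  \<open>\<tau>' < t J < \<tau>\<close> this interlaces the ends of the two rays along the loop, and
  the rays cross.\<close>

lemma exits_incompatible:
  assumes k: "0 < k" "k < J" and k': "J < k'" "k' < n"
    and sk: "sees n p \<L> 0 k" "1 < extent 0 k" and sk': "sees n p \<L> 0 k'" "1 < extent 0 k'"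
    and \<tau>: "h 0 k (extent 0 k) = \<gamma> \<tau>" "t J < \<tau>" "\<tau> < 1" "\<And>v. v \<le> n \<Longrightarrow> \<tau> \<noteq> t v"
    and \<tau>': "h 0 k' (extent 0 k') = \<gamma> \<tau>'" "0 < \<tau>'" "\<tau>' < t J" "\<And>v. v \<le> n \<Longrightarrow> \<tau>' \<noteq> t v"
  shows False
proof -
  have K: "0 < n" "k < n" "0 \<noteq> k" and K': "0 < n" "k' < n" "0 \<noteq> k'" and kk: "k \<noteq> k'" using k k' by auto
  have ts: "0 < t k" "t k < t J" "t J < t k'" "t k' < 1"
    using t01'[of k] t_mono[of k J] t_mono[of J k'] t01'[of k'] k k' by auto
  have ends: "h 0 k 0 = \<gamma> 0" "h 0 k 1 = \<gamma> (t k)" "h 0 k' 0 = \<gamma> 0" "h 0 k' 1 = \<gamma> (t k')"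
    using h0[OF K] h1[OF K] h0[OF K'] h1[OF K'] \<gamma>t K K' \<gamma>01 by auto
  have meet: False if "h 0 k r = h 0 k' r'" "r \<noteq> 0" for r r'
  proof -
    have "h 0 k r = p 0"
      using lines_meet_vertex[of 0 k k' "h 0 k r"] h_line(2)[OF K, of r] h_line(2)[OF K', of r'] that K K' kk by simp
    then have "h 0 k r = h 0 k 0" using h0[OF K] by simp
    then show False using h_inj[OF K] that(2) by simp
  qed
  have e: "extent 0 k \<noteq> 0" "extent 0 k' \<noteq> 0" using sk sk' by auto
  have n1: "t (n - 1) < 1" using t01'[of "n-1"] n3 by simp
  have "\<tau> < t k'"
  proof (rule ccontr)
    assume "\<not> \<tau> < t k'"
    then have tk: "t k' < \<tau>" using \<tau>(4)[of k'] K' by force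
    \<comment> \<open>For \<open>k' = n - 1\<close> the segment from \<open>p 0\<close> to
      \<open>p k'\<close> is a boundary edge and no chord, but then the exit point itself lies on
      that edge.\<close>
    show False
    proof (cases "k' = n - 1")
      case True
      have "\<gamma> \<tau> \<in> edge n p \<L> k'" using \<gamma>_edge[of \<tau> k'] \<tau> tk ts True K' t(3) by auto
      then have "\<gamma> \<tau> \<in> line k' 0" using edge_line[of k'] K' True cyc_succ_Suc[of k'] by auto
      then have "\<gamma> \<tau> \<in> line 0 k'" using line_commute[OF K'] by simp
      then obtain r' where "\<gamma> \<tau> = h 0 k' r'" using h_line(1)[OF K'] by blast
      then show False using meet[of "extent 0 k" r'] \<tau>(1) e by simp
    next
      case False
      then have "\<not> adjacent 0 k'" using adjacent_0[of k'] K' k k' by auto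
      note S = sees_In[OF K' sk'(1) this]
      obtain r r' where "1 \<le> r" "h 0 k r = h 0 k' r'"
        by (rule chords_cross[of "t k" \<tau> 0 k 1 "extent 0 k" 0 k' 0 1 "t k'" 0])
          (use K K' S beyond_In[of k] ends \<tau> ts tk sk(2) in auto)
      then show False using meet[of r r'] by simp
    qed
  qed
  have "t k < \<tau>'"
  proof (rule ccontr)
    assume "\<not> t k < \<tau>'"
    then have tk: "\<tau>' < t k" using \<tau>'(4)[of k] K by force
    show False
    proof (cases "k = 1")
      case True
      have "\<gamma> \<tau>' \<in> edge n p \<L> 0" using \<gamma>_edge[of \<tau>' 0] \<tau>' tk ts True K t(2) by auto
      then have "\<gamma> \<tau>' \<in> line 0 k" using edge_line[of 0] K n3 True cyc_succ_Suc[of 0] by auto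
      then obtain r where r: "\<gamma> \<tau>' = h 0 k r" using h_line(1)[OF K] by blast
      have "r \<noteq> 0"
      proof
        assume "r = 0"
        then have "h 0 k' (extent 0 k') = h 0 k' 0" using r \<tau>'(1) ends by simp
        then show False using h_inj[OF K'] e by simp
      qed
      then show False using meet[of r "extent 0 k'"] r \<tau>'(1) by simp
    next
      case False
      then have "\<not> adjacent 0 k" using adjacent_0[of k] K k k' by auto
      note S = sees_In[OF K sk(1) this]
      obtain r r' where "0 < r'" "h 0 k' r = h 0 k r'"
        by (rule chords_cross[of \<tau>' "t k'" 0 k' 1 "extent 0 k'" 0 k 0 1 "t k" 0])
          (use K K' S beyond_In[of k'] ends \<tau>' ts tk sk'(2) in auto)
      then show False using meet[of r' r] by simp
    qed
  qed
  obtain r r' where "1 \<le> r" "h 0 k r = h 0 k' r'"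
    by (rule chords_cross[of "t k" \<tau> 0 k 1 "extent 0 k" 0 k' 1 "extent 0 k'" \<tau>' "t k'"])
      (use K K' beyond_In[of k'] beyond_In[of k] ends \<tau> \<tau>' ts sk(2) sk'(2) \<open>\<tau> < t k'\<close> \<open>t k < \<tau>'\<close> in auto)
  then show False using meet[of r r'] by simp
qed

end

section \<open>The wedge between two rays\<close>

context polygon_loop
begin

lemma Bd_disjoint: "z \<in> Bd \<Longrightarrow> z \<notin> In" "z \<in> Bd \<Longrightarrow> z \<notin> Out"
  using InOut(6) by blast+

text \<open>The points of interest on the ray from \<open>p 0\<close> to \<open>p k\<close>: its exit point, and \<open>p k\<close> if it is visible.\<close>

definition stop :: "nat \<Rightarrow> real \<Rightarrow> bool" where
  "stop k r \<longleftrightarrow> 0 < k \<and> k < n \<and> 0 < r \<and> r \<le> extent 0 k \<and> (r = extent 0 k \<or> r = 1)"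

text \<open>By \<open>segment_In\<close>, a point of the ray before its extent is inside unless it
  is \<open>p k\<close> or lies on the boundary edge joining \<open>p 0\<close> to an adjacent
  \<open>p k\<close>. Such an edge shares only \<open>p k\<close> with the boundary between
  \<open>t 1\<close> and \<open>t (n - 1)\<close>.\<close>

lemma stop_on_chain:
  assumes k: "0 < k" "k < n" and s: "0 < s" "s \<le> extent 0 k" and \<tau>: "h 0 k s = \<gamma> \<tau>" "t 1 \<le> \<tau>" "\<tau> \<le> t (n - 1)"
  shows "stop k s"
proof (rule ccontr)
  assume "\<not> stop k s"
  then have ne: "s \<noteq> extent 0 k" "s \<noteq> 1" using k s by (auto simp: stop_def)
  have K: "0 < n" "k < n" "0 \<noteq> k" using k by auto
  have \<tau>01: "0 < \<tau>" "\<tau> < 1" using \<tau> t01'[of 1] t01'[of "n-1"] n3 by auto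
  have B: "h 0 k s \<notin> In"
    using Bd_disjoint(1)[OF \<gamma>_Bd[of \<tau>]] \<tau>01 \<tau>(1) by auto
  then have adj: "adjacent 0 k" "s < 1" using segment_In[OF K, of s] s ne by auto
  have nv: "h 0 k s \<noteq> p v" if "v < n" for v using vertex_on_line[OF K that, of s] s ne by auto
  consider "k = 1" | "k = n - 1" using adjacent_0[OF k] adj by blast
  then show False
  proof cases
    case 1
    have "edge n p \<L> 0 = h 0 k ` {0..1}" using edge_h[of 0] 1 n3 cyc_succ_Suc[of 0] by simp
    then have "\<gamma> \<tau> \<in> edge n p \<L> 0" using \<tau>(1) adj s by (metis atLeastAtMost_iff imageI less_imp_le)
    then have "\<gamma> \<tau> \<in> \<gamma> ` {t 0..t 1}" using \<gamma>edge[of 0] K by simp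
    then obtain x where x: "x \<in> {t 0..t 1}" "\<gamma> \<tau> = \<gamma> x" by (rule imageE)
    then have "\<tau> = x" using \<gamma>_inj[of \<tau> x] \<tau>01 t(2) t01[of 1] n3 by auto
    then have "\<tau> = t 1" using x \<tau> by simp
    then show False using nv[of 1] \<gamma>t[of 1] \<tau>(1) n3 by simp
  next
    case 2
    then have "cyc_succ n k = 0" using cyc_succ_Suc[of k] K by simp
    then have "edge n p \<L> k = h 0 k ` {0..1}"
      using edge_def[of n p \<L> k] seg_commute[of k 0] h_seg[OF K] K by simp
    then have "\<gamma> \<tau> \<in> edge n p \<L> k" using \<tau>(1) adj s by (metis atLeastAtMost_iff imageI less_imp_le)
    then have "\<gamma> \<tau> \<in> \<gamma> ` {t k..t (Suc k)}" using \<gamma>edge[of k] K by simp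
    then obtain x where x: "x \<in> {t k..t (Suc k)}" "\<gamma> \<tau> = \<gamma> x" by (rule imageE)
    then have "\<tau> = x" using \<gamma>_inj[of \<tau> x] \<tau>01 t01[of k] t01[of "Suc k"] K by auto
    then have "\<tau> = t k" using x \<tau> 2 by simp
    then show False using nv[of k] \<gamma>t[of k] \<tau>(1) K by simp
  qed
qed

text \<open>An edge on another line meets the ray at most once. An edge on the line of the ray
  itself occupies only parameters up to 1, hence the condition on \<open>r\<close> for an adjacent
  vertex.\<close>

lemma finite_beyond:
  assumes k: "0 < k" "k < n" and r: "adjacent 0 k \<Longrightarrow> 1 \<le> r"
  shows "finite {s. r < s \<and> h 0 k s \<in> Bd}"
proof -
  have K: "0 < n" "k < n" "0 \<noteq> k" using k by auto
  have "finite {s. r < s \<and> h 0 k s \<in> edge n p \<L> m}" if m: "m < n" for m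
  proof -
    let ?A = "{s. r < s \<and> h 0 k s \<in> edge n p \<L> m}"
    have "a = b" if ab: "a \<in> ?A" "b \<in> ?A" for a b
    proof (cases "line 0 k = line m (cyc_succ n m)")
      case True
      have "h 0 k a \<in> h 0 k ` {0..1}" using ab same_edge_line(2)[OF K m True] by auto
      then have "a \<le> 1" using h_inj[OF K] by auto
      then show ?thesis using r same_edge_line(1)[OF K m True] ab by auto
    next
      case False
      have "h 0 k a \<in> line m (cyc_succ n m)" "h 0 k b \<in> line m (cyc_succ n m)"
        using ab edge_line[OF m] by auto
      then have "h 0 k a = h 0 k b"
        using lines_meet[OF line(1)[OF K] _ False] line(1)[OF m cyc_succ(1)[OF m] cyc_succ(2)[OF m, symmetric]]
          h_line(2)[OF K] by blast
      then show ?thesis using h_inj[OF K] by simp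
    qed
    then have "?A = {} \<or> (\<exists>a. ?A = {a})" by blast
    then show ?thesis by (metis finite.emptyI finite.insertI)
  qed
  then have "finite (\<Union>m<n. {s. r < s \<and> h 0 k s \<in> edge n p \<L> m})" by blast
  moreover have "{s. r < s \<and> h 0 k s \<in> Bd} = (\<Union>m<n. {s. r < s \<and> h 0 k s \<in> edge n p \<L> m})"
    by (auto simp: boundary_def)
  ultimately show ?thesis by simp
qed

lemma adjacent_extent: "0 < k \<Longrightarrow> k < n \<Longrightarrow> adjacent 0 k \<Longrightarrow> 1 \<le> extent 0 k"
  using adjacent_sees[of 0 k] sees_iff_extent[of 0 k] by simp

lemma first_boundary_gap:
  assumes k: "0 < k" "k < n"
  obtains s1 where "extent 0 k < s1" "\<And>s. extent 0 k < s \<Longrightarrow> s < s1 \<Longrightarrow> h 0 k s \<notin> Bd"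
proof -
  \<comment> \<open>The added number keeps \<open>F\<close> nonempty if the ray never returns to the
    boundary.\<close>
  define F where "F = insert (extent 0 k + 1) {s. extent 0 k < s \<and> h 0 k s \<in> Bd}"
  have F: "finite F" "F \<noteq> {}" using finite_beyond[OF k] adjacent_extent[OF k] by (auto simp: F_def)
  have "extent 0 k < Min F" using F by (auto simp: F_def)
  moreover have "h 0 k s \<notin> Bd" if "extent 0 k < s" "s < Min F" for s
    using that F Min_le[of F s] by (auto simp: F_def)
  ultimately show thesis using that by blast
qed

end

text \<open>Two stops with \<open>p J\<close> but no further stop between them along the boundary; such a pair
  turns out to be impossible.\<close>

locale polygon_wedge = polygon_loop +
  fixes ka kb :: nat and ra rb \<tau>a \<tau>b :: real and J :: nat
  assumes stops: "stop ka ra" "stop kb rb" and ab: "ka \<noteq> kb"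
    and \<gamma>a: "\<gamma> \<tau>a = h 0 ka ra" and \<gamma>b: "\<gamma> \<tau>b = h 0 kb rb"
    and \<tau>J: "t 1 \<le> \<tau>a" "\<tau>a < t J" "t J < \<tau>b" "\<tau>b \<le> t (n - 1)" "J < n"
    and no_between: "\<And>k r \<tau>. stop k r \<Longrightarrow> \<tau>a < \<tau> \<Longrightarrow> \<tau> < \<tau>b \<Longrightarrow> \<gamma> \<tau> \<noteq> h 0 k r"
begin

lemma ka: "0 < n" "ka < n" "0 \<noteq> ka" and kb: "0 < n" "kb < n" "0 \<noteq> kb"
  using stops by (auto simp: stop_def)

lemma ra: "0 < ra" "ra \<le> extent 0 ka" and rb: "0 < rb" "rb \<le> extent 0 kb"
  using stops by (auto simp: stop_def)

lemma \<tau>01: "0 < \<tau>a" "\<tau>a < \<tau>b" "\<tau>b < 1"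
  using \<tau>J t01'[of 1] t01'[of "n - 1"] n3 by auto

lemma chain_range: "\<tau>a \<le> \<tau> \<Longrightarrow> \<tau> \<le> \<tau>b \<Longrightarrow> 0 < \<tau> \<and> \<tau> < 1 \<and> t 1 \<le> \<tau> \<and> \<tau> \<le> t (n - 1)"
  using \<tau>01 \<tau>J by auto

lemma chain_inj: "\<tau>a \<le> \<tau> \<Longrightarrow> \<tau> \<le> \<tau>b \<Longrightarrow> \<tau>a \<le> \<tau>' \<Longrightarrow> \<tau>' \<le> \<tau>b \<Longrightarrow> \<gamma> \<tau> = \<gamma> \<tau>' \<Longrightarrow> \<tau> = \<tau>'"
  using \<gamma>_inj[of \<tau> \<tau>'] chain_range[of \<tau>] chain_range[of \<tau>'] by auto

lemma chain_not_p0: "\<tau>a \<le> \<tau> \<Longrightarrow> \<tau> \<le> \<tau>b \<Longrightarrow> \<gamma> \<tau> \<noteq> p 0"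
  using \<gamma>_inj[of \<tau> 0] chain_range[of \<tau>] \<gamma>01 by auto

lemma rays_meet:
  assumes "0 < k" "k < n" "0 < k'" "k' < n" "k \<noteq> k'" "h 0 k s = h 0 k' s'" shows "s = 0" "s' = 0"
proof -
  have K: "0 < n" "k < n" "0 \<noteq> k" and K': "0 < n" "k' < n" "0 \<noteq> k'" using assms by auto
  have "h 0 k s = p 0"
    using lines_meet_vertex[of 0 k k' "h 0 k s"] h_line(2)[OF K, of s] h_line(2)[OF K', of s'] assms K by simp
  then have "h 0 k s = h 0 k 0" "h 0 k' s' = h 0 k' 0" using h0[OF K] h0[OF K'] assms(6) by simp_all
  then show "s = 0" "s' = 0" using h_inj[OF K] h_inj[OF K'] by simp_all
qed

lemma rays_ab_meet: "h 0 ka s = h 0 kb s' \<Longrightarrow> s = 0 \<and> s' = 0"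
  using rays_meet[of ka kb s s'] ka kb ab by auto

lemma stop_between_ends:
  assumes "stop k s" "\<tau>a \<le> \<tau>" "\<tau> \<le> \<tau>b" "h 0 k s = \<gamma> \<tau>" shows "\<tau> = \<tau>a \<or> \<tau> = \<tau>b"
  using no_between[OF assms(1), of \<tau>] assms(2-4) by (metis order_le_less)

text \<open>By \<open>stop_on_chain\<close> such a meeting is a stop, so it is at an end of the
  chain; the end at \<open>\<tau>b\<close> is on the other ray.\<close>

lemma a_meets_chain:
  assumes "0 \<le> s" "s \<le> extent 0 ka" "h 0 ka s = \<gamma> \<tau>" "\<tau>a \<le> \<tau>" "\<tau> \<le> \<tau>b" shows "s = ra" "\<tau> = \<tau>a"
proof -
  have "s \<noteq> 0" using assms chain_not_p0[of \<tau>] h0[OF ka] by auto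
  then have "stop ka s" using stop_on_chain[of ka s \<tau>] chain_range[of \<tau>] assms ka by simp
  then have "\<tau> = \<tau>a \<or> \<tau> = \<tau>b" using stop_between_ends assms by blast
  moreover have "\<tau> \<noteq> \<tau>b" using rays_ab_meet[of s rb] assms(3) \<gamma>b \<open>s \<noteq> 0\<close> by auto
  ultimately show "\<tau> = \<tau>a" by simp
  then show "s = ra" using assms(3) \<gamma>a h_inj[OF ka] by simp
qed

lemma b_meets_chain:
  assumes "0 \<le> s" "s \<le> extent 0 kb" "h 0 kb s = \<gamma> \<tau>" "\<tau>a \<le> \<tau>" "\<tau> \<le> \<tau>b" shows "s = rb" "\<tau> = \<tau>b"
proof -
  have "s \<noteq> 0" using assms chain_not_p0[of \<tau>] h0[OF kb] by auto
  then have "stop kb s" using stop_on_chain[of kb s \<tau>] chain_range[of \<tau>] assms kb by simp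
  then have "\<tau> = \<tau>a \<or> \<tau> = \<tau>b" using stop_between_ends assms by blast
  moreover have "\<tau> \<noteq> \<tau>a" using rays_ab_meet[of ra s] assms(3) \<gamma>a \<open>s \<noteq> 0\<close> by auto
  ultimately show "\<tau> = \<tau>b" by simp
  then show "s = rb" using assms(3) \<gamma>b h_inj[OF kb] by simp
qed

text \<open>\<open>D\<close> uses the rays up to their stops, so that the enclosed region contains
  no outside points; \<open>K\<close> uses them in full, so that it is a proper line and has two
  sides.\<close>

definition "D = h 0 ka ` {0..ra} \<union> \<gamma> ` {\<tau>a..\<tau>b} \<union> h 0 kb ` {0..rb}"
definition "R = inside D"
definition "K = h 0 ka ` {0..} \<union> h 0 kb ` {0..}"
definition "c = (h 0 ka \<circ> linepath 0 ra) +++ (subpath \<tau>a \<tau>b \<gamma> +++ (h 0 kb \<circ> linepath rb 0))"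

lemma c: "simple_path c" "pathfinish c = pathstart c" "path_image c = D"
proof -
  define c1 where "c1 = h 0 ka \<circ> linepath 0 ra"
  define c2 where "c2 = subpath \<tau>a \<tau>b \<gamma>"
  define c3 where "c3 = h 0 kb \<circ> linepath rb 0"
  have c1: "arc c1" "pathstart c1 = p 0" "pathfinish c1 = h 0 ka ra" "path_image c1 = h 0 ka ` {0..ra}"
    using h_arc[OF ka, of 0 ra] ra h0[OF ka] by (simp_all add: c1_def closed_segment_eq_real_ivl)
  have c3: "arc c3" "pathstart c3 = h 0 kb rb" "pathfinish c3 = p 0" "path_image c3 = h 0 kb ` {0..rb}"
    using h_arc[OF kb, of rb 0] rb h0[OF kb] by (simp_all add: c3_def closed_segment_eq_real_ivl)
  have c2: "arc c2" "pathstart c2 = h 0 ka ra" "pathfinish c2 = h 0 kb rb" "path_image c2 = \<gamma> ` {\<tau>a..\<tau>b}"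
    using arc_simple_path_subpath_interior[OF loop(1), of \<tau>a \<tau>b] \<tau>01 \<gamma>a \<gamma>b
    by (simp_all add: c2_def path_image_subpath)
  have i23: "path_image c2 \<inter> path_image c3 \<subseteq> {h 0 kb rb}"
  proof
    fix z assume "z \<in> path_image c2 \<inter> path_image c3"
    then have z: "z \<in> \<gamma> ` {\<tau>a..\<tau>b}" "z \<in> h 0 kb ` {0..rb}" unfolding c2(4) c3(4) by auto
    obtain \<tau> where "z = \<gamma> \<tau>" "\<tau>a \<le> \<tau>" "\<tau> \<le> \<tau>b" using z(1) by auto
    moreover obtain s where "z = h 0 kb s" "0 \<le> s" "s \<le> rb" using z(2) by auto
    ultimately show "z \<in> {h 0 kb rb}" using b_meets_chain(1)[of s \<tau>] rb by simp
  qed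
  have i12: "path_image c1 \<inter> path_image c2 \<subseteq> {h 0 ka ra}"
  proof
    fix z assume "z \<in> path_image c1 \<inter> path_image c2"
    then have z: "z \<in> \<gamma> ` {\<tau>a..\<tau>b}" "z \<in> h 0 ka ` {0..ra}" unfolding c2(4) c1(4) by auto
    obtain \<tau> where "z = \<gamma> \<tau>" "\<tau>a \<le> \<tau>" "\<tau> \<le> \<tau>b" using z(1) by auto
    moreover obtain s where "z = h 0 ka s" "0 \<le> s" "s \<le> ra" using z(2) by auto
    ultimately show "z \<in> {h 0 ka ra}" using a_meets_chain(1)[of s \<tau>] ra by simp
  qed
  have i13: "path_image c1 \<inter> path_image c3 \<subseteq> {p 0}"
  proof
    fix z assume "z \<in> path_image c1 \<inter> path_image c3"
    then have z: "z \<in> h 0 ka ` {0..ra}" "z \<in> h 0 kb ` {0..rb}" unfolding c1(4) c3(4) by auto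
    obtain s where "z = h 0 ka s" using z(1) by auto
    moreover obtain s' where "z = h 0 kb s'" using z(2) by auto
    ultimately show "z \<in> {p 0}" using rays_ab_meet[of s s'] h0[OF ka] by simp
  qed
  have a23: "arc (c2 +++ c3)" using arc_join[OF c2(1) c3(1)] c2 c3 i23 by simp
  have im23: "path_image (c2 +++ c3) = path_image c2 \<union> path_image c3"
    using c2 c3 by (simp add: path_image_join)
  have "simple_path (c1 +++ (c2 +++ c3))"
    by (rule simple_path_join_loop[OF c1(1) a23]) (use c1 c2 c3 i12 i13 im23 in auto)
  then show "simple_path c" by (simp add: c_def c1_def c2_def c3_def)
  have "pathfinish (c1 +++ (c2 +++ c3)) = pathstart (c1 +++ (c2 +++ c3))" using c1 c3 by simp
  then show "pathfinish c = pathstart c" by (simp add: c_def c1_def c2_def c3_def)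
  have "path_image (c1 +++ (c2 +++ c3)) = D"
    using c1 c2 c3 im23 by (simp add: path_image_join D_def Un_assoc)
  then show "path_image c = D" by (simp add: c_def c1_def c2_def c3_def)
qed

lemmas JD = Jordan_inside_outside[OF c(1,2), unfolded c(3)]

lemma R: "open R" "connected R" "bounded R" "R \<inter> D = {}" "R \<inter> outside D = {}" "R \<union> outside D = - D"
  "connected (outside D)" "open (outside D)" "closure R = R \<union> D" "D \<subseteq> closure (outside D)" "\<not> bounded (outside D)"
  "R \<noteq> {}" "outside D \<noteq> {}"
  using JD by (auto simp: R_def closure_Un_frontier)

lemma D_not_Out: "D \<inter> Out = {}"
proof -
  have "\<gamma> \<tau> \<notin> Out" if "\<tau>a \<le> \<tau>" "\<tau> \<le> \<tau>b" for \<tau>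
    using Bd_disjoint(2)[OF \<gamma>_Bd[of \<tau>]] chain_range[OF that] by auto
  moreover have "h 0 ka s \<notin> Out" if "0 \<le> s" "s \<le> ra" for s
    using extent_not_Out[OF ka, of s] that ra by simp
  moreover have "h 0 kb s \<notin> Out" if "0 \<le> s" "s \<le> rb" for s
    using extent_not_Out[OF kb, of s] that rb by simp
  ultimately show ?thesis unfolding D_def by auto
qed

text \<open>\<open>Out\<close> is connected, unbounded and disjoint from \<open>D\<close>, whereas
  \<open>R\<close> is bounded.\<close>

lemma Out_outside_D: "Out \<subseteq> outside D"
proof -
  have "R \<inter> Out = {} \<or> outside D \<inter> Out = {}"
    using R D_not_Out InOut(4) by (intro connectedD) auto
  then show ?thesis
  proof
    assume "R \<inter> Out = {}" then show ?thesis using R(6) D_not_Out by blast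
  next
    assume "outside D \<inter> Out = {}"
    then have "Out \<subseteq> R" using R(6) D_not_Out by blast
    then show ?thesis using R(3) InOut(12) bounded_subset by blast
  qed
qed

lemma R_not_Out: "z \<in> R \<Longrightarrow> z \<notin> Out"
  using Out_outside_D R(5) by blast

lemma R_not_Bd: "z \<in> R \<Longrightarrow> z \<notin> Bd"
proof
  assume z: "z \<in> R" "z \<in> Bd"
  then have "z \<in> closure Out" using InOut(8) by blast
  then have "R \<inter> Out \<noteq> {}" using R(1) z(1) open_Int_closure_eq_empty by blast
  then show False using R_not_Out by blast
qed

lemma components_D: "R \<in> components (- path_image c)" "outside D \<in> components (- path_image c)"
  using R(2,7,12,13) by (simp_all add: c(3) R_def inside_in_components outside_in_components)

text \<open>Past the stop the ray does not continue in \<open>R\<close>: it either goes outside at once, or it runs along a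
  crosscut that ends on the boundary outside the closure of \<open>R\<close>.\<close>

lemma beyond_avoids_R:
  assumes k: "(k = ka \<and> r = ra) \<or> (k = kb \<and> r = rb)"
  obtains s1 where "r < s1" "\<And>s. r < s \<Longrightarrow> s < s1 \<Longrightarrow> h 0 k s \<notin> R"
proof -
  have K: "0 < n" "k < n" "0 \<noteq> k" and r: "0 < r" "r \<le> extent 0 k" using k ka kb ra rb by auto
  \<comment> \<open>Beyond \<open>r\<close> the ray cannot meet its own initial piece, by
    injectivity, nor the other ray, which shares only \<open>p 0\<close> with it. What is left of
    \<open>D\<close> is the chain.\<close>
  have in_chain: "\<exists>\<tau>. \<tau>a \<le> \<tau> \<and> \<tau> \<le> \<tau>b \<and> h 0 k s = \<gamma> \<tau>" if s: "r < s" "h 0 k s \<in> D" for s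
  proof -
    have a: "h 0 k s \<notin> h 0 k ` {0..r}" using s h_inj[OF K] by auto
    have b: "s \<noteq> 0" using s r by simp
    from k show ?thesis
    proof
      assume k: "k = ka \<and> r = ra"
      then have "h 0 k s \<notin> h 0 kb ` {0..rb}" using rays_ab_meet[of s] b by auto
      then show ?thesis using a s(2) k unfolding D_def by auto
    next
      assume k: "k = kb \<and> r = rb"
      then have "h 0 k s \<notin> h 0 ka ` {0..ra}" using rays_ab_meet[of _ s] b by (metis imageE)
      then show ?thesis using a s(2) k unfolding D_def by auto
    qed
  qed
  have c1: "h 0 k s \<notin> D" if s: "r < s" "s \<le> extent 0 k" for s
  proof
    assume "h 0 k s \<in> D"
    then obtain \<tau> where "\<tau>a \<le> \<tau>" "\<tau> \<le> \<tau>b" "h 0 k s = \<gamma> \<tau>" using in_chain s by blast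
    then have "s = r" using a_meets_chain(1)[of s \<tau>] b_meets_chain(1)[of s \<tau>] k s r by auto
    then show False using s by simp
  qed
  have c2: "h 0 k s \<in> Bd" if s: "r < s" "h 0 k s \<in> D" for s
    using in_chain[OF s] \<gamma>_Bd chain_range by (metis atLeastAtMost_iff less_imp_le)
  have side: "h 0 k ` X \<inter> R = {}" if X: "connected X" "h 0 k ` X \<inter> D = {}" "x \<in> X" "h 0 k x \<notin> R" for X x
  proof -
    have con: "connected (h 0 k ` X)" using X(1) h_cont[OF K] by (intro connected_continuous_image)
    have sub: "h 0 k ` X \<subseteq> R \<union> outside D" using X(2) R(6) by blast
    have "R \<inter> outside D \<inter> h 0 k ` X = {}" using R(5) by blast
    then have "R \<inter> h 0 k ` X = {} \<or> outside D \<inter> h 0 k ` X = {}"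
      using connectedD[OF con R(1) R(8)] sub by blast
    moreover have "h 0 k x \<in> outside D" using sub X(3,4) by blast
    ultimately show ?thesis using X(3) by blast
  qed
  show thesis
  proof (cases "r < extent 0 k")
    case True
    have "h 0 k ` {r<..extent 0 k} \<inter> R = {}"
    proof (rule side[of _ "extent 0 k"])
      show "h 0 k (extent 0 k) \<notin> R" using R_not_Bd extent_Bd[OF K] by blast
      show "h 0 k ` {r<..extent 0 k} \<inter> D = {}" using c1 by auto
    qed (use True in auto)
    then have "h 0 k s \<notin> R" if "r < s" "s < extent 0 k" for s
      using that by (metis disjoint_iff greaterThanAtMost_iff imageI less_imp_le)
    then show thesis using that True by blast
  next
    case False
    then have r_eq: "r = extent 0 k" using r by simp
    obtain s1 where s1: "r < s1" "\<And>s. r < s \<Longrightarrow> s < s1 \<Longrightarrow> h 0 k s \<notin> Bd"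
      using first_boundary_gap[of k] K r_eq by auto
    have "extent 0 k < (r + s1) / 2" using s1 r_eq by simp
    then obtain s where s: "extent 0 k < s" "s \<le> (r + s1) / 2" "h 0 k s \<in> Out" by (rule beyond_ext[OF K])
    have "h 0 k ` {r<..<s1} \<inter> R = {}"
    proof (rule side[of _ s])
      show "h 0 k s \<notin> R" using R_not_Out s(3) by blast
      have "h 0 k u \<notin> D" if "r < u" "u < s1" for u using c2[of u] s1(2)[of u] that by blast
      then show "h 0 k ` {r<..<s1} \<inter> D = {}" by auto
      show "s \<in> {r<..<s1}" using s(1,2) s1(1) r_eq by auto
    qed auto
    then have "h 0 k s \<notin> R" if "r < s" "s < s1" for s
      using that by (metis disjoint_iff greaterThanLessThan_iff imageI)
    then show thesis using that s1(1) by blast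
  qed
qed

lemma closed_rays: "closed (h 0 ka ` {0..})" "closed (h 0 kb ` {0..})"
proof -
  have "closed (h 0 k ` {0..})" if K: "0 < n" "k < n" "0 \<noteq> k" for k
  proof -
    obtain g where g: "homeomorphism UNIV (line 0 k) (h 0 k) g" using h_homeo[OF K] by blast
    have "closedin (top_of_set (line 0 k)) (line 0 k \<inter> g -` {0..})"
      using g by (intro continuous_closedin_preimage) (auto simp: homeomorphism_def)
    then have "closed (line 0 k \<inter> g -` {0..})"
      using line_closed[OF K] closedin_closed_trans by blast
    moreover have "line 0 k \<inter> g -` {0..} = h 0 k ` {0..}"
    proof -
      have gh: "g (h 0 k s) = s" "h 0 k s \<in> line 0 k" for s using g by (auto simp: homeomorphism_def)
      have hg: "h 0 k (g z) = z" if "z \<in> line 0 k" for z using g that by (simp add: homeomorphism_def)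
      show ?thesis
      proof
        show "line 0 k \<inter> g -` {0..} \<subseteq> h 0 k ` {0..}"
        proof
          fix z assume "z \<in> line 0 k \<inter> g -` {0..}"
          then have "z = h 0 k (g z)" "g z \<in> {0..}" using hg by auto
          then show "z \<in> h 0 k ` {0..}" by (rule image_eqI)
        qed
        show "h 0 k ` {0..} \<subseteq> line 0 k \<inter> g -` {0..}" using gh by auto
      qed
    qed
    ultimately show ?thesis by simp
  qed
  then show "closed (h 0 ka ` {0..})" "closed (h 0 kb ` {0..})" using ka kb by auto
qed

lemma closed_K: "closed K"
  unfolding K_def using closed_rays by (rule closed_Un)

text \<open>Close to such a point the ray either runs on \<open>D\<close> or is in the stretch after
  the stop that \<open>beyond_avoids_R\<close> provides; larger parameters are kept away by
  \<open>h_near\<close>.\<close>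

lemma ray_near:
  assumes k: "(k = ka \<and> r = ra) \<or> (k = kb \<and> r = rb)" and s: "0 \<le> s" "s \<le> r"
  obtains \<epsilon> where "0 < \<epsilon>" "ball (h 0 k s) \<epsilon> \<inter> h 0 k ` {0..} \<inter> R = {}"
proof -
  have K: "0 < n" "k < n" "0 \<noteq> k" using k ka kb by auto
  obtain s1 where s1: "r < s1" "\<And>s. r < s \<Longrightarrow> s < s1 \<Longrightarrow> h 0 k s \<notin> R" using beyond_avoids_R[OF k] by blast
  obtain \<epsilon> where e: "0 < \<epsilon>" "\<And>u. h 0 k u \<in> ball (h 0 k s) \<epsilon> \<Longrightarrow> \<bar>u - s\<bar> < s1 - s"
    using h_near[OF K, of "s1 - s" s] s s1 by auto
  have sub: "h 0 k ` {0..r} \<subseteq> D" using k by (auto simp: D_def)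
  have nR: "h 0 k u \<notin> R" if u: "0 \<le> u" "h 0 k u \<in> ball (h 0 k s) \<epsilon>" for u
  proof (cases "u \<le> r")
    case True
    then have "h 0 k u \<in> D" using sub u by auto
    then show ?thesis using R(4) by blast
  next
    case False
    moreover have "u < s1" using e(2)[OF u(2)] by simp
    ultimately show ?thesis using s1(2) by simp
  qed
  show thesis
  proof (rule that[OF e(1)])
    show "ball (h 0 k s) \<epsilon> \<inter> h 0 k ` {0..} \<inter> R = {}" using nR by auto
  qed
qed

definition "A0 = h 0 ka ` {0..ra} \<union> h 0 kb ` {0..rb}"

lemma A0: "connected A0" "A0 \<subseteq> D" "p 0 \<in> A0"
proof -
  have "connected (h 0 ka ` {0..ra})" "connected (h 0 kb ` {0..rb})"
    using h_cont[OF ka] h_cont[OF kb] by (auto intro!: connected_continuous_image)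
  moreover have p: "p 0 \<in> h 0 ka ` {0..ra}" "p 0 \<in> h 0 kb ` {0..rb}"
    using h0[OF ka] h0[OF kb] ra rb by (auto simp: image_iff intro!: bexI[of _ 0])
  ultimately show "connected A0" unfolding A0_def by (intro connected_Un) auto
  show "A0 \<subseteq> D" by (auto simp: A0_def D_def)
  show "p 0 \<in> A0" using p by (simp add: A0_def)
qed

text \<open>Each of the two rays is either covered by \<open>ray_near\<close> or, being closed,
  keeps a distance from the point. This makes \<open>boundary_common_component\<close> applicable to
  \<open>A0\<close>.\<close>

lemma A0_free: assumes "z \<in> A0" shows "\<exists>\<epsilon>>0. ball z \<epsilon> \<inter> K \<inter> R = {}"
proof -
  have off: "\<exists>\<epsilon>>0. ball z \<epsilon> \<inter> C \<inter> R = {}" if C: "closed C" "z \<notin> C" for C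
  proof -
    have "open (- C)" "z \<in> - C" using C by auto
    then obtain \<epsilon> where "\<epsilon> > 0" "ball z \<epsilon> \<subseteq> - C" using open_contains_ball by metis
    then show ?thesis by blast
  qed
  have ray: "\<exists>\<epsilon>>0. ball z \<epsilon> \<inter> h 0 k ` {0..} \<inter> R = {}"
    if k: "(k = ka \<and> r = ra) \<or> (k = kb \<and> r = rb)" for k r
  proof (cases "z \<in> h 0 k ` {0..r}")
    case True
    then obtain s where "0 \<le> s" "s \<le> r" "z = h 0 k s" by auto
    then show ?thesis using ray_near[OF k, of s] by metis
  next
    case False
    have "z \<notin> h 0 k ` {0..}"
    proof
      assume "z \<in> h 0 k ` {0..}"
      then obtain s where s: "z = h 0 k s" by blast
      have "s = 0"
        using k False assms s rays_ab_meet unfolding A0_def by (metis UnE imageE)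
      then show False using False s k ra rb by auto
    qed
    moreover have "closed (h 0 k ` {0..})" using k closed_rays by auto
    ultimately show ?thesis using off by blast
  qed
  note a = ray[of ka ra, simplified] and b = ray[of kb rb, simplified]
  obtain e1 e2 where "e1 > 0" "ball z e1 \<inter> h 0 ka ` {0..} \<inter> R = {}" "e2 > 0" "ball z e2 \<inter> h 0 kb ` {0..} \<inter> R = {}"
    using a b by blast
  moreover have "ball z (min e1 e2) \<subseteq> ball z e1" "ball z (min e1 e2) \<subseteq> ball z e2" by auto
  ultimately show ?thesis unfolding K_def by (intro exI[of _ "min e1 e2"]) auto
qed

end

section \<open>The proper line formed by the two rays, and its sides\<close>

context polygon_wedge
begin

text \<open>The two rays glued at \<open>p 0\<close> into one proper line, so that
  \<open>proper_line_side\<close> applies and positions on both rays are comparable in a single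
  order.\<close>

definition "H s = (if 0 \<le> s then h 0 ka s else h 0 kb (- s))"

lemma H_neg: "s \<le> 0 \<Longrightarrow> H s = h 0 kb (- s)"
  using h0[OF ka] h0[OF kb] by (cases "s = 0") (auto simp: H_def)

lemma H_range: "range H = K"
proof
  show "range H \<subseteq> K" by (auto simp: H_def K_def)
  show "K \<subseteq> range H"
  proof
    fix z assume "z \<in> K"
    then consider s where "0 \<le> s" "z = h 0 ka s" | s where "0 \<le> s" "z = h 0 kb s" by (auto simp: K_def)
    then show "z \<in> range H"
    proof cases
      case 1 then have "z = H s" by (simp add: H_def)
      then show ?thesis by blast
    next
      case 2 then have "z = H (- s)" using H_neg[of "- s"] by simp
      then show ?thesis by blast
    qed
  qed
qed

lemma H_inj: "inj H"
proof (rule injI)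
  fix s s' assume e: "H s = H s'"
  consider "0 \<le> s" "0 \<le> s'" | "s \<le> 0" "s' \<le> 0" | "0 \<le> s" "s' \<le> 0" | "s \<le> 0" "0 \<le> s'" by linarith
  then show "s = s'"
  proof cases
    case 1 then show ?thesis using e h_inj[OF ka] by (simp add: H_def)
  next
    case 2 then show ?thesis using e h_inj[OF kb] by (simp add: H_neg)
  next
    case 3
    then have "h 0 ka s = h 0 kb (- s')" using e H_neg[of s'] by (simp add: H_def)
    then show ?thesis using rays_ab_meet[of s "- s'"] by simp
  next
    case 4
    then have "h 0 ka s' = h 0 kb (- s)" using e H_neg[of s] by (simp add: H_def)
    then show ?thesis using rays_ab_meet[of s' "- s"] by simp
  qed
qed

lemma H_cont: "continuous_on UNIV H"
proof -
  have "continuous_on ({0..} \<union> {..0}) (\<lambda>s::real. if 0 \<le> s then h 0 ka s else h 0 kb (- s))"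
  proof (rule continuous_on_cases)
    show "continuous_on {..0} (\<lambda>s. h 0 kb (- s))"
      by (rule continuous_on_compose2[OF h_cont[OF kb, of UNIV]]) (auto intro!: continuous_intros)
    show "continuous_on {0..} (h 0 ka)" by (rule h_cont[OF ka])
    show "\<forall>s::real. (s \<in> {0..} \<and> \<not> 0 \<le> s) \<or> (s \<in> {..0} \<and> 0 \<le> s) \<longrightarrow> h 0 ka s = h 0 kb (- s)"
      using h0[OF ka] h0[OF kb] by auto
  qed auto
  moreover have "{0..} \<union> {..0} = (UNIV::real set)" by auto
  moreover have "H = (\<lambda>s. if 0 \<le> s then h 0 ka s else h 0 kb (- s))" by (rule ext) (simp add: H_def)
  ultimately show ?thesis by simp
qed

lemma H_proper: "filterlim H at_infinity at_top" "filterlim H at_infinity at_bot"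
proof -
  have top: "\<forall>\<^sub>F s in at_top. H s = h 0 ka s"
    by (rule eventually_mono[OF eventually_ge_at_top[of 0]]) (simp add: H_def)
  show "filterlim H at_infinity at_top"
    unfolding filterlim_cong[OF refl refl top] by (rule h_proper(1)[OF ka])
  have bot: "\<forall>\<^sub>F s in at_bot. H s = h 0 kb (- s)"
    by (rule eventually_mono[OF eventually_le_at_bot[of 0]]) (simp add: H_neg)
  show "filterlim H at_infinity at_bot"
    unfolding filterlim_cong[OF refl refl bot]
    by (rule filterlim_compose[OF h_proper(1)[OF kb] filterlim_uminus_at_top_at_bot])
qed

lemma D_closure_R: "z \<in> D \<Longrightarrow> e > 0 \<Longrightarrow> ball z e \<inter> R \<noteq> {}"
proof -
  assume z: "z \<in> D" and e: "e > 0"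
  have "z \<in> closure R" using z R(9) by blast
  then obtain w where "w \<in> R" "dist w z < e" using e unfolding closure_approachable by blast
  then have "w \<in> ball z e \<inter> R" by (simp add: dist_commute)
  then show ?thesis by blast
qed

lemma p0_closure_R: "e > 0 \<Longrightarrow> ball (p 0) e \<inter> R \<noteq> {}"
  using D_closure_R A0(2,3) by blast

lemma common_component:
  assumes "connected A" "A \<subseteq> D" "A \<noteq> {}" "\<And>b. b \<in> A \<Longrightarrow> \<exists>\<epsilon>>0. ball b \<epsilon> \<inter> K \<inter> R = {}"
  obtains Z where "connected Z" "Z \<subseteq> R - K" "\<forall>b\<in>A. \<exists>\<delta>>0. ball b \<delta> \<inter> R \<subseteq> Z"
proof (rule boundary_common_component[OF c(1,2) components_D(1) _ closed_K assms(1)])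
  show "path_image c \<subseteq> closure R" using R(9) c(3) by simp
  show "A \<subseteq> path_image c" using assms(2) c(3) by simp
  fix Z assume Z: "Z \<in> components (R - K)" "\<And>b. b \<in> A \<Longrightarrow> \<exists>\<delta>>0. ball b \<delta> \<inter> R \<subseteq> Z"
  show thesis
    using that[of Z] in_components_connected[OF Z(1)] in_components_subset[OF Z(1)] Z(2) by blast
qed (use assms in auto)

text \<open>The side \<open>U\<close> that contains \<open>R\<close> near \<open>p 0\<close> is reached by inverting at a point of the opposite side, since
  only the side without the centre of inversion inherits the crossing property.\<close>

lemma wedge_sides:
  obtains U V \<delta> where "open U" "open V" "U \<inter> V = {}" "U \<union> V = - K" "K \<subseteq> closure V" "crossing_side H U"
    "0 < \<delta>" "ball (p 0) \<delta> \<inter> R \<subseteq> U"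
proof -
  have ne: "A0 \<noteq> {}" using A0(3) by blast
  obtain Z where Z: "connected Z" "Z \<subseteq> R - K" "\<forall>b\<in>A0. \<exists>\<delta>>0. ball b \<delta> \<inter> R \<subseteq> Z"
    by (rule common_component[OF A0(1,2) ne A0_free])
  obtain \<delta> where \<delta>: "0 < \<delta>" "ball (p 0) \<delta> \<inter> R \<subseteq> Z" using Z(3) A0(3) by blast
  obtain z where z: "z \<in> ball (p 0) \<delta> \<inter> R" using p0_closure_R[OF \<delta>(1)] by blast
  then have zZ: "z \<in> Z" using \<delta>(2) by blast
  then have "z \<notin> range H" using Z(2) H_range by blast
  then obtain U1 V1 where 1: "open U1" "open V1" "U1 \<inter> V1 = {}" "U1 \<union> V1 = - range H" "range H \<subseteq> closure U1" "z \<in> V1"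
    using proper_line_side[OF H_cont H_inj H_proper, of z] by metis
  have "U1 \<noteq> {}" using 1(5) by auto
  then obtain z' where z': "z' \<in> U1" by blast
  then have "z' \<notin> range H" using 1(4) by blast
  then obtain U V where 2: "open U" "connected V" "open V" "U \<inter> V = {}" "U \<union> V = - range H" "range H \<subseteq> closure V"
    "z' \<in> V" "crossing_side H U"
    using proper_line_side[OF H_cont H_inj H_proper, of z'] by metis
  have "z \<notin> V"
  proof
    assume "z \<in> V"
    have sub: "V \<subseteq> U1 \<union> V1" using 1(4) 2(5) by blast
    have "U1 \<inter> V1 \<inter> V = {}" using 1(3) by blast
    then have "U1 \<inter> V = {} \<or> V1 \<inter> V = {}" using connectedD[OF 2(2) 1(1,2)] sub by blast
    then show False using \<open>z \<in> V\<close> 1(6) z' 2(7) by blast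
  qed
  then have "z \<in> U" using \<open>z \<notin> range H\<close> 2(5) by blast
  have "Z \<subseteq> U \<union> V" using Z(2) 2(5) H_range by blast
  moreover have "U \<inter> V \<inter> Z = {}" using 2(4) by blast
  ultimately have "U \<inter> Z = {} \<or> V \<inter> Z = {}" using connectedD[OF Z(1) 2(1) 2(3)] by blast
  then have "Z \<subseteq> U" using \<open>z \<in> U\<close> zZ \<open>Z \<subseteq> U \<union> V\<close> by blast
  then have "ball (p 0) \<delta> \<inter> R \<subseteq> U" using \<delta>(2) by blast
  then show thesis
    by (intro that[of U V \<delta>]) (use 2 \<delta>(1) in \<open>simp_all add: H_range\<close>)
qed

section \<open>The chain and the vertices relative to the side \<open>U\<close>\<close>

context
  fixes U V :: "complex set" and \<delta> :: real
  assumes UV: "open U" "open V" "U \<inter> V = {}" "U \<union> V = - K" "K \<subseteq> closure V" "0 < \<delta>" "ball (p 0) \<delta> \<inter> R \<subseteq> U"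
begin

lemma in_side: assumes "connected X" "X \<inter> K = {}" "x \<in> X" "x \<in> U" shows "X \<subseteq> U"
proof -
  have "X \<subseteq> U \<union> V" using assms(2) UV(4) by blast
  moreover have "U \<inter> V \<inter> X = {}" using UV(3) by blast
  ultimately have "U \<inter> X = {} \<or> V \<inter> X = {}" using connectedD[OF assms(1) UV(1,2)] by blast
  then show ?thesis using assms(3,4) \<open>X \<subseteq> U \<union> V\<close> by blast
qed

text \<open>\<open>A0\<close> and this piece of chain together form a connected part of
  \<open>D\<close>, bordered by a single component \<open>Z\<close> of \<open>R - K\<close>. Near
  \<open>p 0\<close> the set \<open>Z\<close> meets \<open>U\<close>, so it lies in
  \<open>U\<close>. A chain point off \<open>K\<close> is a limit of points of \<open>Z\<close>,
  hence not in the open set \<open>V\<close>.\<close>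

lemma chain_side:
  assumes A: "connected A" "A \<subseteq> {\<tau>a..\<tau>b}" "\<tau>a \<in> A \<or> \<tau>b \<in> A"
    and off: "\<And>\<tau>. \<tau> \<in> A \<Longrightarrow> \<tau>a < \<tau> \<Longrightarrow> \<tau> < \<tau>b \<Longrightarrow> \<gamma> \<tau> \<notin> K"
    and \<tau>: "\<tau> \<in> A" "\<tau>a < \<tau>" "\<tau> < \<tau>b"
  shows "\<gamma> \<tau> \<in> U"
proof -
  have ends: "\<gamma> \<tau>a \<in> A0" "\<gamma> \<tau>b \<in> A0" using \<gamma>a \<gamma>b ra rb by (auto simp: A0_def)
  have "A \<subseteq> {0..1}" using A(2) \<tau>01 by auto
  then have "connected (\<gamma> ` A)" using A(1) \<gamma>_cont by (intro connected_continuous_image)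
  moreover have "A0 \<inter> \<gamma> ` A \<noteq> {}" using ends A(3) by blast
  ultimately have con: "connected (A0 \<union> \<gamma> ` A)" using A0(1) by (intro connected_Un)
  have sub: "A0 \<union> \<gamma> ` A \<subseteq> D" using A0(2) A(2) by (auto simp: D_def)
  have ne: "A0 \<union> \<gamma> ` A \<noteq> {}" using A0(3) by blast
  have free: "\<exists>\<epsilon>>0. ball b \<epsilon> \<inter> K \<inter> R = {}" if b: "b \<in> A0 \<union> \<gamma> ` A" for b
  proof (cases "b \<in> A0")
    case True then show ?thesis by (rule A0_free)
  next
    case False
    then obtain u where u: "u \<in> A" "b = \<gamma> u" using b by blast
    then have "u \<noteq> \<tau>a" "u \<noteq> \<tau>b" using False ends by auto
    then have "\<tau>a < u" "u < \<tau>b" using u(1) A(2) by force+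
    then have "b \<notin> K" using off[of u] u by simp
    then have "open (- K)" "b \<in> - K" using closed_K by auto
    then obtain \<epsilon> where "\<epsilon> > 0" "ball b \<epsilon> \<subseteq> - K" using open_contains_ball by metis
    then show ?thesis by blast
  qed
  obtain Z where Z: "connected Z" "Z \<subseteq> R - K" "\<forall>b\<in>A0 \<union> \<gamma> ` A. \<exists>\<delta>>0. ball b \<delta> \<inter> R \<subseteq> Z"
    by (rule common_component[OF con sub ne free])
  obtain \<delta>1 where \<delta>1: "\<delta>1 > 0" "ball (p 0) \<delta>1 \<inter> R \<subseteq> Z" using Z(3) A0(3) by blast
  have "min \<delta> \<delta>1 > 0" using \<delta>1(1) UV(6) by simp
  then obtain x where x: "x \<in> ball (p 0) (min \<delta> \<delta>1) \<inter> R" using p0_closure_R by blast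
  then have "x \<in> ball (p 0) \<delta> \<inter> R" "x \<in> ball (p 0) \<delta>1 \<inter> R" by auto
  then have "x \<in> U" "x \<in> Z" using UV(7) \<delta>1(2) by blast+
  then have ZU: "Z \<subseteq> U" using in_side[OF Z(1)] Z(2) by blast
  have b: "\<gamma> \<tau> \<in> U \<union> V" using off[OF \<tau>] UV(4) by blast
  show ?thesis
  proof (rule ccontr)
    assume "\<gamma> \<tau> \<notin> U"
    then have "\<gamma> \<tau> \<in> V" using b by blast
    then obtain e where e: "e > 0" "ball (\<gamma> \<tau>) e \<subseteq> V" using UV(2) open_contains_ball by blast
    obtain \<delta>2 where \<delta>2: "\<delta>2 > 0" "ball (\<gamma> \<tau>) \<delta>2 \<inter> R \<subseteq> Z" using Z(3) \<tau>(1) by blast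
    have "\<gamma> \<tau> \<in> D" using sub \<tau>(1) by blast
    moreover have "min e \<delta>2 > 0" using e \<delta>2 by simp
    ultimately obtain y where "y \<in> ball (\<gamma> \<tau>) (min e \<delta>2) \<inter> R" using D_closure_R by blast
    then have "y \<in> ball (\<gamma> \<tau>) e" "y \<in> ball (\<gamma> \<tau>) \<delta>2 \<inter> R" by auto
    then have "y \<in> V" "y \<in> U" using e(2) \<delta>2(2) ZU by blast+
    then show False using UV(3) by blast
  qed
qed

text \<open>After \<open>p 0\<close> the ray to such a vertex avoids \<open>K\<close>, so it is in
  \<open>U\<close> up to \<open>p k\<close>, and it starts in \<open>R\<close>. It first leaves
  \<open>R\<close> at a point of \<open>D\<close> off \<open>K\<close>, that is, strictly within the
  chain, and not after its extent, since \<open>R\<close> contains no outside points. By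
  \<open>stop_on_chain\<close> this point is a stop that \<open>no_between\<close> forbids.\<close>

lemma vertex_not_in_side: assumes k: "0 < k" "k < n" shows "p k \<notin> U"
proof
  assume pU: "p k \<in> U"
  have k': "0 < n" "k < n" "0 \<noteq> k" using k by auto
  have "p ka \<in> K" "p kb \<in> K" using h1[OF ka] h1[OF kb] by (auto simp: K_def image_iff intro: bexI[of _ 1])
  then have "k \<noteq> ka" "k \<noteq> kb" using pU UV(4) by blast+
  then have off: "h 0 k s \<notin> K" if "s > 0" for s
    using rays_meet[of k ka s] rays_meet[of k kb s] k ka kb that by (auto simp: K_def)
  define E where "E = h 0 k ` {0<..1}"
  have "connected E" unfolding E_def using h_cont[OF k'] by (intro connected_continuous_image) auto
  moreover have "E \<inter> K = {}" using off by (auto simp: E_def)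
  moreover have "p k \<in> E" using h1[OF k'] by (auto simp: E_def image_iff intro: bexI[of _ 1])
  ultimately have EU: "E \<subseteq> U" using in_side pU by blast
  \<comment> \<open>Close to \<open>p 0\<close> the sets \<open>D\<close> and \<open>K\<close>
    coincide: the chain keeps its distance, and the rays have not reached their stops.\<close>
  have "compact (\<gamma> ` {\<tau>a..\<tau>b})" using \<tau>01 by (intro compact_continuous_image \<gamma>_cont) auto
  moreover have "p 0 \<notin> \<gamma> ` {\<tau>a..\<tau>b}"
  proof
    assume "p 0 \<in> \<gamma> ` {\<tau>a..\<tau>b}"
    then obtain \<tau> where "\<tau> \<in> {\<tau>a..\<tau>b}" "p 0 = \<gamma> \<tau>" by (rule imageE)
    then show False using chain_not_p0[of \<tau>] by auto
  qed
  ultimately have "open (- \<gamma> ` {\<tau>a..\<tau>b})" "p 0 \<in> - \<gamma> ` {\<tau>a..\<tau>b}"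
    using compact_imp_closed by auto
  then obtain e1 where e1: "e1 > 0" "ball (p 0) e1 \<subseteq> - \<gamma> ` {\<tau>a..\<tau>b}" using open_contains_ball by metis
  then have D_near: "ball (p 0) e1 \<inter> D \<subseteq> K" by (auto simp: D_def K_def)
  obtain ea where ea: "ea > 0" "\<And>s. h 0 ka s \<in> ball (h 0 ka 0) ea \<Longrightarrow> \<bar>s - 0\<bar> < ra" using h_near[OF ka ra(1)] by blast
  obtain eb where eb: "eb > 0" "\<And>s. h 0 kb s \<in> ball (h 0 kb 0) eb \<Longrightarrow> \<bar>s - 0\<bar> < rb" using h_near[OF kb rb(1)] by blast
  define e where "e = min ea eb"
  have e: "e > 0" "e \<le> ea" "e \<le> eb" using ea(1) eb(1) by (auto simp: e_def)
  have K_near: "ball (p 0) e \<inter> K \<subseteq> D"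
  proof
    fix z assume z: "z \<in> ball (p 0) e \<inter> K"
    then consider s where "0 \<le> s" "z = h 0 ka s" | s where "0 \<le> s" "z = h 0 kb s" by (auto simp: K_def)
    then show "z \<in> D"
    proof cases
      case 1
      then have "s < ra" using ea(2)[of s] z e(2) h0[OF ka] by auto
      then show ?thesis using 1 by (auto simp: D_def)
    next
      case 2
      then have "s < rb" using eb(2)[of s] z e(3) h0[OF kb] by auto
      then show ?thesis using 2 by (auto simp: D_def)
    qed
  qed
  \<comment> \<open>Local connectivity on the other side of \<open>D\<close>: near
    \<open>p 0\<close> all points of \<open>outside D\<close> are joined off \<open>K\<close>, and
    one of them, \<open>v\<close>, is in \<open>V\<close>. So none of them is in \<open>U\<close>,
    which places the beginning of the ray in \<open>R\<close>.\<close>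
  have p0D: "p 0 \<in> path_image c" using A0(2,3) c(3) by blast
  have e_free: "ball (p 0) e \<inter> K \<inter> outside D = {}" using K_near outside_no_overlap[of D] by blast
  obtain d where d: "d > 0"
    "\<And>x y. x \<in> ball (p 0) d \<inter> outside D \<Longrightarrow> y \<in> ball (p 0) d \<inter> outside D \<Longrightarrow> connected_component (outside D - K) x y"
    using boundary_local_connectivity[OF c(1,2) components_D(2) closed_K p0D e(1) e_free] by blast
  define f where "f = min d (min e1 \<delta>)"
  have f: "f > 0" "f \<le> d" "f \<le> e1" "f \<le> \<delta>" using d(1) e1(1) UV(6) by (auto simp: f_def)
  have balls: "ball (p 0) f \<subseteq> ball (p 0) d" "ball (p 0) f \<subseteq> ball (p 0) e1" "ball (p 0) f \<subseteq> ball (p 0) \<delta>"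
    using f by (auto intro!: subset_ball)
  have "p 0 \<in> K" using h0[OF ka] by (auto simp: K_def image_iff intro: bexI[of _ 0])
  then have "p 0 \<in> closure V" using UV(5) by blast
  then obtain v where "v \<in> V" "dist v (p 0) < f" using f(1) unfolding closure_approachable by blast
  then have v: "v \<in> V" "v \<in> ball (p 0) f" by (auto simp: dist_commute)
  have "v \<notin> K" "v \<notin> U" using v(1) UV(3,4) by blast+
  then have "v \<notin> D" "v \<notin> R" using v(2) D_near UV(7) balls by blast+
  then have vO: "v \<in> outside D" using R(6) by blast
  obtain s0 where s0: "s0 > 0" "\<And>s. \<bar>s - 0\<bar> < s0 \<Longrightarrow> h 0 k s \<in> ball (h 0 k 0) f" using h_near'[OF k' f(1)] by blast
  define s1 where "s1 = min 1 (s0 / 2)"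
  have s1: "0 < s1" "s1 \<le> 1" "s1 < s0" using s0(1) by (auto simp: s1_def)
  have start: "h 0 k s \<in> R" if s: "0 < s" "s \<le> s1" for s
  proof (rule ccontr)
    assume nR: "h 0 k s \<notin> R"
    have "h 0 k s \<in> ball (p 0) f" using s0(2)[of s] s s1 h0[OF k'] by simp
    moreover have "h 0 k s \<notin> D" using D_near off[OF s(1)] calculation balls by blast
    ultimately have "h 0 k s \<in> ball (p 0) d \<inter> outside D" using nR R(6) balls by blast
    then have "connected_component (outside D - K) (h 0 k s) v" using d(2) v(2) vO balls by blast
    then obtain T where T: "connected T" "T \<subseteq> outside D - K" "h 0 k s \<in> T" "v \<in> T"
      unfolding connected_component_def by blast
    have "h 0 k s \<in> U" using EU s s1 by (auto simp: E_def)
    then have "T \<subseteq> U" using in_side[OF T(1) _ T(3)] T(2) by blast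
    then show False using T(4) \<open>v \<notin> U\<close> by blast
  qed
  \<comment> \<open>Its infimum is the first parameter at which the ray is no longer in
    \<open>R\<close>; there is one since the ray is eventually outside the polygon.\<close>
  define S where "S = {s1..} \<inter> h 0 k -` (- R)"
  have "closed S" unfolding S_def
    using continuous_closed_preimage[OF h_cont[OF k'], of "{s1..}" "- R"] R(1) by auto
  obtain r0 where r0: "r0 \<ge> 0" "\<forall>r\<ge>r0. h 0 k r \<in> Out" using eventually_Out[OF k'] by blast
  have "max s1 r0 \<in> S" using r0 R_not_Out[of "h 0 k (max s1 r0)"] by (auto simp: S_def)
  then have "S \<noteq> {}" by blast
  have bddS: "bdd_below S" by (rule bdd_belowI[of _ s1]) (simp add: S_def)
  define q where "q = Inf S"
  have qS: "q \<in> S" unfolding q_def using \<open>S \<noteq> {}\<close> bddS \<open>closed S\<close> by (rule closed_contains_Inf)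
  have q1: "s1 \<le> q" "h 0 k q \<notin> R" "0 < q" using qS s1 by (auto simp: S_def)
  have before: "h 0 k s \<in> R" if s: "0 < s" "s < q" for s
  proof (rule ccontr)
    assume "h 0 k s \<notin> R"
    then have "s \<in> S" using start[OF s(1)] by (force simp: S_def)
    then have "q \<le> s" unfolding q_def using bddS by (rule cInf_lower)
    then show False using s by simp
  qed
  have "h 0 k q \<in> closure (h 0 k ` {0<..<q})" using h_open_segment(3)[OF k' q1(3)] .
  moreover have "h 0 k ` {0<..<q} \<subseteq> R" using before by auto
  ultimately have "h 0 k q \<in> closure R" using closure_mono by blast
  then have "h 0 k q \<in> D" using R(9) q1(2) by blast
  moreover have "h 0 k q \<notin> K" using off q1(3) .
  moreover have "D \<subseteq> K \<union> \<gamma> ` {\<tau>a..\<tau>b}" by (auto simp: D_def K_def)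
  ultimately have "h 0 k q \<in> \<gamma> ` {\<tau>a..\<tau>b}" by blast
  then obtain \<tau> where \<tau>: "\<tau> \<in> {\<tau>a..\<tau>b}" "h 0 k q = \<gamma> \<tau>" by (rule imageE)
  have "\<gamma> \<tau>a \<in> K" "\<gamma> \<tau>b \<in> K" using \<gamma>a \<gamma>b ra rb by (auto simp: K_def)
  then have "\<tau> \<noteq> \<tau>a" "\<tau> \<noteq> \<tau>b" using \<tau>(2) \<open>h 0 k q \<notin> K\<close> by auto
  then have \<tau>i: "\<tau>a < \<tau>" "\<tau> < \<tau>b" using \<tau>(1) by auto
  have "q \<le> extent 0 k"
  proof (rule ccontr)
    assume "\<not> q \<le> extent 0 k"
    then have "extent 0 k < (extent 0 k + q) / 2" by simp
    then obtain s where s: "extent 0 k < s" "s \<le> (extent 0 k + q) / 2" "h 0 k s \<in> Out" by (rule beyond_ext[OF k'])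
    have "0 < s" "s < q" using s extent(1)[OF k'] \<open>\<not> q \<le> extent 0 k\<close> by auto
    then show False using before R_not_Out s(3) by blast
  qed
  then have "stop k q" using stop_on_chain[OF k q1(3) _ \<tau>(2)] chain_range[of \<tau>] \<tau>i by simp
  then show False using no_between[OF _ \<tau>i] \<tau>(2) by metis
qed

end

lemma wedge_impossible: False
proof -
  obtain U V \<delta> where UV: "open U" "open V" "U \<inter> V = {}" "U \<union> V = - K" "K \<subseteq> closure V" "0 < \<delta>" "ball (p 0) \<delta> \<inter> R \<subseteq> U"
    and cross: "crossing_side H U"
    by (rule wedge_sides)
  note chain = chain_side[OF UV] and vert = vertex_not_in_side[OF UV]
  have "0 \<le> \<tau>a" "\<tau>a < 1" "0 \<le> \<tau>b" using \<tau>01 by auto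
  \<comment> \<open>The edge that leaves the stop at \<open>\<tau>a\<close> towards
    \<open>p J\<close>: if the stop is a vertex, it is the edge after it. For \<open>\<tau>b\<close>
    it is the edge before the stop, hence the different strictness for \<open>l\<close>.\<close>
  then obtain m where m: "m < n" "t m \<le> \<tau>a" "\<tau>a < t (Suc m)" using index by blast
  obtain l where l: "l < n" "t l < \<tau>b" "\<tau>b \<le> t (Suc l)"
  proof -
    obtain l where l: "l < n" "t l \<le> \<tau>b" "\<tau>b < t (Suc l)"
      using index[OF \<open>0 \<le> \<tau>b\<close> \<tau>01(3)] by blast
    show thesis
    proof (cases "t l = \<tau>b")
      case True
      then have "l \<noteq> 0" using \<tau>01 t(2) by (cases l) auto
      then show thesis using that[of "l - 1"] l True t_mono[of "l - 1" l] by simp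
    qed (use that[of l] l in auto)
  qed
  have m1: "1 \<le> m"
  proof -
    have "t 1 < t (Suc m)" using m \<tau>J by simp
    then show ?thesis using t_less_iff[of 1 "Suc m"] m n3 by simp
  qed
  have mJ: "Suc m \<le> J"
  proof -
    have "t m < t J" using m \<tau>J by simp
    then show ?thesis using t_less_iff[of m J] m \<tau>J by simp
  qed
  have Jl: "J \<le> l"
  proof -
    have "t J < t (Suc l)" using l \<tau>J by simp
    then show ?thesis using t_less_iff[of J "Suc l"] l \<tau>J by simp
  qed
  have ln: "Suc l < n"
  proof -
    have "t l < t (n - 1)" using l \<tau>J by simp
    then show ?thesis using t_less_iff[of l "n - 1"] l by simp
  qed
  have tm: "t (Suc m) \<le> t J" "t J \<le> t l" using t_mono_le[of "Suc m" J] t_mono_le[of J l] mJ Jl l \<tau>J by auto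
  \<comment> \<open>The edge \<open>q\<close> is not incident to \<open>p 0\<close>, so its line
    misses \<open>p 0\<close> and meets a line through \<open>p 0\<close> at most once.\<close>
  have no_edge_line: "z = w" if q: "0 < q" "Suc q < n" and k: "0 < k" "k < n"
    and z: "z \<in> edge n p \<L> q" "z = h 0 k s" and w: "w \<in> edge n p \<L> q" "w = h 0 k s'" for q k z w s s'
  proof -
    have k': "0 < n" "k < n" "0 \<noteq> k" and q': "q < n" "Suc q < n" "q \<noteq> Suc q" using q k by auto
    have "edge n p \<L> q \<subseteq> line q (Suc q)" using edge_line[of q] cyc_succ_Suc[of q] q' by simp
    then have zw: "z \<in> line q (Suc q)" "w \<in> line q (Suc q)" using z w by auto
    have "p 0 \<notin> line q (Suc q)" using line_vertex[OF q', of 0] q by auto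
    moreover have "p 0 \<in> line 0 k" using line(2)[OF k'] .
    ultimately have "line 0 k \<noteq> line q (Suc q)" by auto
    then show "z = w"
      using lines_meet[OF line(1)[OF k'] line(1)[OF q'], of z w] zw z(2) w(2) h_line(2)[OF k'] by simp
  qed
  have edge_m: "\<gamma> \<tau> \<in> edge n p \<L> m" if "\<tau>a \<le> \<tau>" "\<tau> \<le> t (Suc m)" for \<tau>
    using \<gamma>edge[OF m(1)] m that by (metis atLeastAtMost_iff imageI order_trans)
  have edge_l: "\<gamma> \<tau> \<in> edge n p \<L> l" if "t l \<le> \<tau>" "\<tau> \<le> \<tau>b" for \<tau>
    using \<gamma>edge[OF l(1)] l that by (metis atLeastAtMost_iff imageI order_trans)
  have once: "\<tau> = \<tau>'" if e: "(\<tau>a \<le> \<tau> \<and> \<tau> \<le> t (Suc m) \<and> \<tau>a \<le> \<tau>' \<and> \<tau>' \<le> t (Suc m)) \<or> (t l \<le> \<tau> \<and> \<tau> \<le> \<tau>b \<and> t l \<le> \<tau>' \<and> \<tau>' \<le> \<tau>b)"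
    and k: "k = ka \<or> k = kb" and z: "\<gamma> \<tau> = h 0 k s" "\<gamma> \<tau>' = h 0 k s'" for \<tau> \<tau>' k s s'
  proof -
    have k': "0 < k" "k < n" using k ka kb by auto
    from e have "\<gamma> \<tau> = \<gamma> \<tau>'"
    proof
      assume "\<tau>a \<le> \<tau> \<and> \<tau> \<le> t (Suc m) \<and> \<tau>a \<le> \<tau>' \<and> \<tau>' \<le> t (Suc m)"
      then have "\<gamma> \<tau> \<in> edge n p \<L> m" "\<gamma> \<tau>' \<in> edge n p \<L> m" using edge_m by blast+
      then show ?thesis using m1 mJ Jl ln k' z by (intro no_edge_line[of m k "\<gamma> \<tau>" s "\<gamma> \<tau>'" s']) (assumption | linarith)+
    next
      assume "t l \<le> \<tau> \<and> \<tau> \<le> \<tau>b \<and> t l \<le> \<tau>' \<and> \<tau>' \<le> \<tau>b"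
      then have "\<gamma> \<tau> \<in> edge n p \<L> l" "\<gamma> \<tau>' \<in> edge n p \<L> l" using edge_l by blast+
      then show ?thesis using m1 mJ Jl ln k' z by (intro no_edge_line[of l k "\<gamma> \<tau>" s "\<gamma> \<tau>'" s']) (assumption | linarith)+
    qed
    moreover have "\<tau>a \<le> \<tau>" "\<tau> \<le> \<tau>b" "\<tau>a \<le> \<tau>'" "\<tau>' \<le> \<tau>b" using e tm \<tau>J l m by auto
    ultimately show ?thesis using chain_inj by blast
  qed
  \<comment> \<open>The edge cannot meet its own ray again, by \<open>once\<close>. If it met
    neither ray, \<open>chain_side\<close> would place its end \<open>p (Suc m)\<close> in
    \<open>U\<close>, against \<open>vertex_not_in_side\<close>.\<close>
  have "\<exists>y. \<tau>a < y \<and> y \<le> t (Suc m) \<and> \<gamma> y \<in> h 0 kb ` {0..}"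
  proof (rule ccontr)
    assume a: "\<not> ?thesis"
    have "\<gamma> \<tau> \<notin> K" if "\<tau> \<in> {\<tau>a..t (Suc m)}" "\<tau>a < \<tau>" "\<tau> < \<tau>b" for \<tau>
    proof -
      have "\<gamma> \<tau> \<noteq> h 0 ka s" for s
        using once[of \<tau> \<tau>a ka s ra] \<gamma>a that m by auto
      then show ?thesis using that a unfolding K_def by auto
    qed
    moreover have "t (Suc m) \<in> {\<tau>a..t (Suc m)}" "\<tau>a < t (Suc m)" "t (Suc m) < \<tau>b" using m tm \<tau>J by auto
    moreover have "connected {\<tau>a..t (Suc m)}" "{\<tau>a..t (Suc m)} \<subseteq> {\<tau>a..\<tau>b}" "\<tau>a \<in> {\<tau>a..t (Suc m)}"
      using m tm \<tau>J by auto
    ultimately have "\<gamma> (t (Suc m)) \<in> U" using chain[of "{\<tau>a..t (Suc m)}" "t (Suc m)"] by blast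
    then show False using vert[of "Suc m"] \<gamma>t[of "Suc m"] mJ \<tau>J by simp
  qed
  then obtain y where y: "\<tau>a < y" "y \<le> t (Suc m)" "\<gamma> y \<in> h 0 kb ` {0..}" by blast
  have "\<exists>y'. t l \<le> y' \<and> y' < \<tau>b \<and> \<gamma> y' \<in> h 0 ka ` {0..}"
  proof (rule ccontr)
    assume a: "\<not> ?thesis"
    have "\<gamma> \<tau> \<notin> K" if "\<tau> \<in> {t l..\<tau>b}" "\<tau>a < \<tau>" "\<tau> < \<tau>b" for \<tau>
    proof -
      have "\<gamma> \<tau> \<noteq> h 0 kb s" for s
        using once[of \<tau> \<tau>b kb s rb] \<gamma>b that l by auto
      then show ?thesis using that a unfolding K_def by auto
    qed
    moreover have "t l \<in> {t l..\<tau>b}" "\<tau>a < t l" "t l < \<tau>b" using l tm \<tau>J by auto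
    moreover have "connected {t l..\<tau>b}" "{t l..\<tau>b} \<subseteq> {\<tau>a..\<tau>b}" "\<tau>b \<in> {t l..\<tau>b}"
      using l tm \<tau>J by auto
    ultimately have "\<gamma> (t l) \<in> U" using chain[of "{t l..\<tau>b}" "t l"] by blast
    then show False using vert[of l] \<gamma>t[of l] l m1 mJ Jl by simp
  qed
  then obtain y' where y': "t l \<le> y'" "y' < \<tau>b" "\<gamma> y' \<in> h 0 ka ` {0..}" by blast
  obtain sb where sb: "\<gamma> y = h 0 kb sb" "0 \<le> sb" using y(3) by auto
  obtain sa where sa: "\<gamma> y' = h 0 ka sa" "0 \<le> sa" using y'(3) by auto
  have yb: "y < \<tau>b" "\<tau>a < y'" using y tm \<tau>J y' by auto
  \<comment> \<open>Up to its extent a ray meets the chain only at its stop, so both crossings lie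
    beyond the stops.\<close>
  have "rb < sb"
  proof (rule ccontr)
    assume "\<not> rb < sb"
    then have "y = \<tau>b" using b_meets_chain(2)[of sb y] sb rb y yb by auto
    then show False using yb by simp
  qed
  have "ra < sa"
  proof (rule ccontr)
    assume "\<not> ra < sa"
    then have "y' = \<tau>a" using a_meets_chain(2)[of sa y'] sa ra y' yb by auto
    then show False using yb by simp
  qed
  have "y \<noteq> y'"
  proof
    assume "y = y'"
    then have "sb = 0" using sa(1) sb(1) rays_ab_meet[of sa sb] by simp
    then show False using \<open>rb < sb\<close> rb by simp
  qed
  then have yy': "y < y'" using y y' tm by simp
  have U1: "\<gamma> \<tau> \<in> U" if "\<tau>a < \<tau>" "\<tau> < y" for \<tau>
  proof -
    have "\<gamma> u \<notin> K" if u: "u \<in> {\<tau>a..<y}" "\<tau>a < u" "u < \<tau>b" for u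
    proof -
      have "\<gamma> u \<noteq> h 0 ka s" for s using once[of u \<tau>a ka s ra] \<gamma>a u m y by auto
      moreover have "\<gamma> u \<noteq> h 0 kb s" for s using once[of u y kb s sb] sb u y by auto
      ultimately show ?thesis unfolding K_def by auto
    qed
    moreover have "{\<tau>a..<y} \<subseteq> {\<tau>a..\<tau>b}" using yb by force
    ultimately show ?thesis using chain[of "{\<tau>a..<y}" \<tau>] that yb y(1) by simp
  qed
  have U2: "\<gamma> \<tau> \<in> U" if "y' < \<tau>" "\<tau> < \<tau>b" for \<tau>
  proof -
    have "\<gamma> u \<notin> K" if u: "u \<in> {y'<..\<tau>b}" "\<tau>a < u" "u < \<tau>b" for u
    proof -
      have "\<gamma> u \<noteq> h 0 kb s" for s using once[of u \<tau>b kb s rb] \<gamma>b u l y' by auto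
      moreover have "\<gamma> u \<noteq> h 0 ka s" for s using once[of u y' ka s sa] sa u y' by auto
      ultimately show ?thesis unfolding K_def by auto
    qed
    moreover have "{y'<..\<tau>b} \<subseteq> {\<tau>a..\<tau>b}" using yb by force
    ultimately show ?thesis using chain[of "{y'<..\<tau>b}" \<tau>] that yb y'(2) by simp
  qed
  define d where "d = subpath y \<tau>a \<gamma>"
  define S where "S = \<gamma> ` {y'<..<\<tau>b}"
  \<comment> \<open>Along \<open>H\<close> the parameters \<open>- sb < - rb < ra < sa\<close>
    belong to the chain points at \<open>y\<close>, \<open>\<tau>b\<close>, \<open>\<tau>a\<close>,
    \<open>y'\<close>. So the piece from \<open>y\<close> to \<open>\<tau>a\<close> and the piece
    from \<open>y'\<close> to \<open>\<tau>b\<close> have interlaced ends and must meet, although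
    the chain is injective and \<open>y < y'\<close>.\<close>
  have "S \<inter> path_image d \<noteq> {}"
  proof (rule cross[unfolded crossing_side_def, rule_format, of "- sb" "- rb" ra sa])
    show "- sb < - rb" "- rb < ra" "ra < sa" using \<open>rb < sb\<close> \<open>ra < sa\<close> ra rb by auto
    show "arc d" unfolding d_def
      using arc_simple_path_subpath_interior[OF loop(1), of y \<tau>a] y yb \<tau>01 by auto
    show st: "pathstart d = H (- sb)" using H_neg[of "- sb"] sb by (simp add: d_def)
    show fi: "pathfinish d = H ra" using \<gamma>a ra by (simp add: d_def H_def)
    have im: "path_image d = \<gamma> ` {\<tau>a..y}"
      using y by (simp add: d_def path_image_subpath_gen closed_segment_eq_real_ivl)
    show "path_image d - {H (- sb), H ra} \<subseteq> U"
    proof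
      fix z assume z: "z \<in> path_image d - {H (- sb), H ra}"
      then obtain \<tau> where \<tau>: "\<tau> \<in> {\<tau>a..y}" "z = \<gamma> \<tau>" unfolding im by blast
      have "\<gamma> y = H (- sb)" "\<gamma> \<tau>a = H ra" using st fi by (simp_all add: d_def)
      then have "\<tau> \<noteq> y" "\<tau> \<noteq> \<tau>a" using z \<tau>(2) by auto
      then show "z \<in> U" using U1[of \<tau>] \<tau> by auto
    qed
    have sub01: "{y'..\<tau>b} \<subseteq> {0..1}" using yb \<tau>01 y' by auto
    show "connected S" unfolding S_def using sub01 by (intro connected_continuous_image \<gamma>_cont) auto
    show "S \<subseteq> U" using U2 by (auto simp: S_def)
    have cl: "closure {y'<..<\<tau>b} = {y'..\<tau>b}" using y' by simp
    have "{y'<..<\<tau>b} \<subseteq> {y'..\<tau>b}" by auto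
    then have "\<gamma> \<tau>b \<in> closure S" "\<gamma> y' \<in> closure S"
      unfolding S_def
      using closure_image_mono_on[OF \<gamma>_cont[OF sub01], of "{y'<..<\<tau>b}"] cl y'(2) by simp_all
    moreover have "\<gamma> \<tau>b = H (- rb)" using H_neg[of "- rb"] rb \<gamma>b by simp
    moreover have "\<gamma> y' = H sa" using sa by (simp add: H_def)
    ultimately show "H (- rb) \<in> closure S" "H sa \<in> closure S" by simp_all
  qed
  moreover have "path_image d = \<gamma> ` {\<tau>a..y}"
    using y by (simp add: d_def path_image_subpath_gen closed_segment_eq_real_ivl)
  ultimately obtain z where z: "z \<in> \<gamma> ` {y'<..<\<tau>b}" "z \<in> \<gamma> ` {\<tau>a..y}" by (auto simp: S_def)
  obtain u where "u \<in> {y'<..<\<tau>b}" "z = \<gamma> u" using z(1) by (rule imageE)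
  moreover obtain u' where "u' \<in> {\<tau>a..y}" "z = \<gamma> u'" using z(2) by (rule imageE)
  ultimately have "u \<in> {y'<..<\<tau>b}" "u' \<in> {\<tau>a..y}" "\<gamma> u = \<gamma> u'" by auto
  then show False using chain_inj[of u u'] yy' y yb by auto
qed

end

section \<open>Blockers seen from vertex 0\<close>

text \<open>\<open>designated_blocker\<close> for the pair \<open>(0, J)\<close>, with the cyclic
  walks turned into index intervals.\<close>

definition blocks :: "nat \<Rightarrow> (nat \<Rightarrow> complex) \<Rightarrow> complex set set \<Rightarrow> nat \<Rightarrow> nat \<Rightarrow> bool" where
  "blocks n p \<L> J k \<longleftrightarrow> 0 < k \<and> k < n \<and> sees n p \<L> 0 k \<and>
     (k < J \<and> (\<exists>m\<in>{J..<n}. first_exits_through n p \<L> 0 k m) \<or>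
      J < k \<and> (\<exists>m<J. first_exits_through n p \<L> 0 k m))"

context polygon_loop
begin

text \<open>In loop parameters, the blocking vertex and the exit of its ray are on different sides
  of \<open>t J\<close>; \<open>blocksI\<close> is the converse.\<close>

lemma blocks_param:
  assumes J: "0 < J" "J < n" and b: "blocks n p \<L> J k"
  obtains \<tau> where "0 < \<tau>" "\<tau> < 1" "h 0 k (extent 0 k) = \<gamma> \<tau>" "\<And>v. v \<le> n \<Longrightarrow> \<tau> \<noteq> t v" "1 < extent 0 k"
    "0 < k" "k < n" "sees n p \<L> 0 k" "(k < J \<and> t J < \<tau>) \<or> (J < k \<and> \<tau> < t J)"
proof -
  have k: "0 < k" "k < n" and s: "sees n p \<L> 0 k" using b by (auto simp: blocks_def)
  have K: "0 < n" "k < n" "0 \<noteq> k" using k by auto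
  note fe = first_exits_iff[OF K s]
  have e: "1 < extent 0 k" using b fe by (auto simp: blocks_def)
  obtain \<tau> where \<tau>: "0 < \<tau>" "\<tau> < 1" "\<gamma> \<tau> = h 0 k (extent 0 k)" "\<And>v. v \<le> n \<Longrightarrow> \<tau> \<noteq> t v"
    using exit_param[OF k, of "extent 0 k"] e extent_Bd[OF K] by auto
  have "(k < J \<and> t J < \<tau>) \<or> (J < k \<and> \<tau> < t J)"
    using b \<gamma>_edge_index[OF \<tau>(1,2,4) J(2)] unfolding blocks_def fe \<tau>(3) by blast
  then show thesis using that[of \<tau>] \<tau> e k s by simp
qed

lemma blocksI:
  assumes J: "0 < J" "J < n" and k: "0 < k" "k < n" "sees n p \<L> 0 k" "1 < extent 0 k"
    and \<tau>: "0 < \<tau>" "\<tau> < 1" "h 0 k (extent 0 k) = \<gamma> \<tau>" "\<And>v. v \<le> n \<Longrightarrow> \<tau> \<noteq> t v"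
    and side: "(k < J \<and> t J < \<tau>) \<or> (J < k \<and> \<tau> < t J)"
  shows "blocks n p \<L> J k"
proof -
  have K: "0 < n" "k < n" "0 \<noteq> k" using k by auto
  note fe = first_exits_iff[OF K k(3)]
  show ?thesis
    using side \<gamma>_edge_index[OF \<tau>(1,2,4) J(2)] k unfolding blocks_def fe \<tau>(3) by blast
qed

lemma blocks_separates:
  assumes J: "0 < J" "J < n" "\<not> sees n p \<L> 0 J" and b: "blocks n p \<L> J k" "k < J"
    and su: "s < k" "k < u" "u \<le> J"
  shows "\<not> sees n p \<L> s u"
proof -
  obtain \<tau> where "\<tau> < 1" "h 0 k (extent 0 k) = \<gamma> \<tau>" "1 < extent 0 k" "0 < k" "sees n p \<L> 0 k" "t J < \<tau>"
    by (rule blocks_param[OF J(1,2) b(1)]) (use b(2) in auto)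
  then show ?thesis using exit_separates[of k J \<tau> s u] J b su by blast
qed

lemma blocks_opposite:
  assumes J: "0 < J" "J < n" and b: "blocks n p \<L> J k" "k < J" and b': "blocks n p \<L> J k'" "J < k'"
  shows False
proof -
  obtain \<tau> where \<tau>: "\<tau> < 1" "h 0 k (extent 0 k) = \<gamma> \<tau>" "\<And>v. v \<le> n \<Longrightarrow> \<tau> \<noteq> t v"
    "1 < extent 0 k" "0 < k" "sees n p \<L> 0 k" "t J < \<tau>"
    by (rule blocks_param[OF J(1,2) b(1)]) (use b(2) in auto)
  obtain \<tau>' where \<tau>': "0 < \<tau>'" "h 0 k' (extent 0 k') = \<gamma> \<tau>'" "\<And>v. v \<le> n \<Longrightarrow> \<tau>' \<noteq> t v"
    "1 < extent 0 k'" "k' < n" "sees n p \<L> 0 k'" "\<tau>' < t J"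
    by (rule blocks_param[OF J(1,2) b'(1)]) (use b'(2) in auto)
  show False
    by (rule exits_incompatible[of k J k' \<tau> \<tau>']) (use \<tau> \<tau>' b b' in auto)
qed

lemma blocks_exists:
  assumes J: "0 < J" "J < n" "\<not> sees n p \<L> 0 J"
  shows "\<exists>k. blocks n p \<L> J k"
proof (rule ccontr)
  assume nb: "\<not> (\<exists>k. blocks n p \<L> J k)"
  \<comment> \<open>The loop parameters of all stops; finitely many, as each ray has at most two
    stops.\<close>
  define T where "T = {\<tau>. 0 < \<tau> \<and> \<tau> < 1 \<and> (\<exists>k r. stop k r \<and> \<gamma> \<tau> = h 0 k r)}"
  have "finite (\<gamma> ` T)"
  proof (rule finite_subset)
    show "\<gamma> ` T \<subseteq> (\<Union>k<n. {h 0 k (extent 0 k), h 0 k 1})"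
    proof
      fix z assume "z \<in> \<gamma> ` T"
      then obtain \<tau> where "\<tau> \<in> T" "z = \<gamma> \<tau>" by blast
      then obtain k r where "stop k r" "z = h 0 k r" unfolding T_def by blast
      then have "k < n" "z \<in> {h 0 k (extent 0 k), h 0 k 1}" by (auto simp: stop_def)
      then show "z \<in> (\<Union>k<n. {h 0 k (extent 0 k), h 0 k 1})" by blast
    qed
  qed simp
  moreover have "inj_on \<gamma> T"
  proof (rule inj_onI)
    fix x y assume "x \<in> T" "y \<in> T" "\<gamma> x = \<gamma> y"
    then show "x = y" using \<gamma>_inj[of x y] by (auto simp: T_def)
  qed
  ultimately have fin: "finite T" by (rule finite_imageD)
  have J1: "J \<noteq> 1" "J \<noteq> n - 1"
    using J adjacent_sees[of 0 J] adjacent_0[of J] by auto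
  \<comment> \<open>The neighbours of \<open>p 0\<close> are stops, so both sides of
    \<open>J\<close> contain one.\<close>
  have edge_stop: "t k \<in> T" if k: "k = 1 \<or> k = n - 1" for k
  proof -
    have k': "0 < k" "k < n" using k n3 by auto
    then have "adjacent 0 k" using k adjacent_0[of k] by simp
    then have "stop k 1" using adjacent_extent[OF k'] k' by (auto simp: stop_def)
    moreover have "\<gamma> (t k) = h 0 k 1" using h1[of 0 k] \<gamma>t[of k] k' by simp
    ultimately show ?thesis using t01'[OF k'] by (auto simp: T_def)
  qed
  \<comment> \<open>By general position a stop at \<open>p J\<close> would be on the ray to
    \<open>p J\<close> itself, with \<open>r = 1\<close>, and \<open>p J\<close> would be
    visible.\<close>
  have notJ: "\<tau> \<noteq> t J" if \<tau>: "\<tau> \<in> T" for \<tau>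
  proof
    assume e: "\<tau> = t J"
    obtain k r where kr: "stop k r" "\<gamma> \<tau> = h 0 k r" using \<tau> by (auto simp: T_def)
    have K: "0 < n" "k < n" "0 \<noteq> k" using kr by (auto simp: stop_def)
    have "h 0 k r = p J" using kr(2) e \<gamma>t[OF J(2)] by simp
    then have "r = 1 \<and> J = k" using vertex_on_line[OF K J(2), of r] kr(1) by (auto simp: stop_def)
    then show False using J(3) sees_iff_extent[OF K] kr(1) by (auto simp: stop_def)
  qed
  define Ta where "Ta = {\<tau> \<in> T. \<tau> < t J}"
  define Tb where "Tb = {\<tau> \<in> T. t J < \<tau>}"
  have "t 1 < t J" "t J < t (n - 1)" using t_mono[of 1 J] t_mono[of J "n - 1"] J J1 by auto
  then have Ta: "finite Ta" "t 1 \<in> Ta" and Tb: "finite Tb" "t (n - 1) \<in> Tb"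
    using fin edge_stop by (auto simp: Ta_def Tb_def)
  define \<tau>a where "\<tau>a = Max Ta"
  define \<tau>b where "\<tau>b = Min Tb"
  have a: "\<tau>a \<in> Ta" "t 1 \<le> \<tau>a" "\<And>\<tau>. \<tau> \<in> Ta \<Longrightarrow> \<tau> \<le> \<tau>a"
    unfolding \<tau>a_def using Max_in[OF Ta(1)] Max_ge[OF Ta(1)] Ta(2) by blast+
  have b: "\<tau>b \<in> Tb" "\<tau>b \<le> t (n - 1)" "\<And>\<tau>. \<tau> \<in> Tb \<Longrightarrow> \<tau>b \<le> \<tau>"
    unfolding \<tau>b_def using Min_in[OF Tb(1)] Min_le[OF Tb(1)] Tb(2) by blast+
  obtain ka ra where sa: "stop ka ra" "\<gamma> \<tau>a = h 0 ka ra" and \<tau>a: "0 < \<tau>a" "\<tau>a < 1" "\<tau>a < t J"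
    using a(1) by (auto simp: Ta_def T_def)
  obtain kb rb where sb: "stop kb rb" "\<gamma> \<tau>b = h 0 kb rb" and \<tau>b: "0 < \<tau>b" "\<tau>b < 1" "t J < \<tau>b"
    using b(1) by (auto simp: Tb_def T_def)
  \<comment> \<open>Two stops of one ray are its visible vertex and its exit point. Here they would
    be on different sides of \<open>J\<close>, which makes the vertex a blocker.\<close>
  have ab: "ka \<noteq> kb"
  proof
    assume eq: "ka = kb"
    define k where "k = ka"
    have k: "0 < k" "k < n" using sa(1) by (auto simp: stop_def k_def)
    have K: "0 < n" "k < n" "0 \<noteq> k" using k by auto
    have "ra \<noteq> rb" using sa(2) sb(2) eq \<gamma>_inj[of \<tau>a \<tau>b] \<tau>a \<tau>b by auto
    then have e: "1 < extent 0 k" and r: "(ra = 1 \<and> rb = extent 0 k) \<or> (rb = 1 \<and> ra = extent 0 k)"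
      using sa(1) sb(1) eq by (auto simp: stop_def k_def)
    have sees: "sees n p \<L> 0 k" using sees_iff_extent[OF K] e by simp
    obtain \<tau> where \<tau>: "0 < \<tau>" "\<tau> < 1" "\<gamma> \<tau> = h 0 k (extent 0 k)" "\<And>v. v \<le> n \<Longrightarrow> \<tau> \<noteq> t v"
      using exit_param[OF k, of "extent 0 k"] e extent_Bd[OF K] by auto
    have vert: "h 0 k 1 = \<gamma> (t k)" using h1[OF K] \<gamma>t[OF k(2)] by simp
    have tk: "0 < t k" "t k < 1" using t01'[OF k] by auto
    from r show False
    proof
      assume r: "ra = 1 \<and> rb = extent 0 k"
      have "\<tau>a = t k" using \<gamma>_inj[of \<tau>a "t k"] sa(2) vert r tk \<tau>a by (auto simp: k_def)
      moreover have "\<tau>b = \<tau>" using \<gamma>_inj[of \<tau>b \<tau>] sb(2) r \<tau> \<tau>b eq by (auto simp: k_def)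
      ultimately have "k < J" "t J < \<tau>" using t_less_iff[of k J] \<tau>a \<tau>b k J by auto
      then show False using nb blocksI[OF J(1,2) k sees e, of \<tau>] \<tau> by metis
    next
      assume r: "rb = 1 \<and> ra = extent 0 k"
      have "\<tau>b = t k" using \<gamma>_inj[of \<tau>b "t k"] sb(2) vert r tk \<tau>b eq by (auto simp: k_def)
      moreover have "\<tau>a = \<tau>" using \<gamma>_inj[of \<tau>a \<tau>] sa(2) r \<tau> \<tau>a by (auto simp: k_def)
      ultimately have "J < k" "\<tau> < t J" using t_less_iff[of J k] \<tau>a \<tau>b k J by auto
      then show False using nb blocksI[OF J(1,2) k sees e, of \<tau>] \<tau> by metis
    qed
  qed
  interpret polygon_wedge n p \<L> \<gamma> t ka kb ra rb \<tau>a \<tau>b J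
  proof unfold_locales
    fix k r \<tau> assume s: "stop k r" and \<tau>: "\<tau>a < \<tau>" "\<tau> < \<tau>b"
    show "\<gamma> \<tau> \<noteq> h 0 k r"
    proof
      assume "\<gamma> \<tau> = h 0 k r"
      then have "\<tau> \<in> T" using s \<tau> \<tau>a \<tau>b by (auto simp: T_def)
      then have "\<tau> \<in> Ta \<or> \<tau> \<in> Tb" using notJ[of \<tau>] by (auto simp: Ta_def Tb_def)
      then show False using a(3)[of \<tau>] b(3)[of \<tau>] \<tau> by auto
    qed
  qed (use sa sb ab a b \<tau>a \<tau>b J in auto)
  show False by (rule wedge_impossible)
qed

end

text \<open>Vertices and edges get separate maps because a reversal that fixes vertex 0 sends vertex
  \<open>d > 0\<close> to \<open>n - d\<close>, but edge \<open>d\<close> to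
  \<open>n - 1 - d\<close>.\<close>

lemma reindex:
  assumes f: "\<And>d. p' d = p (f d)" and fn: "\<And>d. d < n \<Longrightarrow> f d < n" and inj: "inj_on f {..<n}"
    and g: "bij_betw g {..<n} {..<n}" and e: "\<And>d. d < n \<Longrightarrow> edge n p' \<L> d = edge n p \<L> (g d)"
  shows "boundary n p' \<L> = boundary n p \<L>"
    and "a < n \<Longrightarrow> b < n \<Longrightarrow> sees n p' \<L> a b \<longleftrightarrow> sees n p \<L> (f a) (f b)"
    and "m < n \<Longrightarrow> first_exits_through n p' \<L> a b m \<longleftrightarrow> first_exits_through n p \<L> (f a) (f b) (g m)"
proof -
  have "boundary n p' \<L> = (\<Union>d<n. edge n p \<L> (g d))" using e by (simp add: boundary_def)
  also have "\<dots> = \<Union> (edge n p \<L> ` (g ` {..<n}))" by (simp only: image_image)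
  also have "g ` {..<n} = {..<n}" using g by (simp add: bij_betw_def)
  finally show B: "boundary n p' \<L> = boundary n p \<L>" by (simp add: boundary_def)
  have L: "pline p' \<L> a b = pline p \<L> (f a) (f b)" for a b by (simp add: pline_def f)
  have S: "seg p' \<L> a b = seg p \<L> (f a) (f b)" for a b by (simp add: seg_def L f)
  show "sees n p' \<L> a b \<longleftrightarrow> sees n p \<L> (f a) (f b)" if "a < n" "b < n"
    using that fn inj_onD[OF inj, of a b] by (auto simp: sees_def B S)
  show "first_exits_through n p' \<L> a b m \<longleftrightarrow> first_exits_through n p \<L> (f a) (f b) (g m)" if "m < n"
    using e[OF that] by (simp add: first_exits_through_def L B f)
qed

lemma reindex_polygon_loop:
  assumes P: "polygon_loop n p \<L> \<gamma> t"
    and f: "\<And>d. p' d = p (f d)" and fb: "bij_betw f {..<n} {..<n}"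
    and g: "bij_betw g {..<n} {..<n}" and e: "\<And>d. d < n \<Longrightarrow> edge n p' \<L> d = edge n p \<L> (g d)"
    and loop': "simple_path \<gamma>'" "pathfinish \<gamma>' = pathstart \<gamma>'" "path_image \<gamma>' = path_image \<gamma>"
    and t': "strict_mono_on {..n} t'" "t' 0 = 0" "t' n = 1"
    and \<gamma>': "\<And>i. i < n \<Longrightarrow> \<gamma>' (t' i) = p' i" "\<And>i. i < n \<Longrightarrow> \<gamma>' ` {t' i..t' (Suc i)} = edge n p \<L> (g i)"
  shows "polygon_loop n p' \<L> \<gamma>' t'"
proof -
  interpret polygon_loop n p \<L> \<gamma> t by (rule P)
  have fn: "f d < n" if "d < n" for d using bij_betw_apply[OF fb, of d] that by simp
  have fi: "inj_on f {..<n}" using fb by (simp add: bij_betw_def)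
  have im: "p' ` {..<n} = p ` {..<n}"
  proof -
    have "p' ` {..<n} = p ` (f ` {..<n})" by (simp add: f image_image)
    then show ?thesis using fb by (simp add: bij_betw_def)
  qed
  note B = reindex(1)[OF f fn fi g e]
  show ?thesis
  proof
    show "inj_on p' {..<n}"
    proof (rule inj_onI)
      fix x y assume xy: "x \<in> {..<n}" "y \<in> {..<n}" "p' x = p' y"
      then have "f x = f y" using p_inj[of "f x" "f y"] fn by (simp add: f)
      then show "x = y" using fi xy by (simp add: inj_on_def)
    qed
    show "\<exists>!l. l \<in> \<L> \<and> p' i \<in> l \<and> p' j \<in> l" if "i < n" "j < n" "i \<noteq> j" for i j
    proof -
      have "f i \<noteq> f j" using inj_onD[OF fi, of i j] that by auto
      then show ?thesis using uniq[of "f i" "f j"] fn that by (simp add: f)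
    qed
    show "path_image \<gamma>' = boundary n p' \<L>" using B loop'(3) loop(3) by simp
    show "card (l \<inter> p' ` {..<n}) = 2" if "l \<in> \<L>" for l using two[OF that] im by simp
    show "\<gamma>' ` {t' i..t' (Suc i)} = edge n p' \<L> i" if "i < n" for i using \<gamma>'(2) e that by simp
  qed (use n3 arr loop' t' \<gamma>' in auto)
qed

section \<open>Rotation and reversal of the indices\<close>

lemma bij_rotate: "i < n \<Longrightarrow> bij_betw (\<lambda>d. (i + d) mod n) {..<n} {..<(n::nat)}"
proof -
  assume i: "i < n"
  have "inj_on (\<lambda>d. (i + d) mod n) {..<n}"
  proof (rule inj_onI)
    fix x y assume xy: "x \<in> {..<n}" "y \<in> {..<n}" "(i + x) mod n = (i + y) mod n"
    have "(i + z) mod n = (if i + z < n then i + z else i + z - n)" if "z < n" for z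
      using that i by (simp add: mod_if)
    then show "x = y" using xy i by (auto split: if_splits)
  qed
  moreover have "(\<lambda>d. (i + d) mod n) ` {..<n} \<subseteq> {..<n}" using i by auto
  ultimately show ?thesis by (simp add: bij_betw_def endo_inj_surj)
qed

lemma rotate_edge: "edge n (\<lambda>d. p ((i + d) mod n)) \<L> d = edge n p \<L> ((i + d) mod n)"
proof -
  have "(i + cyc_succ n d) mod n = cyc_succ n ((i + d) mod n)" by (simp add: cyc_succ_def mod_simps)
  then show ?thesis by (simp add: edge_def seg_def pline_def)
qed

lemma rotated_loop:
  assumes P: "polygon_loop n p \<L> \<gamma> t" and i: "i < n"
  obtains \<gamma>' t' where "polygon_loop n (\<lambda>d. p ((i + d) mod n)) \<L> \<gamma>' t'"
proof -
  interpret polygon_loop n p \<L> \<gamma> t by (rule P)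
  \<comment> \<open>\<open>T\<close> continues \<open>t\<close> into the next period of the loop;
    subtracting \<open>t i\<close> adapts it to the loop restarted at \<open>p i\<close>.\<close>
  define T where "T e = (if e \<le> n then t e else t (e - n) + 1)" for e
  define t' where "t' d = T (i + d) - t i" for d
  define \<gamma>' where "\<gamma>' = shiftpath (t i) \<gamma>"
  have ti: "0 \<le> t i" "t i < 1" using t01[of i] t_mono[of i n] t i by auto
  have \<gamma>'_low: "\<gamma>' x = \<gamma> (t i + x)" if "t i + x \<le> 1" for x using that by (simp add: \<gamma>'_def shiftpath_def)
  have \<gamma>'_high: "\<gamma>' x = \<gamma> (t i + x - 1)" if "1 \<le> t i + x" for x
    using that \<gamma>01 by (cases "t i + x = 1") (simp_all add: \<gamma>'_def shiftpath_def)
  have T_high: "T e = t (e - n) + 1" if "n \<le> e" for e using that t by (auto simp: T_def)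
  have T_less: "T x < T y" if xy: "x < y" "y \<le> n + i" for x y
  proof -
    consider "y \<le> n" | "x \<le> n" "n < y" | "n < x" using xy by linarith
    then show ?thesis
    proof cases
      case 1 then show ?thesis using t_mono[of x y] xy by (simp add: T_def)
    next
      case 2
      then have "t x \<le> 1" "0 < y - n" "y - n \<le> n" using t01(2)[of x] xy i by auto
      then show ?thesis using t_mono[of 0 "y - n"] t(2) 2 by (simp add: T_def)
    next
      case 3
      then show ?thesis using t_mono[of "x - n" "y - n"] xy i by (simp add: T_def)
    qed
  qed
  have tT: "t i + t' d = T (i + d)" for d by (simp add: t'_def)
  have "polygon_loop n (\<lambda>d. p ((i + d) mod n)) \<L> \<gamma>' t'"
  proof (rule reindex_polygon_loop[OF P, where f = "\<lambda>d. (i + d) mod n" and g = "\<lambda>d. (i + d) mod n"])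
    show "simple_path \<gamma>'" "pathfinish \<gamma>' = pathstart \<gamma>'" "path_image \<gamma>' = path_image \<gamma>"
      unfolding \<gamma>'_def
      using simple_path_shiftpath[OF loop(1,2)] closed_shiftpath[of \<gamma> "t i"] path_image_shiftpath[of "t i" \<gamma>] loop ti
      by auto
    show "strict_mono_on {..n} t'"
      by (rule strict_mono_onI) (use T_less in \<open>auto simp: t'_def\<close>)
    show "t' 0 = 0" using i by (simp add: t'_def T_def)
    show "t' n = 1" using T_high[of "i + n"] by (simp add: t'_def)
    fix d assume d: "d < n"
    show "\<gamma>' (t' d) = p ((i + d) mod n)"
    proof (cases "i + d \<le> n")
      case True
      then have "t i + t' d = t (i + d)" using tT by (simp add: T_def)
      moreover have "t (i + d) \<le> 1" using t01 True by blast
      ultimately have "\<gamma>' (t' d) = \<gamma> (t (i + d))" using \<gamma>'_low[of "t' d"] by simp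
      also have "\<dots> = p ((i + d) mod n)" using \<gamma>t[of "i + d"] \<gamma>01 t True by (cases "i + d = n") auto
      finally show ?thesis .
    next
      case False
      then have a: "t i + t' d = t (i + d - n) + 1" using tT by (simp add: T_def)
      have e: "i + d - n < n" "(i + d) mod n = i + d - n" using False i d by (auto simp: mod_if)
      have "0 \<le> t (i + d - n)" using t01(1)[of "i + d - n"] e by simp
      then have "\<gamma>' (t' d) = \<gamma> (t (i + d - n))" using \<gamma>'_high[of "t' d"] a by simp
      then show ?thesis using \<gamma>t[OF e(1)] e(2) by simp
    qed
    show "\<gamma>' ` {t' d..t' (Suc d)} = edge n p \<L> ((i + d) mod n)"
    proof (cases "i + d < n")
      case True
      have a: "t i + t' d = t (i + d)" "t i + t' (Suc d) = t (Suc (i + d))"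
        using tT[of d] tT[of "Suc d"] True by (simp_all add: T_def)
      have "t (Suc (i + d)) \<le> 1" using t01[of "Suc (i + d)"] True by simp
      then have "\<gamma>' ` {t' d..t' (Suc d)} = (\<lambda>x. \<gamma> (t i + x)) ` {t' d..t' (Suc d)}"
        using a by (intro image_cong[OF refl] \<gamma>'_low) auto
      also have "\<dots> = \<gamma> ` ((+) (t i) ` {t' d..t' (Suc d)})" by (simp only: image_image)
      also have "(+) (t i) ` {t' d..t' (Suc d)} = {t (i + d)..t (Suc (i + d))}"
        using a by (simp add: add.commute)
      finally show ?thesis using \<gamma>edge[OF True] True by simp
    next
      case False
      define e where "e = i + d - n"
      have e: "e < n" "(i + d) mod n = e" "Suc (i + d) - n = Suc e" using False i d by (auto simp: e_def mod_if)
      have a: "t i + t' d = t e + 1" "t i + t' (Suc d) = t (Suc e) + 1"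
        using tT[of d] tT[of "Suc d"] T_high[of "i + d"] T_high[of "Suc (i + d)"] False e by (simp_all add: e_def)
      have "0 \<le> t e" using t01[of e] e by simp
      then have "\<gamma>' ` {t' d..t' (Suc d)} = (\<lambda>x. \<gamma> (t i + x - 1)) ` {t' d..t' (Suc d)}"
        using a by (intro image_cong[OF refl] \<gamma>'_high) auto
      also have "\<dots> = (\<lambda>x. \<gamma> ((t i - 1) + x)) ` {t' d..t' (Suc d)}" by (simp add: algebra_simps)
      also have "\<dots> = \<gamma> ` ((+) (t i - 1) ` {t' d..t' (Suc d)})" by (simp only: image_image)
      also have "(+) (t i - 1) ` {t' d..t' (Suc d)} = {t e..t (Suc e)}"
      proof -
        have b: "t' d + (t i - 1) = t e" "t' (Suc d) + (t i - 1) = t (Suc e)" using a by linarith+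
        show ?thesis by (simp only: image_add_atLeastAtMost b)
      qed
      finally show ?thesis using \<gamma>edge[OF e(1)] e(2) by simp
    qed
  qed (use bij_rotate[OF i] rotate_edge in auto)
  then show thesis by (rule that)
qed

context polygon_loop
begin

text \<open>The reflection of the cyclic order that keeps the viewpoint 0; the reduction
  \<open>mod n\<close> serves the case \<open>d = 0\<close>.\<close>

definition rev_index :: "nat \<Rightarrow> nat" where "rev_index d = (n - d) mod n"

lemma rev_index: "rev_index 0 = 0" "0 < d \<Longrightarrow> rev_index d = n - d"
  using n3 by (auto simp: rev_index_def)

lemma bij_rev_index: "bij_betw rev_index {..<n} {..<n}"
proof -
  have "inj_on rev_index {..<n}"
  proof (rule inj_onI)
    fix x y assume "x \<in> {..<n}" "y \<in> {..<n}" "rev_index x = rev_index y"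
    then show "x = y" using rev_index by (cases "x = 0"; cases "y = 0") auto
  qed
  moreover have "rev_index ` {..<n} \<subseteq> {..<n}" using n3 by (auto simp: rev_index_def)
  ultimately show ?thesis by (simp add: bij_betw_def endo_inj_surj)
qed

lemma bij_rev_edge: "bij_betw (\<lambda>d. n - 1 - d) {..<n} {..<n}"
  by (rule bij_betw_byWitness[of _ "\<lambda>d. n - 1 - d"]) auto

lemma rev_edge: assumes "d < n" shows "edge n (\<lambda>d. p (rev_index d)) \<L> d = edge n p \<L> (n - 1 - d)"
proof -
  have m: "n - 1 - d < n" using assms by simp
  have r: "rev_index (cyc_succ n d) = n - 1 - d"
    using assms rev_index by (auto simp: cyc_succ_Suc)
  have s: "rev_index d = cyc_succ n (n - 1 - d)"
    using assms rev_index(1) rev_index(2)[of d] by (cases "d = 0") (auto simp: cyc_succ_Suc)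
  have "edge n (\<lambda>d. p (rev_index d)) \<L> d = seg p \<L> (cyc_succ n (n - 1 - d)) (n - 1 - d)"
    by (simp add: edge_def seg_def pline_def r s)
  then show ?thesis
    using seg_commute[of "n - 1 - d" "cyc_succ n (n - 1 - d)"] cyc_succ[OF m] m by (simp add: edge_def)
qed

lemma reversed_loop: "polygon_loop n (\<lambda>d. p (rev_index d)) \<L> (reversepath \<gamma>) (\<lambda>d. 1 - t (n - d))"
proof (rule reindex_polygon_loop[OF polygon_loop_axioms _ bij_rev_index bij_rev_edge rev_edge])
  show "simple_path (reversepath \<gamma>)" "pathfinish (reversepath \<gamma>) = pathstart (reversepath \<gamma>)"
    "path_image (reversepath \<gamma>) = path_image \<gamma>"
    using loop(1,2) by (simp_all add: simple_path_reversepath)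
  show "strict_mono_on {..n} (\<lambda>d. 1 - t (n - d))"
    by (rule strict_mono_onI) (auto intro!: t_mono)
  show "1 - t (n - 0) = 0" "1 - t (n - n) = 1" using t by simp_all
  fix d assume d: "d < n"
  show "reversepath \<gamma> (1 - t (n - d)) = p (rev_index d)"
    using d \<gamma>t[of "n - d"] \<gamma>01 t rev_index(1) rev_index(2)[of d] by (cases "d = 0") (auto simp: reversepath_def)
  have "n - d = Suc (n - 1 - d)" "n - Suc d = n - 1 - d" using d by auto
  then have "reversepath \<gamma> ` {1 - t (n - d)..1 - t (n - Suc d)} = \<gamma> ` ((-) 1 ` {1 - t (Suc (n - 1 - d))..1 - t (n - 1 - d)})"
    by (simp only: reversepath_def image_image)
  also have "\<dots> = \<gamma> ` {t (n - 1 - d)..t (Suc (n - 1 - d))}" by simp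
  also have "\<dots> = edge n p \<L> (n - 1 - d)" using \<gamma>edge[of "n - 1 - d"] d by simp
  finally show "reversepath \<gamma> ` {1 - t (n - d)..1 - t (n - Suc d)} = edge n p \<L> (n - 1 - d)" .
qed auto

lemma rev_sees: "a < n \<Longrightarrow> b < n \<Longrightarrow> sees n (\<lambda>d. p (rev_index d)) \<L> a b \<longleftrightarrow> sees n p \<L> (rev_index a) (rev_index b)"
  using bij_betw_apply[OF bij_rev_index] bij_betw_imp_inj_on[OF bij_rev_index]
  by (intro reindex(2)[OF _ _ _ bij_rev_edge rev_edge]) auto

lemma rev_first_exits: "m < n \<Longrightarrow> first_exits_through n (\<lambda>d. p (rev_index d)) \<L> a b m \<longleftrightarrow>
    first_exits_through n p \<L> (rev_index a) (rev_index b) (n - 1 - m)"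
  using bij_betw_apply[OF bij_rev_index] bij_betw_imp_inj_on[OF bij_rev_index]
  by (intro reindex(3)[OF _ _ _ bij_rev_edge rev_edge]) auto

lemma rev_blocks:
  assumes J: "0 < J" "J < n" and b: "blocks n p \<L> J k" "J < k"
  shows "blocks n (\<lambda>d. p (rev_index d)) \<L> (n - J) (n - k)"
proof -
  have k: "0 < k" "k < n" "sees n p \<L> 0 k" using b by (auto simp: blocks_def)
  obtain m where m: "m < J" "first_exits_through n p \<L> 0 k m" using b by (auto simp: blocks_def)
  have r: "rev_index (n - k) = k" using rev_index(2)[of "n - k"] k by simp
  have "sees n (\<lambda>d. p (rev_index d)) \<L> 0 (n - k)" using rev_sees[of 0 "n - k"] r k rev_index(1) by simp
  moreover have "first_exits_through n (\<lambda>d. p (rev_index d)) \<L> 0 (n - k) (n - 1 - m)"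
    using rev_first_exits[of "n - 1 - m" 0 "n - k"] r rev_index(1) m J by simp
  moreover have "n - 1 - m \<in> {n - J..<n}" using m J by auto
  ultimately show ?thesis using k b(2) J unfolding blocks_def by auto
qed

text \<open>The mirror image of \<open>blocks_separates\<close> under \<open>rev_index\<close>. On
  this side the viewpoint is the far end \<open>u = n\<close>, hence \<open>u mod n\<close>.\<close>

lemma blocks_separates_right:
  assumes J: "0 < J" "J < n" "\<not> sees n p \<L> 0 J" and b: "blocks n p \<L> J k" "J < k"
    and su: "J \<le> s" "s < k" "k < u" "u \<le> n"
  shows "\<not> sees n p \<L> s (u mod n)"
proof
  assume see: "sees n p \<L> s (u mod n)"
  have k: "k < n" using b by (auto simp: blocks_def)
  have r: "rev_index (n - s) = s" "rev_index (n - J) = J" "rev_index (n - u) = u mod n"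
    using rev_index(2)[of "n - s"] rev_index(2)[of "n - J"] rev_index(1) rev_index(2)[of "n - u"] su J k
    by (cases "u = n"; auto)+
  have "\<not> sees n (\<lambda>d. p (rev_index d)) \<L> 0 (n - J)" using rev_sees[of 0 "n - J"] r rev_index(1) J by simp
  then have "\<not> sees n (\<lambda>d. p (rev_index d)) \<L> (n - u) (n - s)"
    using polygon_loop.blocks_separates[OF reversed_loop _ _ _ rev_blocks[OF J(1,2) b], of "n - u" "n - s"] J b(2) su k by simp
  then have "\<not> sees n p \<L> (u mod n) s" using rev_sees[of "n - u" "n - s"] r su J k by simp
  then show False using see sees_commute by simp
qed

text \<open>Of two blockers on the same side of \<open>J\<close>, the one farther from
  \<open>J\<close> would hide the other from \<open>p 0\<close>. Blockers on opposite sides are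
  excluded by \<open>blocks_opposite\<close>.\<close>

lemma blocks_unique:
  assumes J: "0 < J" "J < n" "\<not> sees n p \<L> 0 J" and b: "blocks n p \<L> J k" "blocks n p \<L> J k'"
  shows "k = k'"
proof -
  have bs: "0 < x \<and> x < n \<and> sees n p \<L> 0 x \<and> x \<noteq> J" if "blocks n p \<L> J x" for x
    using that by (auto simp: blocks_def)
  have False if xy: "blocks n p \<L> J x" "blocks n p \<L> J y" "x < y" for x y
  proof -
    note x = bs[OF xy(1)] and y = bs[OF xy(2)]
    consider "y < J" | "x < J" "J < y" | "J < x" using x y xy(3) by linarith
    then show False
    proof cases
      case 1
      then show False using blocks_separates[OF J xy(1), of 0 y] x y xy(3) by simp
    next
      case 2
      then show False using blocks_opposite[OF J(1,2) xy(1) _ xy(2)] by simp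
    next
      case 3
      then show False
        using blocks_separates_right[OF J xy(2), of x n] x y xy(3) sees_commute[of x 0] by simp
    qed
  qed
  then show ?thesis using b by (metis linorder_neqE_nat)
qed

end

section \<open>Cyclic walks, and the passage from viewpoint 0 to an arbitrary vertex\<close>

lemma pseudo_polygon_loop:
  assumes "pseudo_polygon n p \<L>" obtains \<gamma> t where "polygon_loop n p \<L> \<gamma> t"
proof -
  have conf: "pseudo_configuration n p \<L>" and ccw: "ccw_indexed n p \<L>"
    using assms by (auto simp: pseudo_polygon_def)
  obtain \<gamma> t where g: "simple_path \<gamma>" "pathfinish \<gamma> = pathstart \<gamma>" "path_image \<gamma> = boundary n p \<L>"
    "strict_mono_on {..n} t" "t 0 = 0" "t n = 1"
    "\<forall>i<n. \<gamma> (t i) = p i \<and> \<gamma> ` {t i..t (i + 1)} = edge n p \<L> i"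
    using ccw unfolding ccw_indexed_def by blast
  have "polygon_loop n p \<L> \<gamma> t"
    by unfold_locales (use conf g in \<open>auto simp: pseudo_configuration_def\<close>)
  then show thesis by (rule that)
qed

text \<open>Walks are described by offsets from \<open>i\<close>, where the offset \<open>n\<close>
  may stand for the return to \<open>i\<close>. A walk takes fewer than \<open>n\<close> steps,
  hence the bound on \<open>B - A\<close>.\<close>

lemma walk:
  assumes "A \<le> B" "B - A < n"
  shows "walk_vertices n ((i + A) mod n) ((i + B) mod n) = (\<lambda>d. (i + d) mod n) ` {A..B}"
    and "walk_edges n ((i + A) mod n) ((i + B) mod n) = (\<lambda>d. (i + d) mod n) ` {A..<B}"
proof -
  define x where "x = (i + A) mod n"
  have x: "x < n" using assms by (simp add: x_def)
  have "i + A + (B - A) = i + B" using assms(1) by simp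
  then have B: "(i + B) mod n = (x + (B - A)) mod n" unfolding x_def mod_add_left_eq by (simp only:)
  have len: "((i + B) mod n + n - x) mod n = B - A"
  proof (cases "x + (B - A) < n")
    case True
    then have "(i + B) mod n + n - x = (B - A) + n" unfolding B by simp
    then show ?thesis using assms(2) by simp
  next
    case False
    then have "(x + (B - A)) mod n = x + (B - A) - n"
      using x assms(2) by (simp add: le_mod_geq)
    then have "(i + B) mod n + n - x = B - A" unfolding B using False by simp
    then show ?thesis using assms(2) by simp
  qed
  have shift: "(x + d) mod n = (i + (A + d)) mod n" for d by (simp add: x_def mod_simps add.assoc)
  have "(\<lambda>d. (x + d) mod n) ` S = (\<lambda>d. (i + d) mod n) ` ((+) A ` S)" for S
    by (simp only: shift image_image)
  moreover have "(+) A ` {..B - A} = {A..B}" "(+) A ` {..<B - A} = {A..<B}"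
    using assms(1) image_add_atLeastAtMost[of A 0 "B - A"] image_add_atLeastLessThan[of A 0 "B - A"]
    by (simp_all add: atLeast0AtMost lessThan_atLeast0)
  ultimately show "walk_vertices n ((i + A) mod n) ((i + B) mod n) = (\<lambda>d. (i + d) mod n) ` {A..B}"
    "walk_edges n ((i + A) mod n) ((i + B) mod n) = (\<lambda>d. (i + d) mod n) ` {A..<B}"
    by (simp_all add: walk_vertices_def walk_edges_def x_def[symmetric] len)
qed

theorem lemma3:
  fixes n :: nat and p :: "nat \<Rightarrow> complex" and \<L> :: "complex set set" and i j :: nat
  assumes "pseudo_polygon n p \<L>"
    and "invisible_pair n p \<L> i j"
  shows "(\<exists>!k. designated_blocker n p \<L> i j k) \<and>
         (\<forall>k. designated_blocker n p \<L> i j k \<longrightarrow>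
              candidate_blocker n (visibility_graph n p \<L>) i j k)"
proof -
  obtain \<gamma>0 t0 where P0: "polygon_loop n p \<L> \<gamma>0 t0" using pseudo_polygon_loop[OF assms(1)] by blast
  have ij: "i < n" "j < n" "i \<noteq> j" "\<not> sees n p \<L> i j" using assms(2) by (auto simp: invisible_pair_def)
  define f where "f d = (i + d) mod n" for d
  define p' where "p' d = p (f d)" for d
  obtain \<gamma> t where P: "polygon_loop n p' \<L> \<gamma> t"
    using rotated_loop[OF P0 ij(1)] unfolding p'_def f_def by blast
  interpret Q: polygon_loop n p' \<L> \<gamma> t by (rule P)
  have fb: "bij_betw f {..<n} {..<n}" using bij_rotate[OF ij(1)] by (simp add: f_def[abs_def])
  have fn: "f d < n" for d using ij by (simp add: f_def)
  have f0: "f 0 = i" "f n = i" using ij by (simp_all add: f_def)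
  have finj: "f a = f b \<longleftrightarrow> a = b" if "a < n" "b < n" for a b
    using inj_onD[OF bij_betw_imp_inj_on[OF fb], of a b] that by auto
  have fsurj: "\<exists>d<n. k = f d" if "k < n" for k
    using bij_betw_imp_surj_on[OF fb] that by (metis imageE lessThan_iff)
  have e: "edge n p' \<L> d = edge n p \<L> (f d)" for d
    using rotate_edge[of n p i \<L> d] by (simp add: p'_def[abs_def] f_def)
  note re = reindex[of p' p f n f \<L>, OF p'_def fn bij_betw_imp_inj_on[OF fb] fb e]
  have fmod: "f (d mod n) = f d" for d by (simp add: f_def mod_simps)
  have see: "sees n p \<L> (f a) (f b) \<longleftrightarrow> sees n p' \<L> a b" if "a < n" "b < n" for a b using re(2) that by simp
  have fe: "first_exits_through n p \<L> i (f k) (f m) \<longleftrightarrow> first_exits_through n p' \<L> 0 k m" if "m < n" for k m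
    using re(3)[OF that, of 0 k] f0 by simp
  have VG: "{a, b} \<in> visibility_graph n p \<L> \<longleftrightarrow> sees n p \<L> a b" for a b
    using polygon_loop.sees_commute[OF P0, of a b] by (auto simp: visibility_graph_def doubleton_eq_iff)
  obtain J where J: "J < n" "j = f J" using fsurj[OF ij(2)] by blast
  have J0: "0 < J" using J ij f0 by (cases J) auto
  have inv: "\<not> sees n p' \<L> 0 J" using see[of 0 J] ij J f0 by simp
  have w1: "walk_vertices n i j = f ` {0..J}" "walk_edges n i j = f ` {0..<J}"
    using walk[of 0 J n i] J ij by (simp_all add: f_def[abs_def])
  have w2: "walk_vertices n j i = f ` {J..n}" "walk_edges n j i = f ` {J..<n}"
    using walk[of J n n i] J J0 ij by (simp_all add: f_def[abs_def])
  have db: "designated_blocker n p \<L> i j (f d) \<longleftrightarrow> blocks n p' \<L> J d" if d: "d < n" for d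
  proof (cases "d = 0")
    case True
    then show ?thesis using f0 by (simp add: designated_blocker_def blocks_def)
  next
    case False
    have "f d \<in> f ` {0..J} \<longleftrightarrow> d \<le> J"
      using finj d J by (auto simp: image_iff)
    \<comment> \<open>The offset \<open>n\<close> also denotes \<open>i\<close>, which is no
      conflict since \<open>d\<close> is not 0 here.\<close>
    moreover have "f d \<in> f ` {J..n} \<longleftrightarrow> J \<le> d"
    proof
      assume "f d \<in> f ` {J..n}"
      then obtain u where u: "u \<in> {J..n}" "f d = f u" by blast
      then have "u \<noteq> n" using f0 finj[of d 0] d False by auto
      then show "J \<le> d" using u finj[of d u] d by auto
    qed (use d in auto)
    moreover have "(\<exists>m\<in>f ` {J..<n}. first_exits_through n p \<L> i (f d) m) \<longleftrightarrow> (\<exists>m\<in>{J..<n}. first_exits_through n p' \<L> 0 d m)"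
      using fe by auto
    moreover have "(\<exists>m\<in>f ` {0..<J}. first_exits_through n p \<L> i (f d) m) \<longleftrightarrow> (\<exists>m<J. first_exits_through n p' \<L> 0 d m)"
      using fe J by (auto simp: Bex_def)
    moreover have "f d \<noteq> i" "f d \<noteq> j \<longleftrightarrow> d \<noteq> J" using finj[of d 0] finj[of d J] f0 J d False by auto
    moreover have "sees n p \<L> i (f d) \<longleftrightarrow> sees n p' \<L> 0 d" using see[of 0 d] d f0 by simp
    ultimately show ?thesis
      unfolding designated_blocker_def blocks_def w1 w2 using d False by auto
  qed
  obtain d0 where d0: "blocks n p' \<L> J d0" using Q.blocks_exists[OF J0 J(1) inv] by blast
  have d0n: "0 < d0" "d0 < n" "sees n p' \<L> 0 d0" "d0 \<noteq> J" using d0 by (auto simp: blocks_def)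
  have only: "k = f d0" if "designated_blocker n p \<L> i j k" for k
  proof -
    have "k < n" using that by (simp add: designated_blocker_def sees_def)
    then obtain d where d: "d < n" "k = f d" using fsurj by blast
    then have "blocks n p' \<L> J d" using db that by simp
    then have "d = d0" using Q.blocks_unique[OF J0 J(1) inv] d0 by blast
    then show ?thesis using d by simp
  qed
  have pred: "cyc_pred n (f d0) = f (d0 - 1)"
  proof -
    have "(f d0 + n - 1) mod n = (f d0 + (n - 1)) mod n" using d0n by simp
    also have "\<dots> = (i + d0 + (n - 1)) mod n" by (simp add: f_def mod_simps)
    also have "i + d0 + (n - 1) = (i + (d0 - 1)) + n" using d0n by simp
    finally show ?thesis by (simp add: cyc_pred_def f_def)
  qed
  have succ: "cyc_succ n (f d0) = f (d0 + 1)" by (simp add: cyc_succ_def f_def mod_simps)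
  have w: "walk_vertices n (f A) (f B) = f ` {A..B}" if "A \<le> B" "B - A < n" for A B
    using walk(1)[OF that] by (simp add: f_def[abs_def])
  have "candidate_blocker n (visibility_graph n p \<L>) i j (f d0)"
  proof (cases "d0 < J")
    case True
    \<comment> \<open>Both remaining clauses of the candidate condition are instances:
      \<open>s = 0\<close> shows that \<open>f d0\<close> is the first visible vertex met from
      \<open>j\<close>, and all \<open>s < d0\<close> give the absence of separating visible
      pairs.\<close>
    have sep: "\<not> sees n p \<L> (f s) (f u)" if "s < d0" "d0 < u" "u \<le> J" for s u
      using Q.blocks_separates[OF J0 J(1) inv d0 True that] see[of s u] that d0n J by simp
    have "walk_vertices n i (f (d0 - 1)) = f ` {0..d0 - 1}" using w[of 0 "d0 - 1"] f0 d0n by simp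
    moreover have "walk_vertices n (f d0) j = f ` {d0..J}" "walk_vertices n (f (d0 + 1)) j = f ` {d0 + 1..J}"
      using w[of d0 J] w[of "d0 + 1" J] True J by auto
    moreover have "f d0 \<in> f ` {0..J}" using True by simp
    moreover have "sees n p \<L> i (f d0)" using see[of 0 d0] d0n f0 by simp
    moreover have "\<not> sees n p \<L> i l" if l: "l \<in> f ` {d0..J}" "l \<noteq> f d0" for l
    proof -
      obtain u where u: "u \<in> {d0..J}" "l = f u" using l(1) by blast
      then have "d0 < u" using l(2) by (cases "u = d0") auto
      then show ?thesis using sep[of 0 u] u d0n f0 by simp
    qed
    moreover have "\<not> (\<exists>s\<in>f ` {0..d0 - 1}. \<exists>u\<in>f ` {d0 + 1..J}. sees n p \<L> s u)" using sep d0n by auto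
    ultimately show ?thesis
      unfolding candidate_blocker_def VG pred succ w1 by blast
  next
    case False
    then have Jd: "J < d0" using d0n by simp
    \<comment> \<open>On this side the viewpoint has the offset \<open>n\<close>, so
      \<open>u = n\<close> plays the part that \<open>s = 0\<close> has on the other side.\<close>
    have sep: "\<not> sees n p \<L> (f s) (f u)" if "J \<le> s" "s < d0" "d0 < u" "u \<le> n" for s u
      using Q.blocks_separates_right[OF J0 J(1) inv d0 Jd that] see[of s "u mod n"] that d0n fmod by simp
    have "walk_vertices n j (f d0) = f ` {J..d0}" "walk_vertices n j (f (d0 - 1)) = f ` {J..d0 - 1}"
      using w[of J d0] w[of J "d0 - 1"] J Jd d0n by auto
    moreover have "walk_vertices n (f (d0 + 1)) i = f ` {d0 + 1..n}" using w[of "d0 + 1" n] f0 d0n by auto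
    moreover have "f d0 \<in> f ` {J..n}" using Jd d0n by simp
    moreover have "sees n p \<L> i (f d0)" using see[of 0 d0] d0n f0 by simp
    moreover have "\<not> sees n p \<L> i l" if l: "l \<in> f ` {J..d0}" "l \<noteq> f d0" for l
    proof -
      obtain u where u: "u \<in> {J..d0}" "l = f u" using l(1) by blast
      then have "u < d0" using l(2) by (cases "u = d0") auto
      then show ?thesis using sep[of u n] u d0n f0 polygon_loop.sees_commute[OF P0, of i l] by simp
    qed
    moreover have "\<not> (\<exists>s\<in>f ` {J..d0 - 1}. \<exists>u\<in>f ` {d0 + 1..n}. sees n p \<L> s u)" using sep Jd by auto
    ultimately show ?thesis
      unfolding candidate_blocker_def VG pred succ w2 by blast
  qed
  then show ?thesis using only db[OF d0n(2)] d0 by metis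
qed

end
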